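(* Let $\mathbf{U}_l,\mathbf{V}_l,\mathbf{N}_l,\mathbf{M}_l,\mathbf{U}_r,\mathbf{V}_r,\mathbf{N}_r,\mathbf{M}_r\in\mathcal{RH}_\infty$ be a doubly-coprime factorization of the plant $\mathbf{G}$, so that in particular $\mathbf{G}=\mathbf{M}_l^{-1}\mathbf{N}_l$, and let $\mathbf{M}_l,\mathbf{N}_l$ have the state-space realization $$\mathbf{M}_l(z)=C(zI-A)^{-1}B_M+D_M,\qquad \mathbf{N}_l(z)=C(zI-A)^{-1}B_N+D_N,$$ where $A$ is a real square matrix with all eigenvalues in the open unit disc. Let $\epsilon>0$. There exist $\mathbf{X},\mathbf{Y}\in\mathcal{RH}_\infty$ such that $$\|\mathbf{M}_l(z)\mathbf{X}(z)-\mathbf{N}_l(z)\mathbf{Y}(z)-I\|_\infty<\epsilon$$ if and only if there exist real symmetric matrices $X,Z$ and real matrices $Q,F,L_X,L_Y,R_X,R_Y$ of compatible size such that $$\begin{bmatrix} X & Z & f_1 & f_2 & f_3 & 0\\ \star & Z & Q & Q & F & 0\\ \star & \star & X & Z & 0 & f_4\\ \star & \star & \star & Z & 0 & f_5\\ \star & \star & \star & \star & I & f_6\\ \star & \star & \star & \star & \star & \epsilon^2 I \end{bmatrix}\succ 0,$$ where $$\begin{aligned} f_1&=AX+B_ML_X-B_NL_Y, & f_2&=AZ+B_ML_X-B_NL_Y,\\ f_3&=B_MR_X-B_NR_Y, & f_4&=X^{\mathsf T}C^{\mathsf T}+L_X^{\mathsf T}D_M^{\mathsf T}-L_Y^{\mathsf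 T}D_N^{\mathsf T},\\ f_5&=Z^{\mathsf T}C^{\mathsf T}+L_X^{\mathsf T}D_M^{\mathsf T}-L_Y^{\mathsf T}D_N^{\mathsf T}, & f_6&=R_X^{\mathsf T}D_M^{\mathsf T}-R_Y^{\mathsf T}D_N^{\mathsf T}-I. \end{aligned}$$ Moreover, if this matrix inequality holds, then $\mathbf{X},\mathbf{Y}\in\mathcal{RH}_\infty$ satisfying $\|\mathbf{M}_l\mathbf{X}-\mathbf{N}_l\mathbf{Y}-I\|_\infty<\epsilon$ are given by the state-space realizations $\mathbf{X}(z)=\hat C_X(zI-\hat A)^{-1}\hat B+\hat D_X$ and $\mathbf{Y}(z)=\hat C_Y(zI-\hat A)^{-1}\hat B+\hat D_Y$ with $$\begin{bmatrix}\hat A&\hat B\\\hat C_X&\hat D_X\\\hat C_Y&\hat D_Y\end{bmatrix}=\begin{bmatrix}U^{\mathsf T}Z^{-1}&0&0\\0&I&0\\0&0&I\end{bmatrix}\begin{bmatrix}Q&F\\L_X&R_X\\L_Y&R_Y\end{bmatrix}\begin{bmatrix}U^{-1}&0\\0&I\end{bmatrix}^{\mathsf T},$$ where $U$ is an arbitrary non-singular real matrix of the same size as $A$.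
   Context: $\mathcal{RH}_\infty$ denotes the set of real-rational proper stable transfer matrices in discrete time (all poles in the open unit disc), of whatever dimensions are compatible; $\|\cdot\|_\infty$ is the $\mathcal{H}_\infty$ norm, $\|\mathbf{T}\|_\infty=\sup_{|z|=1}\sigma_{\max}(\mathbf{T}(z))$. In the block matrix, $\star$ denotes the blocks determined by symmetry, and $\succ0$ means symmetric positive definite. The transfer matrices $\mathbf{X},\mathbf{Y}$ and the matrix variable $X$ are different objects. Plant: $\mathbf{G}(z)=C_p(zI-A_p)^{-1}B_p$ is a strictly proper $p\times m$ transfer matrix with $(A_p,B_p)$ stabilizable and $(C_p,A_p)$ detectable. Doubly-coprime factorization of $\mathbf{G}$: a collection $\mathbf{U}_l,\mathbf{V}_l,\mathbf{N}_l,\mathbf{M}_l,\mathbf{U}_r,\mathbf{V}_r,\mathbf{N}_r,\mathbf{M}_r\in\mathcal{RH}_\infty$ such that $\mathbf{G}=\mathbf{N}_r\mathbf{M}_r^{-1}=\mathbf{M}_l^{-1}\mathbf{N}_l$ and $$\begin{bmatrix}\mathbf{U}_l&-\mathbf{V}_l\\-\mathbf{N}_l&\mathbf{M}_l\end{bmatrix}\begin{bmatrix}\mathbf{M}_r&\mathbf{V}_r\\\mathbf{N}_r&\mathbf{U}_r\end{bmatrix}=I.$$ Dimensions: $\mathbf{M}_l$ and $\mathbf{X}$ are $p\times p$, $\mathbf{N}_l$ is $p\times m$, $\mathbf{Y}$ is $m\times p$; if $A$ is $k\times k$ then $X,Z,Q\in\mathbb{R}^{k\times k}$, $F\in\mathbb{R}^{k\times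 p}$, $L_X\in\mathbb{R}^{p\times k}$, $L_Y\in\mathbb{R}^{m\times k}$, $R_X\in\mathbb{R}^{p\times p}$, $R_Y\in\mathbb{R}^{m\times p}$. (The matrices $A,C$ of the realization of $\mathbf{M}_l,\mathbf{N}_l$ need not equal $A_p,C_p$.) *)

theory Defs
  imports
    "HOL-Computational_Algebra.Computational_Algebra"
    "HOL-Computational_Algebra.Field_as_Ring"
    "Jordan_Normal_Form.Schur_Decomposition"
    "Jordan_Normal_Form.Gauss_Jordan_Elimination"
begin

text \<open>Unspecified unless \<open>M\<close> is invertible.\<close>

definition mat_inv :: "'a::field mat \<Rightarrow> 'a mat" where
  "mat_inv M = the (mat_inverse M)"

definition append_cols :: "'a::zero mat \<Rightarrow> 'a mat \<Rightarrow> 'a mat" (infixr \<open>@\<^sub>c\<close> 66) where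
  "M @\<^sub>c N = four_block_mat M N (0\<^sub>m 0 (dim_col M)) (0\<^sub>m 0 (dim_col N))"

definition sym_mat :: "real mat \<Rightarrow> bool" where
  "sym_mat M \<longleftrightarrow> square_mat M \<and> M\<^sup>T = M"

definition pos_def :: "real mat \<Rightarrow> bool" where
  "pos_def M \<longleftrightarrow> sym_mat M \<and>
     (\<forall>v \<in> carrier_vec (dim_row M). v \<noteq> 0\<^sub>v (dim_row M) \<longrightarrow> v \<bullet> (M *\<^sub>v v) > 0)"

definition schur_stable :: "real mat \<Rightarrow> bool" where
  "schur_stable M \<longleftrightarrow> (\<forall>\<mu>. eigenvalue (map_mat complex_of_real M) \<mu> \<longrightarrow> cmod \<mu> < 1)"

definition stabilizable :: "real mat \<Rightarrow> real mat \<Rightarrow> bool" where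
  "stabilizable A B \<longleftrightarrow>
     (\<exists>K \<in> carrier_mat (dim_col B) (dim_row A). schur_stable (A + B * K))"

definition detectable :: "real mat \<Rightarrow> real mat \<Rightarrow> bool" where
  "detectable C A \<longleftrightarrow>
     (\<exists>L \<in> carrier_mat (dim_row A) (dim_row C). schur_stable (A + L * C))"

text \<open>
  A transfer matrix is a matrix over the field of real rational functions. Identities between
  transfer matrices, inverses and realizations are thus identities of rational functions, and
  junk values at poles play no role.
\<close>

type_synonym rfun = "real poly fract"

definition rf_num :: "rfun \<Rightarrow> real poly" where
  "rf_num f = fst (quot_of_fract f)"

definition rf_den :: "rfun \<Rightarrow> real poly" where
  "rf_den f = snd (quot_of_fract f)"

definition rf_eval :: "rfun \<Rightarrow> complex \<Rightarrow> complex" where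
  "rf_eval f z = poly (map_poly of_real (rf_num f)) z / poly (map_poly of_real (rf_den f)) z"

text \<open>\<^const>\<open>quot_of_fract\<close> is in lowest terms, so the poles are the roots of the denominator.\<close>

definition rf_poles :: "rfun \<Rightarrow> complex set" where
  "rf_poles f = {z. poly (map_poly of_real (rf_den f)) z = 0}"

definition rf_proper :: "rfun \<Rightarrow> bool" where
  "rf_proper f \<longleftrightarrow> degree (rf_num f) \<le> degree (rf_den f)"

definition RH_inf :: "nat \<Rightarrow> nat \<Rightarrow> rfun mat set" where
  "RH_inf r c = {T \<in> carrier_mat r c. \<forall>i<r. \<forall>j<c.
     rf_proper (T $$ (i, j)) \<and> rf_poles (T $$ (i, j)) \<subseteq> {z. cmod z < 1}}"

definition const_tf :: "real mat \<Rightarrow> rfun mat" where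
  "const_tf = map_mat (\<lambda>a. to_fract [:a:])"

definition z_var :: rfun where
  "z_var = to_fract [:0, 1:]"

definition ss_tf :: "real mat \<Rightarrow> real mat \<Rightarrow> real mat \<Rightarrow> real mat \<Rightarrow> rfun mat" where
  "ss_tf A B C D =
     const_tf C * mat_inv (z_var \<cdot>\<^sub>m 1\<^sub>m (dim_row A) - const_tf A) * const_tf B + const_tf D"

text \<open>Singular values: the square roots of the eigenvalues of \<open>M\<^sup>* M\<close>.\<close>

definition sigma_max :: "complex mat \<Rightarrow> real" where
  "sigma_max M = Max {s. 0 \<le> s \<and> eigenvalue (mat_adjoint M * M) (of_real (s\<^sup>2))}"

definition tf_eval :: "rfun mat \<Rightarrow> complex \<Rightarrow> complex mat" where
  "tf_eval T z = map_mat (\<lambda>f. rf_eval f z) T"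

definition Hinf_norm :: "rfun mat \<Rightarrow> real" where
  "Hinf_norm T = (SUP z \<in> {z. cmod z = 1}. sigma_max (tf_eval T z))"

definition doubly_coprime ::
  "nat \<Rightarrow> nat \<Rightarrow> rfun mat \<Rightarrow> rfun mat \<Rightarrow> rfun mat \<Rightarrow> rfun mat \<Rightarrow> rfun mat \<Rightarrow>
     rfun mat \<Rightarrow> rfun mat \<Rightarrow> rfun mat \<Rightarrow> rfun mat \<Rightarrow> bool" where
  "doubly_coprime p m G Ul Vl Nl Ml Ur Vr Nr Mr \<longleftrightarrow>
     Ul \<in> RH_inf m m \<and> Vl \<in> RH_inf m p \<and> Nl \<in> RH_inf p m \<and> Ml \<in> RH_inf p p \<and>
     Ur \<in> RH_inf p p \<and> Vr \<in> RH_inf m p \<and> Nr \<in> RH_inf p m \<and> Mr \<in> RH_inf m m \<and>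
     invertible_mat Mr \<and> invertible_mat Ml \<and>
     G = Nr * mat_inv Mr \<and> G = mat_inv Ml * Nl \<and>
     four_block_mat Ul (- Vl) (- Nl) Ml * four_block_mat Mr Vr Nr Ur = 1\<^sub>m (m + p)"

definition lmi_mat ::
  "nat \<Rightarrow> nat \<Rightarrow> real \<Rightarrow> real mat \<Rightarrow> real mat \<Rightarrow> real mat \<Rightarrow> real mat \<Rightarrow> real mat \<Rightarrow> real mat \<Rightarrow>
     real mat \<Rightarrow> real mat \<Rightarrow> real mat \<Rightarrow> real mat \<Rightarrow> real mat \<Rightarrow> real mat \<Rightarrow> real mat \<Rightarrow> real mat \<Rightarrow>
     real mat" where
  "lmi_mat k p \<epsilon> A B\<^sub>M B\<^sub>N C D\<^sub>M D\<^sub>N X Z Q F L\<^sub>X L\<^sub>Y R\<^sub>X R\<^sub>Y =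
    (let f1 = A * X + B\<^sub>M * L\<^sub>X - B\<^sub>N * L\<^sub>Y;
         f2 = A * Z + B\<^sub>M * L\<^sub>X - B\<^sub>N * L\<^sub>Y;
         f3 = B\<^sub>M * R\<^sub>X - B\<^sub>N * R\<^sub>Y;
         f4 = X\<^sup>T * C\<^sup>T + L\<^sub>X\<^sup>T * D\<^sub>M\<^sup>T - L\<^sub>Y\<^sup>T * D\<^sub>N\<^sup>T;
         f5 = Z\<^sup>T * C\<^sup>T + L\<^sub>X\<^sup>T * D\<^sub>M\<^sup>T - L\<^sub>Y\<^sup>T * D\<^sub>N\<^sup>T;
         f6 = R\<^sub>X\<^sup>T * D\<^sub>M\<^sup>T - R\<^sub>Y\<^sup>T * D\<^sub>N\<^sup>T - 1\<^sub>m p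
     in (X           @\<^sub>c Z           @\<^sub>c f1          @\<^sub>c f2          @\<^sub>c f3          @\<^sub>c 0\<^sub>m k p)
     @\<^sub>r (Z\<^sup>T          @\<^sub>c Z           @\<^sub>c Q           @\<^sub>c Q           @\<^sub>c F           @\<^sub>c 0\<^sub>m k p)
     @\<^sub>r (f1\<^sup>T         @\<^sub>c Q\<^sup>T          @\<^sub>c X           @\<^sub>c Z           @\<^sub>c 0\<^sub>m k p      @\<^sub>c f4)
     @\<^sub>r (f2\<^sup>T         @\<^sub>c Q\<^sup>T          @\<^sub>c Z\<^sup>T          @\<^sub>c Z           @\<^sub>c 0\<^sub>m k p      @\<^sub>c f5)
     @\<^sub>r (f3\<^sup>T         @\<^sub>c F\<^sup>T          @\<^sub>c (0\<^sub>m k p)\<^sup>T  @\<^sub>c (0\<^sub>m k p)\<^sup>T  @\<^sub>c 1\<^sub>m p        @\<^sub>c f6)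
     @\<^sub>r ((0\<^sub>m k p)\<^sup>T  @\<^sub>c (0\<^sub>m k p)\<^sup>T  @\<^sub>c f4\<^sup>T         @\<^sub>c f5\<^sup>T         @\<^sub>c f6\<^sup>T         @\<^sub>c \<epsilon>\<^sup>2 \<cdot>\<^sub>m 1\<^sub>m p))"

definition lmi_holds ::
  "nat \<Rightarrow> nat \<Rightarrow> nat \<Rightarrow> real \<Rightarrow> real mat \<Rightarrow> real mat \<Rightarrow> real mat \<Rightarrow> real mat \<Rightarrow> real mat \<Rightarrow> real mat \<Rightarrow>
     real mat \<Rightarrow> real mat \<Rightarrow> real mat \<Rightarrow> real mat \<Rightarrow> real mat \<Rightarrow> real mat \<Rightarrow> real mat \<Rightarrow> real mat \<Rightarrow>
     bool" where
  "lmi_holds k p m \<epsilon> A B\<^sub>M B\<^sub>N C D\<^sub>M D\<^sub>N X Z Q F L\<^sub>X L\<^sub>Y R\<^sub>X R\<^sub>Y \<longleftrightarrow>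
     X \<in> carrier_mat k k \<and> sym_mat X \<and> Z \<in> carrier_mat k k \<and> sym_mat Z \<and>
     Q \<in> carrier_mat k k \<and> F \<in> carrier_mat k p \<and>
     L\<^sub>X \<in> carrier_mat p k \<and> L\<^sub>Y \<in> carrier_mat m k \<and>
     R\<^sub>X \<in> carrier_mat p p \<and> R\<^sub>Y \<in> carrier_mat m p \<and>
     pos_def (lmi_mat k p \<epsilon> A B\<^sub>M B\<^sub>N C D\<^sub>M D\<^sub>N X Z Q F L\<^sub>X L\<^sub>Y R\<^sub>X R\<^sub>Y)"

end

theory Submission
  imports Defs
begin

text \<open>
  Write \<open>B u\<close> for \<open>B\<^sub>M u\<^sub>X - B\<^sub>N u\<^sub>Y\<close> and \<open>D u\<close> for \<open>D\<^sub>M u\<^sub>X - D\<^sub>N u\<^sub>Y\<close>. If \<open>Xt\<close> and \<open>Yt\<close> share a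
  state \<open>q\<close> with \<open>Z q\<^sup>+ = Q q + F v\<close> and \<open>u = L q + R v\<close>, the error \<open>M\<^sub>l Xt - N\<^sub>l Yt - I\<close> is the
  transfer matrix from \<open>v\<close> to \<open>y\<close> of the cascade \<open>x\<^sup>+ = A x + B u\<close>, \<open>y = C x + D u - v\<close>. The matrix
  inequality is the bounded real inequality of this cascade in adapted coordinates. To see this, put
  \<open>\<Delta> = X - Z\<close> and describe a test vector with blocks \<open>a\<^sub>1, a\<^sub>2, b\<^sub>1, b\<^sub>2, c, d\<close> by the sums \<open>a = a\<^sub>1 + a\<^sub>2\<close>
  and \<open>b = b\<^sub>1 + b\<^sub>2\<close> in place of its second and fourth blocks. The form then displays the state
  equations of the cascade (\<open>lmi_quadratic_form\<close>): the state is given by \<open>x = \<Delta> b\<^sub>1 + Z b\<close> and \<open>q = b\<close>,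
  the input is \<open>c\<close>, and the stored energy is \<open>b\<^sub>1 \<bullet> \<Delta> b\<^sub>1 + b \<bullet> Z b\<close>.

  \<^bold>\<open>From the inequality to a controller.\<close> At a frequency \<open>z\<close> with \<open>|z| = 1\<close> the response to a
  sinusoid multiplies the state by \<open>z\<close>. Evaluate the form with \<open>(a\<^sub>1, a) = - z (b\<^sub>1, b)\<close>, \<open>c = v\<close> and
  \<open>d = - y / \<epsilon>\<^sup>2\<close>: the residuals of the state equations vanish, the two storage terms cancel because
  \<open>|z| = 1\<close>, and what is left is \<open>|v|\<^sup>2 - |y|\<^sup>2 / \<epsilon>\<^sup>2\<close> (\<open>dissipation\<close>). A positive definite form is bounded below by
  \<open>\<eta> |\<cdot>|\<^sup>2\<close>, so \<open>|y|\<^sup>2 \<le> \<epsilon>\<^sup>2 (1 - \<eta>) |v|\<^sup>2\<close> uniformly in \<open>z\<close>, which is what makes the supremum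
  strictly smaller than \<open>\<epsilon>\<close>. The same test vector without input shows that every mode \<open>\<lambda>\<close> of
  \<open>Z\<^sup>-\<^sup>1 Q\<close> satisfies \<open>|\<lambda>| < 1\<close> (\<open>filter_mode_stable\<close>). The matrix \<open>U\<close> is a change of the controller
  state (\<open>lmi_sufficient\<close>).

  \<^bold>\<open>From a controller to the inequality.\<close> One block of the doubly coprime factorization is the
  identity \<open>M\<^sub>l U\<^sub>r - N\<^sub>l V\<^sub>r = I\<close>, so error zero is attained and the claim is that the inequality has a
  solution. A stable right inverse of \<open>[M\<^sub>l, - N\<^sub>l]\<close> steers the system \<open>(A, B, C, D)\<close> from any initial
  state to rest with output zero: there are sequences \<open>\<Phi>\<^sub>n\<close>, \<open>\<Upsilon>\<^sub>n\<close> with \<open>\<Phi>\<^sub>0 = I\<close>,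
  \<open>\<Phi>\<^sub>n\<^sub>+\<^sub>1 = A \<Phi>\<^sub>n + B \<Upsilon>\<^sub>n\<close>, \<open>C \<Phi>\<^sub>n + D \<Upsilon>\<^sub>n = 0\<close> and \<open>\<Phi>\<^sub>n \<longlonglongrightarrow> 0\<close>; they are the expansion coefficients at
  infinity (Markov parameters) of explicit stable rational matrices
  (\<open>right_inverse_imp_lmi_feasible\<close>). The constant term \<open>R\<close> of the right inverse satisfies
  \<open>D R = I\<close>. Put \<open>F = B R\<close>, \<open>W = I + F F\<^sup>T\<close> and, with sums over \<open>n < N\<close>,
  \<open>Z = \<Sum> \<Phi>\<^sub>n W \<Phi>\<^sub>n\<^sup>T\<close>, \<open>L = \<Sum> \<Upsilon>\<^sub>n W \<Phi>\<^sub>n\<^sup>T\<close>, \<open>Q = A Z + B L\<close>. Then \<open>C Z + D L = 0\<close>, the error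
  terms containing \<open>b\<close> disappear, and the form splits into a form in \<open>(a, b, c)\<close> and one in
  \<open>(a\<^sub>1, b\<^sub>1, d)\<close>. The first telescopes, up to a boundary term that contains \<open>\<Phi>\<^sub>N\<close>, into a sum of
  squares (\<open>feedback_gram_ge\<close>). The second is positive for \<open>\<Delta> = \<delta> S\<close>, where \<open>S\<close> is a truncated
  Gramian of \<open>A\<close> and \<open>\<delta>\<close> is small (\<open>completed_square_pos\<close>). Truncation at a large \<open>N\<close> keeps
  all sums finite: only \<open>\<Phi>\<^sub>N\<close> and \<open>A\<^sup>N\<close> have to be small (\<open>lmi_feasible\<close>).
\<close>

section \<open>Vectors and matrices with explicit dimensions\<close>

text \<open>
  The rules below have equations between dimensions as premises instead of memberships in
  carriers. No premise then contains a variable that is absent from the conclusion, so the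
  simplifier can expand products of matrices and vectors by itself. In the same way the rules
  for \<open>M\<^sup>T\<close> move every transpose to the other side of an inner product.
\<close>

lemma mult_mat_vec_add:
  fixes M :: "'a::comm_ring mat"
  assumes "dim_vec v = dim_col M" "dim_vec w = dim_col M"
  shows "M *\<^sub>v (v + w) = M *\<^sub>v v + M *\<^sub>v w"
  by (rule mult_add_distrib_mat_vec[of M "dim_row M" "dim_col M"]) (use assms in \<open>auto intro: carrier_vecI\<close>)

lemma mult_mat_vec_minus:
  fixes M :: "'a::comm_ring mat"
  assumes "dim_vec v = dim_col M" "dim_vec w = dim_col M"
  shows "M *\<^sub>v (v - w) = M *\<^sub>v v - M *\<^sub>v w"
  by (rule mult_minus_distrib_mat_vec[of M "dim_row M" "dim_col M"]) (use assms in \<open>auto intro: carrier_vecI\<close>)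

lemma mult_mat_vec_uminus:
  fixes M :: "'a::comm_ring mat"
  assumes "dim_vec v = dim_col M"
  shows "M *\<^sub>v (- v) = - (M *\<^sub>v v)"
  using assms by (intro eq_vecI) (auto simp: scalar_prod_def sum_negf)

lemma mult_mat_vec_smult:
  fixes M :: "'a::field mat"
  assumes "dim_vec v = dim_col M"
  shows "M *\<^sub>v (c \<cdot>\<^sub>v v) = c \<cdot>\<^sub>v (M *\<^sub>v v)"
  by (rule mult_mat_vec[of M "dim_row M" "dim_col M"]) (use assms in \<open>auto intro: carrier_vecI\<close>)

lemma add_mat_mult_vec:
  fixes M :: "'a::comm_ring mat"
  assumes "dim_row M = dim_row N" "dim_col M = dim_col N" "dim_vec v = dim_col N"
  shows "(M + N) *\<^sub>v v = M *\<^sub>v v + N *\<^sub>v v"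
  by (rule add_mult_distrib_mat_vec[of M "dim_row M" "dim_col M"]) (use assms in \<open>auto intro: carrier_vecI\<close>)

lemma minus_mat_mult_vec:
  fixes M :: "'a::comm_ring mat"
  assumes "dim_row M = dim_row N" "dim_col M = dim_col N" "dim_vec v = dim_col N"
  shows "(M - N) *\<^sub>v v = M *\<^sub>v v - N *\<^sub>v v"
  by (rule minus_mult_distrib_mat_vec[of M "dim_row M" "dim_col M"]) (use assms in \<open>auto intro: carrier_vecI\<close>)

lemma smult_mat_mult_vec:
  fixes M :: "'a::comm_ring mat"
  assumes "dim_vec v = dim_col M"
  shows "(c \<cdot>\<^sub>m M) *\<^sub>v v = c \<cdot>\<^sub>v (M *\<^sub>v v)"
  using assms by (intro eq_vecI) (auto simp: scalar_prod_def sum_distrib_left mult.assoc)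

lemma mult_mat_mult_vec:
  fixes M :: "'a::comm_ring mat"
  assumes "dim_col M = dim_row N" "dim_vec v = dim_col N"
  shows "(M * N) *\<^sub>v v = M *\<^sub>v (N *\<^sub>v v)"
  by (rule assoc_mult_mat_vec[of M "dim_row M" "dim_col M"]) (use assms in \<open>auto intro: carrier_vecI\<close>)

lemma one_mat_mult_vec: "dim_vec v = n \<Longrightarrow> 1\<^sub>m n *\<^sub>v v = (v :: 'a::comm_ring_1 vec)"
  by (intro one_mult_mat_vec) (auto intro: carrier_vecI)

lemma zero_mat_mult_vec: "dim_vec v = n \<Longrightarrow> 0\<^sub>m k n *\<^sub>v v = (0\<^sub>v k :: 'a::comm_ring_1 vec)"
  by (intro eq_vecI) (auto simp: scalar_prod_def)

lemma mult_mat_vec_zero: "n = dim_col M \<Longrightarrow> M *\<^sub>v 0\<^sub>v n = (0\<^sub>v (dim_row M) :: 'a::comm_ring_1 vec)"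
  by (intro eq_vecI) (auto simp: scalar_prod_def)

lemma inner_add:
  fixes u :: "'a::comm_ring vec"
  assumes "dim_vec u = dim_vec w" "dim_vec v = dim_vec w"
  shows "u \<bullet> (v + w) = u \<bullet> v + u \<bullet> w" "(u + v) \<bullet> w = u \<bullet> w + v \<bullet> w"
  using assms by (auto simp: scalar_prod_def sum.distrib algebra_simps)

lemma inner_minus:
  fixes u :: "'a::comm_ring vec"
  assumes "dim_vec u = dim_vec w" "dim_vec v = dim_vec w"
  shows "u \<bullet> (v - w) = u \<bullet> v - u \<bullet> w" "(u - v) \<bullet> w = u \<bullet> w - v \<bullet> w"
  using assms by (auto simp: scalar_prod_def sum_subtractf algebra_simps)

lemma inner_uminus:
  fixes u :: "'a::comm_ring vec"
  assumes "dim_vec u = dim_vec v"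
  shows "u \<bullet> (- v) = - (u \<bullet> v)" "(- u) \<bullet> v = - (u \<bullet> v)"
  using assms by (auto simp: scalar_prod_def sum_negf)

lemma inner_smult:
  fixes u :: "'a::comm_ring vec"
  assumes "dim_vec u = dim_vec v"
  shows "u \<bullet> (c \<cdot>\<^sub>v v) = c * (u \<bullet> v)" "(c \<cdot>\<^sub>v u) \<bullet> v = c * (u \<bullet> v)"
  using assms by (auto simp: scalar_prod_def sum_distrib_left algebra_simps)

lemma inner_zero:
  fixes u :: "'a::comm_ring vec"
  assumes "dim_vec u = n"
  shows "u \<bullet> 0\<^sub>v n = 0" "0\<^sub>v n \<bullet> u = 0"
  using assms by (auto simp: scalar_prod_def)

lemma inner_commute: "dim_vec u = dim_vec v \<Longrightarrow> u \<bullet> v = v \<bullet> (u :: 'a::comm_ring vec)"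
  by (auto simp: scalar_prod_def mult.commute)

lemma inner_transpose:
  fixes M :: "'a::comm_ring mat"
  assumes "dim_vec u = dim_col M" "dim_vec v = dim_row M"
  shows "u \<bullet> (M\<^sup>T *\<^sub>v v) = v \<bullet> (M *\<^sub>v u)" "(M\<^sup>T *\<^sub>v v) \<bullet> u = v \<bullet> (M *\<^sub>v u)"
  using assms transpose_vec_mult_scalar[of M "dim_row M" "dim_col M" u v]
    inner_commute[of u "M\<^sup>T *\<^sub>v v"] by (auto intro: carrier_vecI)

lemma inner_append:
  fixes u :: "'a::comm_ring vec"
  assumes "dim_vec u = dim_vec v" "dim_vec u' = dim_vec v'"
  shows "(u @\<^sub>v u') \<bullet> (v @\<^sub>v v') = u \<bullet> v + u' \<bullet> v'"
  by (rule scalar_prod_append[of _ "dim_vec u" _ "dim_vec u'"]) (use assms in \<open>auto intro: carrier_vecI\<close>)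

lemmas lin_simps = mult_mat_vec_add mult_mat_vec_minus mult_mat_vec_uminus mult_mat_vec_smult
  add_mat_mult_vec minus_mat_mult_vec smult_mat_mult_vec mult_mat_mult_vec
  one_mat_mult_vec zero_mat_mult_vec mult_mat_vec_zero

lemmas inner_simps = inner_add inner_minus inner_uminus inner_smult inner_zero inner_transpose

lemma dim_append_cols [simp]:
  "dim_row (M @\<^sub>c N) = dim_row M" "dim_col (M @\<^sub>c N) = dim_col M + dim_col N"
  by (auto simp: append_cols_def)

lemma dim_append_rows [simp]:
  "dim_row (M @\<^sub>r N) = dim_row M + dim_row N" "dim_col (M @\<^sub>r N) = dim_col M"
  by (auto simp: append_rows_def)

lemma append_cols_mult_vec:
  fixes M :: "'a::comm_ring_1 mat"
  assumes "dim_row M = dim_row N" "dim_vec v = dim_col M" "dim_vec w = dim_col N"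
  shows "(M @\<^sub>c N) *\<^sub>v (v @\<^sub>v w) = M *\<^sub>v v + N *\<^sub>v w"
proof (rule eq_vecI)
  fix i assume "i < dim_vec (M *\<^sub>v v + N *\<^sub>v w)"
  then have i: "i < dim_row M" "i < dim_row N" using assms by auto
  have "row (M @\<^sub>c N) i = row M i @\<^sub>v row N i"
    unfolding append_cols_def
    by (rule row_four_block_mat(1)[of _ "dim_row M" "dim_col M" _ "dim_col N" _ 0])
       (use i assms in \<open>auto intro: carrier_vecI\<close>)
  then show "((M @\<^sub>c N) *\<^sub>v (v @\<^sub>v w)) $ i = (M *\<^sub>v v + N *\<^sub>v w) $ i"
    using i assms by (auto simp: inner_append)
qed (use assms in auto)

lemma append_rows_mult_vec:
  fixes M :: "'a::comm_ring_1 mat"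
  assumes "dim_col M = dim_col N" "dim_vec v = dim_col N"
  shows "(M @\<^sub>r N) *\<^sub>v v = (M *\<^sub>v v) @\<^sub>v (N *\<^sub>v v)"
  by (rule mat_mult_append[of _ "dim_row M" "dim_col M" _ "dim_row N"]) (use assms in \<open>auto intro: carrier_vecI\<close>)

lemma inner_self_nonneg: "0 \<le> v \<bullet> (v :: real vec)"
  by (auto simp: scalar_prod_def intro!: sum_nonneg)

lemma inner_self_eq_0_iff: "v \<bullet> v = 0 \<longleftrightarrow> (v :: real vec) = 0\<^sub>v (dim_vec v)"
proof
  assume "v \<bullet> v = 0"
  then have "\<forall>i\<in>{0..<dim_vec v}. v $ i * v $ i = 0"
    unfolding scalar_prod_def by (subst (asm) sum_nonneg_eq_0_iff) auto
  then show "v = 0\<^sub>v (dim_vec v)" by (intro eq_vecI) auto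
next
  assume "v = 0\<^sub>v (dim_vec v)"
  then show "v \<bullet> v = 0" by (metis inner_zero(1))
qed


section \<open>Bounds for quadratic forms\<close>

lemma inner_Cauchy_Schwarz:
  fixes u v :: "real vec"
  assumes "dim_vec u = dim_vec v"
  shows "(u \<bullet> v)\<^sup>2 \<le> (u \<bullet> u) * (v \<bullet> v)"
proof (cases "v \<bullet> v = 0")
  case True
  then have "v = 0\<^sub>v (dim_vec v)" by (simp add: inner_self_eq_0_iff)
  then have "u \<bullet> v = 0" by (metis assms inner_zero(1))
  then show ?thesis using True by simp
next
  case False
  then have pos: "v \<bullet> v > 0" using inner_self_nonneg[of v] by simp
  define t where "t = (u \<bullet> v) / (v \<bullet> v)"
  have t: "t * (v \<bullet> v) = u \<bullet> v" using pos by (simp add: t_def)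
  have "0 \<le> (u - t \<cdot>\<^sub>v v) \<bullet> (u - t \<cdot>\<^sub>v v)" by (rule inner_self_nonneg)
  also have "\<dots> = u \<bullet> u - 2 * t * (u \<bullet> v) + t * (t * (v \<bullet> v))"
    using assms inner_commute[of u v] by (simp add: inner_simps algebra_simps)
  also have "\<dots> = u \<bullet> u - t * (u \<bullet> v)" unfolding t by (simp add: algebra_simps)
  finally have "t * (u \<bullet> v) * (v \<bullet> v) \<le> (u \<bullet> u) * (v \<bullet> v)"
    using pos by (intro mult_right_mono) auto
  also have "t * (u \<bullet> v) * (v \<bullet> v) = (u \<bullet> v) * (t * (v \<bullet> v))" by (simp add: mult_ac)
  finally show ?thesis unfolding t by (simp add: power2_eq_square)
qed

text \<open>The square of the Frobenius norm.\<close>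

definition frob :: "real mat \<Rightarrow> real" where
  "frob M = (\<Sum>i<dim_row M. row M i \<bullet> row M i)"

lemma frob_nonneg: "0 \<le> frob M"
  by (auto simp: frob_def intro!: sum_nonneg inner_self_nonneg)

lemma inner_mult_mat_vec_le_frob:
  assumes "dim_vec v = dim_col M"
  shows "(M *\<^sub>v v) \<bullet> (M *\<^sub>v v) \<le> frob M * (v \<bullet> v)"
proof -
  have "(M *\<^sub>v v) \<bullet> (M *\<^sub>v v) = (\<Sum>i<dim_row M. (row M i \<bullet> v)\<^sup>2)"
    by (auto simp: scalar_prod_def[of "M *\<^sub>v v"] power2_eq_square lessThan_atLeast0)
  also have "\<dots> \<le> (\<Sum>i<dim_row M. (row M i \<bullet> row M i) * (v \<bullet> v))"
    using assms by (intro sum_mono inner_Cauchy_Schwarz) auto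
  finally show ?thesis by (simp add: frob_def sum_distrib_right)
qed

lemma inverse_of_trivial_kernel:
  fixes M :: "'a::field mat"
  assumes M: "M \<in> carrier_mat n n"
    and ker: "\<And>v. v \<in> carrier_vec n \<Longrightarrow> M *\<^sub>v v = 0\<^sub>v n \<Longrightarrow> v = 0\<^sub>v n"
  obtains N where "N \<in> carrier_mat n n" "M * N = 1\<^sub>m n" "N * M = 1\<^sub>m n"
proof -
  have "det M \<noteq> 0" using ker det_0_iff_vec_prod_zero_field[OF M] by blast
  then have "M \<in> Units (ring_mat TYPE('a) n undefined)" by (rule det_non_zero_imp_unit[OF M])
  then show thesis using that by (auto simp: Units_def ring_mat_def)
qed

lemma pos_form_inverse:
  fixes M :: "real mat"
  assumes M: "M \<in> carrier_mat n n"
    and pos: "\<And>v. v \<in> carrier_vec n \<Longrightarrow> v \<noteq> 0\<^sub>v n \<Longrightarrow> v \<bullet> (M *\<^sub>v v) > 0"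
  obtains N where "N \<in> carrier_mat n n" "M * N = 1\<^sub>m n" "N * M = 1\<^sub>m n"
proof (rule inverse_of_trivial_kernel[OF M])
  fix v assume v: "v \<in> carrier_vec n" "M *\<^sub>v v = 0\<^sub>v n"
  show "v = 0\<^sub>v n"
  proof (rule ccontr)
    assume "v \<noteq> 0\<^sub>v n"
    from pos[OF v(1) this] v show False by (simp add: inner_zero)
  qed
qed (rule that)

text \<open>
  The constant comes from an inverse \<open>N\<close> of \<open>M\<close>. Expanding the form at \<open>v - t N v\<close> gives
  \<open>v \<bullet> M v \<ge> 2 t |v|\<^sup>2 - t\<^sup>2 (N v \<bullet> v)\<close>, and \<open>N v \<bullet> v \<le> c |v|\<^sup>2\<close>, so that \<open>t = 1 / c\<close> leaves \<open>|v|\<^sup>2 / c\<close>.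
\<close>

lemma pos_def_coercive:
  assumes M: "M \<in> carrier_mat n n" and pd: "pos_def M"
  obtains \<eta> where "\<eta> > 0" "\<And>v. v \<in> carrier_vec n \<Longrightarrow> \<eta> * (v \<bullet> v) \<le> v \<bullet> (M *\<^sub>v v)"
proof -
  have sym: "M\<^sup>T = M" and pos: "\<And>v. v \<in> carrier_vec n \<Longrightarrow> v \<noteq> 0\<^sub>v n \<Longrightarrow> v \<bullet> (M *\<^sub>v v) > 0"
    using pd M by (auto simp: pos_def_def sym_mat_def)
  have nonneg: "v \<bullet> (M *\<^sub>v v) \<ge> 0" if "v \<in> carrier_vec n" for v
    using pos[OF that] M that by (cases "v = 0\<^sub>v n") (auto simp: inner_zero less_imp_le)
  obtain N where N: "N \<in> carrier_mat n n" "M * N = 1\<^sub>m n"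
    using pos_form_inverse[OF M pos] by metis
  define c where "c = 1 + frob N"
  have c: "c \<ge> 1" using frob_nonneg[of N] by (simp add: c_def)
  have bound: "1 / c * (v \<bullet> v) \<le> v \<bullet> (M *\<^sub>v v)" if v: "v \<in> carrier_vec n" for v
  proof -
    note dims = carrier_matD[OF M] carrier_matD[OF N(1)] carrier_vecD[OF v]
    define w where "w = N *\<^sub>v v"
    have dw: "dim_vec w = n" by (simp add: w_def dims)
    have Mw: "M *\<^sub>v w = v"
      unfolding w_def using N dims by (simp flip: mult_mat_mult_vec add: one_mat_mult_vec)
    have "0 \<le> (v - (1 / c) \<cdot>\<^sub>v w) \<bullet> (M *\<^sub>v (v - (1 / c) \<cdot>\<^sub>v w))"
      by (rule nonneg) (auto simp: dims dw intro!: carrier_vecI)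
    also have "\<dots> = v \<bullet> (M *\<^sub>v v) - 2 / c * (v \<bullet> v) + 1 / c * (1 / c * (w \<bullet> v))"
      using inner_transpose(1)[of w M v] sym
      by (simp add: dims dw lin_simps inner_simps Mw diff_divide_distrib mult.commute)
    finally have 1: "0 \<le> v \<bullet> (M *\<^sub>v v) - 2 / c * (v \<bullet> v) + 1 / c * (1 / c * (w \<bullet> v))" .
    have "2 * (w \<bullet> v) \<le> w \<bullet> w + v \<bullet> v"
      using inner_self_nonneg[of "w - v"] inner_commute[of w v]
      by (simp add: dims dw inner_simps)
    also have "w \<bullet> w \<le> frob N * (v \<bullet> v)"
      unfolding w_def by (rule inner_mult_mat_vec_le_frob) (simp add: dims)
    finally have "2 * (w \<bullet> v) \<le> c * (v \<bullet> v)" by (simp add: c_def algebra_simps)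
    moreover have "0 \<le> c * (v \<bullet> v)" using c inner_self_nonneg[of v] by simp
    ultimately have "w \<bullet> v \<le> c * (v \<bullet> v)" by linarith
    then have "1 / c * (1 / c * (w \<bullet> v)) \<le> 1 / c * (1 / c * (c * (v \<bullet> v)))"
      using c by (intro mult_left_mono) auto
    also have "\<dots> = 1 / c * (v \<bullet> v)" using c by simp
    finally have 2: "1 / c * (1 / c * (w \<bullet> v)) \<le> 1 / c * (v \<bullet> v)" .
    have "2 / c * (v \<bullet> v) = 1 / c * (v \<bullet> v) + 1 / c * (v \<bullet> v)"
      by (simp add: algebra_simps)
    with 1 2 show ?thesis by linarith
  qed
  show thesis by (rule that[of "1 / c"]) (use c bound in auto)
qed

lemma mat_eqI_vec:
  fixes M N :: "'a::comm_ring_1 mat"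
  assumes "dim_row M = dim_row N" "dim_col M = n" "dim_col N = n"
    and "\<And>x. dim_vec x = n \<Longrightarrow> M *\<^sub>v x = N *\<^sub>v x"
  shows "M = N"
proof (rule eq_matI)
  fix i j assume ij: "i < dim_row N" "j < dim_col N"
  have "(M *\<^sub>v unit_vec n j) $ i = (N *\<^sub>v unit_vec n j) $ i" using assms(4)[of "unit_vec n j"] by simp
  then show "M $$ (i, j) = N $$ (i, j)"
    using ij assms(1-3) scalar_prod_right_unit[of j n "row M i"] scalar_prod_right_unit[of j n "row N i"]
    by simp
qed (use assms in auto)

lemma symmetric_of_form:
  fixes M :: "real mat"
  assumes M: "M \<in> carrier_mat n n"
    and sym: "\<And>u v. u \<in> carrier_vec n \<Longrightarrow> v \<in> carrier_vec n \<Longrightarrow> u \<bullet> (M *\<^sub>v v) = v \<bullet> (M *\<^sub>v u)"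
  shows "M\<^sup>T = M"
proof (rule eq_matI)
  have entry: "unit_vec n i \<bullet> (M *\<^sub>v unit_vec n j) = M $$ (i, j)" if "i < n" "j < n" for i j
    using that M scalar_prod_right_unit[of j n "row M i"]
    by (subst scalar_prod_left_unit[of _ n]) (auto intro: carrier_vecI)
  fix i j assume "i < dim_row M" "j < dim_col M"
  then show "M\<^sup>T $$ (i, j) = M $$ (i, j)"
    using M entry[of i j] entry[of j i] sym[of "unit_vec n i" "unit_vec n j"] by auto
qed (use M in auto)

section \<open>The quadratic form of the matrix inequality\<close>

locale lmi_variables =
  fixes k p m :: nat and \<epsilon> :: real
    and A B\<^sub>M B\<^sub>N C D\<^sub>M D\<^sub>N X Z Q F L\<^sub>X L\<^sub>Y R\<^sub>X R\<^sub>Y :: "real mat"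
  assumes carriers: "A \<in> carrier_mat k k" "B\<^sub>M \<in> carrier_mat k p" "B\<^sub>N \<in> carrier_mat k m"
      "C \<in> carrier_mat p k" "D\<^sub>M \<in> carrier_mat p p" "D\<^sub>N \<in> carrier_mat p m"
      "X \<in> carrier_mat k k" "Z \<in> carrier_mat k k" "Q \<in> carrier_mat k k" "F \<in> carrier_mat k p"
      "L\<^sub>X \<in> carrier_mat p k" "L\<^sub>Y \<in> carrier_mat m k" "R\<^sub>X \<in> carrier_mat p p" "R\<^sub>Y \<in> carrier_mat m p"
    and symmetric: "X\<^sup>T = X" "Z\<^sup>T = Z"
begin

abbreviation lmi :: "real mat" where
  "lmi \<equiv> lmi_mat k p \<epsilon> A B\<^sub>M B\<^sub>N C D\<^sub>M D\<^sub>N X Z Q F L\<^sub>X L\<^sub>Y R\<^sub>X R\<^sub>Y"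

definition \<Delta> :: "real mat" where
  "\<Delta> = X - Z"

text \<open>
  The second and fourth blocks are parametrized by the sums \<open>a\<close> and \<open>b\<close>. In these coordinates the
  block \<open>[X, Z; Z, Z]\<close> is \<open>diag (\<Delta>, Z)\<close>, and \<open>Q\<close>, \<open>L\<^sub>X\<close>, \<open>L\<^sub>Y\<close> act on the single vector \<open>b\<close>.
\<close>

definition test_vec :: "real vec \<Rightarrow> real vec \<Rightarrow> real vec \<Rightarrow> real vec \<Rightarrow> real vec \<Rightarrow> real vec \<Rightarrow> real vec" where
  "test_vec a\<^sub>1 a b\<^sub>1 b c d = a\<^sub>1 @\<^sub>v (a - a\<^sub>1) @\<^sub>v b\<^sub>1 @\<^sub>v (b - b\<^sub>1) @\<^sub>v c @\<^sub>v d"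

text \<open>
  For \<open>(a\<^sub>1, a) = - z (b\<^sub>1, b)\<close> the next two vectors vanish exactly when \<open>x = \<Delta> b\<^sub>1 + Z b\<close> and \<open>q = b\<close>
  solve the state equations of the cascade at the frequency \<open>z\<close>, with input \<open>c\<close>; the third is the
  error produced by that response.
\<close>

definition plant_residual :: "real vec \<Rightarrow> real vec \<Rightarrow> real vec \<Rightarrow> real vec \<Rightarrow> real vec \<Rightarrow> real vec" where
  "plant_residual a\<^sub>1 a b\<^sub>1 b c = \<Delta> *\<^sub>v a\<^sub>1 + Z *\<^sub>v a + A *\<^sub>v (\<Delta> *\<^sub>v b\<^sub>1 + Z *\<^sub>v b)
     + B\<^sub>M *\<^sub>v (L\<^sub>X *\<^sub>v b + R\<^sub>X *\<^sub>v c) - B\<^sub>N *\<^sub>v (L\<^sub>Y *\<^sub>v b + R\<^sub>Y *\<^sub>v c)"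

definition filter_residual :: "real vec \<Rightarrow> real vec \<Rightarrow> real vec \<Rightarrow> real vec" where
  "filter_residual a b c = Z *\<^sub>v a + Q *\<^sub>v b + F *\<^sub>v c"

definition error_output :: "real vec \<Rightarrow> real vec \<Rightarrow> real vec \<Rightarrow> real vec" where
  "error_output b\<^sub>1 b c = C *\<^sub>v (\<Delta> *\<^sub>v b\<^sub>1 + Z *\<^sub>v b)
     + D\<^sub>M *\<^sub>v (L\<^sub>X *\<^sub>v b + R\<^sub>X *\<^sub>v c) - D\<^sub>N *\<^sub>v (L\<^sub>Y *\<^sub>v b + R\<^sub>Y *\<^sub>v c) - c"

lemma dims [simp]:
  "dim_row A = k" "dim_col A = k" "dim_row B\<^sub>M = k" "dim_col B\<^sub>M = p"
  "dim_row B\<^sub>N = k" "dim_col B\<^sub>N = m" "dim_row C = p" "dim_col C = k"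
  "dim_row D\<^sub>M = p" "dim_col D\<^sub>M = p" "dim_row D\<^sub>N = p" "dim_col D\<^sub>N = m"
  "dim_row X = k" "dim_col X = k" "dim_row Z = k" "dim_col Z = k"
  "dim_row Q = k" "dim_col Q = k" "dim_row F = k" "dim_col F = p"
  "dim_row L\<^sub>X = p" "dim_col L\<^sub>X = k" "dim_row L\<^sub>Y = m" "dim_col L\<^sub>Y = k"
  "dim_row R\<^sub>X = p" "dim_col R\<^sub>X = p" "dim_row R\<^sub>Y = m" "dim_col R\<^sub>Y = p"
  "dim_row \<Delta> = k" "dim_col \<Delta> = k"
  using carriers by (auto simp: \<Delta>_def)

lemma dim_lmi: "lmi \<in> carrier_mat (4 * k + 2 * p) (4 * k + 2 * p)"
  by (rule carrier_matI) (simp_all add: lmi_mat_def Let_def)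

lemma dim_test_vec:
  "dim_vec a\<^sub>1 = k \<Longrightarrow> dim_vec a = k \<Longrightarrow> dim_vec b\<^sub>1 = k \<Longrightarrow> dim_vec b = k \<Longrightarrow> dim_vec c = p \<Longrightarrow>
    dim_vec d = p \<Longrightarrow> test_vec a\<^sub>1 a b\<^sub>1 b c d \<in> carrier_vec (4 * k + 2 * p)"
  by (rule carrier_vecI) (simp add: test_vec_def)

text \<open>The rotation argument below needs the symmetry of both storage matrices.\<close>

lemma symmetric_\<Delta>: "\<Delta>\<^sup>T = \<Delta>"
  unfolding \<Delta>_def using symmetric carriers by (simp add: transpose_minus)

definition f\<^sub>1 where "f\<^sub>1 = A * X + B\<^sub>M * L\<^sub>X - B\<^sub>N * L\<^sub>Y"
definition f\<^sub>2 where "f\<^sub>2 = A * Z + B\<^sub>M * L\<^sub>X - B\<^sub>N * L\<^sub>Y"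
definition f\<^sub>3 where "f\<^sub>3 = B\<^sub>M * R\<^sub>X - B\<^sub>N * R\<^sub>Y"
definition f\<^sub>4 where "f\<^sub>4 = X\<^sup>T * C\<^sup>T + L\<^sub>X\<^sup>T * D\<^sub>M\<^sup>T - L\<^sub>Y\<^sup>T * D\<^sub>N\<^sup>T"
definition f\<^sub>5 where "f\<^sub>5 = Z\<^sup>T * C\<^sup>T + L\<^sub>X\<^sup>T * D\<^sub>M\<^sup>T - L\<^sub>Y\<^sup>T * D\<^sub>N\<^sup>T"
definition f\<^sub>6 where "f\<^sub>6 = R\<^sub>X\<^sup>T * D\<^sub>M\<^sup>T - R\<^sub>Y\<^sup>T * D\<^sub>N\<^sup>T - 1\<^sub>m p"

lemmas f_defs = f\<^sub>1_def f\<^sub>2_def f\<^sub>3_def f\<^sub>4_def f\<^sub>5_def f\<^sub>6_def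

lemma dims_f [simp]:
  "dim_row f\<^sub>1 = k" "dim_col f\<^sub>1 = k" "dim_row f\<^sub>2 = k" "dim_col f\<^sub>2 = k"
  "dim_row f\<^sub>3 = k" "dim_col f\<^sub>3 = p" "dim_row f\<^sub>4 = k" "dim_col f\<^sub>4 = p"
  "dim_row f\<^sub>5 = k" "dim_col f\<^sub>5 = p" "dim_row f\<^sub>6 = p" "dim_col f\<^sub>6 = p"
  by (simp_all add: f_defs)

text \<open>
  The product keeps the zero and identity blocks unevaluated, so that it follows from the block
  rules alone; they disappear when the inner product is taken.
\<close>

lemma lmi_mult_vec:
  assumes v [simp]: "dim_vec a\<^sub>1 = k" "dim_vec a\<^sub>2 = k" "dim_vec b\<^sub>1 = k" "dim_vec b\<^sub>2 = k"
      "dim_vec c = p" "dim_vec d = p"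
  shows "lmi *\<^sub>v (a\<^sub>1 @\<^sub>v a\<^sub>2 @\<^sub>v b\<^sub>1 @\<^sub>v b\<^sub>2 @\<^sub>v c @\<^sub>v d) =
     (X *\<^sub>v a\<^sub>1 + (Z *\<^sub>v a\<^sub>2 + (f\<^sub>1 *\<^sub>v b\<^sub>1 + (f\<^sub>2 *\<^sub>v b\<^sub>2 + (f\<^sub>3 *\<^sub>v c + 0\<^sub>m k p *\<^sub>v d)))))
     @\<^sub>v (Z\<^sup>T *\<^sub>v a\<^sub>1 + (Z *\<^sub>v a\<^sub>2 + (Q *\<^sub>v b\<^sub>1 + (Q *\<^sub>v b\<^sub>2 + (F *\<^sub>v c + 0\<^sub>m k p *\<^sub>v d)))))
     @\<^sub>v (f\<^sub>1\<^sup>T *\<^sub>v a\<^sub>1 + (Q\<^sup>T *\<^sub>v a\<^sub>2 + (X *\<^sub>v b\<^sub>1 + (Z *\<^sub>v b\<^sub>2 + (0\<^sub>m k p *\<^sub>v c + f\<^sub>4 *\<^sub>v d)))))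
     @\<^sub>v (f\<^sub>2\<^sup>T *\<^sub>v a\<^sub>1 + (Q\<^sup>T *\<^sub>v a\<^sub>2 + (Z\<^sup>T *\<^sub>v b\<^sub>1 + (Z *\<^sub>v b\<^sub>2 + (0\<^sub>m k p *\<^sub>v c + f\<^sub>5 *\<^sub>v d)))))
     @\<^sub>v (f\<^sub>3\<^sup>T *\<^sub>v a\<^sub>1 + (F\<^sup>T *\<^sub>v a\<^sub>2 + ((0\<^sub>m k p)\<^sup>T *\<^sub>v b\<^sub>1 + ((0\<^sub>m k p)\<^sup>T *\<^sub>v b\<^sub>2 + (1\<^sub>m p *\<^sub>v c + f\<^sub>6 *\<^sub>v d)))))
     @\<^sub>v ((0\<^sub>m k p)\<^sup>T *\<^sub>v a\<^sub>1 + ((0\<^sub>m k p)\<^sup>T *\<^sub>v a\<^sub>2 + (f\<^sub>4\<^sup>T *\<^sub>v b\<^sub>1 + (f\<^sub>5\<^sup>T *\<^sub>v b\<^sub>2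
          + (f\<^sub>6\<^sup>T *\<^sub>v c + (\<epsilon>\<^sup>2 \<cdot>\<^sub>m 1\<^sub>m p) *\<^sub>v d)))))"
  unfolding lmi_mat_def Let_def f_defs[symmetric]
  by (simp only: append_rows_mult_vec append_cols_mult_vec dim_append_cols dim_append_rows dims v
      dims_f index_append_vec(2) index_transpose_mat(2,3) index_zero_mat(2,3)
      index_one_mat(2,3) index_smult_mat(2,3))

lemma six_blocks:
  fixes v :: "real vec"
  assumes v: "v \<in> carrier_vec (4 * k + 2 * p)"
  obtains a\<^sub>1 a\<^sub>2 b\<^sub>1 b\<^sub>2 c d where "v = a\<^sub>1 @\<^sub>v a\<^sub>2 @\<^sub>v b\<^sub>1 @\<^sub>v b\<^sub>2 @\<^sub>v c @\<^sub>v d"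
    "dim_vec a\<^sub>1 = k" "dim_vec a\<^sub>2 = k" "dim_vec b\<^sub>1 = k" "dim_vec b\<^sub>2 = k" "dim_vec c = p" "dim_vec d = p"
proof -
  have split: "\<exists>x y. w = x @\<^sub>v y \<and> dim_vec x = i \<and> dim_vec y = n - i" if "dim_vec w = n" "i \<le> n"
    for w :: "real vec" and n i
    using that vec_first_last_append[of w i "n - i"]
    by (intro exI[of _ "vec_first w i"] exI[of _ "vec_last w (n - i)"]) (auto intro: carrier_vecI)
  have "dim_vec v = 4 * k + 2 * p" using v by simp
  from split[OF this, of k] obtain a\<^sub>1 w\<^sub>1 where 1: "v = a\<^sub>1 @\<^sub>v w\<^sub>1" "dim_vec a\<^sub>1 = k" "dim_vec w\<^sub>1 = 3 * k + 2 * p"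
    by auto
  from split[OF 1(3), of k] obtain a\<^sub>2 w\<^sub>2 where 2: "w\<^sub>1 = a\<^sub>2 @\<^sub>v w\<^sub>2" "dim_vec a\<^sub>2 = k" "dim_vec w\<^sub>2 = 2 * k + 2 * p"
    by auto
  from split[OF 2(3), of k] obtain b\<^sub>1 w\<^sub>3 where 3: "w\<^sub>2 = b\<^sub>1 @\<^sub>v w\<^sub>3" "dim_vec b\<^sub>1 = k" "dim_vec w\<^sub>3 = k + 2 * p"
    by auto
  from split[OF 3(3), of k] obtain b\<^sub>2 w\<^sub>4 where 4: "w\<^sub>3 = b\<^sub>2 @\<^sub>v w\<^sub>4" "dim_vec b\<^sub>2 = k" "dim_vec w\<^sub>4 = 2 * p"
    by auto
  from split[OF 4(3), of p] obtain c d where 5: "w\<^sub>4 = c @\<^sub>v d" "dim_vec c = p" "dim_vec d = p"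
    by auto
  show thesis by (rule that[of a\<^sub>1 a\<^sub>2 b\<^sub>1 b\<^sub>2 c d]) (simp_all add: 1 2 3 4 5)
qed

text \<open>
  Symmetry is tested on pairs of block vectors: each block occurs together with its transpose, and the
  rules for inner products identify the two.
\<close>

lemma lmi_symmetric: "lmi\<^sup>T = lmi"
proof (rule symmetric_of_form[OF dim_lmi])
  fix u v :: "real vec" assume uv: "u \<in> carrier_vec (4 * k + 2 * p)" "v \<in> carrier_vec (4 * k + 2 * p)"
  obtain a\<^sub>1 a\<^sub>2 b\<^sub>1 b\<^sub>2 c d where u: "u = a\<^sub>1 @\<^sub>v a\<^sub>2 @\<^sub>v b\<^sub>1 @\<^sub>v b\<^sub>2 @\<^sub>v c @\<^sub>v d" and
    [simp]: "dim_vec a\<^sub>1 = k" "dim_vec a\<^sub>2 = k" "dim_vec b\<^sub>1 = k" "dim_vec b\<^sub>2 = k" "dim_vec c = p" "dim_vec d = p"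
    by (rule six_blocks[OF uv(1)])
  obtain a\<^sub>1' a\<^sub>2' b\<^sub>1' b\<^sub>2' c' d' where v: "v = a\<^sub>1' @\<^sub>v a\<^sub>2' @\<^sub>v b\<^sub>1' @\<^sub>v b\<^sub>2' @\<^sub>v c' @\<^sub>v d'" and
    [simp]: "dim_vec a\<^sub>1' = k" "dim_vec a\<^sub>2' = k" "dim_vec b\<^sub>1' = k" "dim_vec b\<^sub>2' = k" "dim_vec c' = p" "dim_vec d' = p"
    by (rule six_blocks[OF uv(2)])
  have XZ: "x \<bullet> (X *\<^sub>v y) = y \<bullet> (X *\<^sub>v x)" "x \<bullet> (Z *\<^sub>v y) = y \<bullet> (Z *\<^sub>v x)"
    if "dim_vec x = k" "dim_vec y = k" for x y
    using inner_transpose(1)[of x X y] inner_transpose(1)[of x Z y] symmetric that by auto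
  have "v \<bullet> (lmi *\<^sub>v u) = u \<bullet> (lmi *\<^sub>v v)"
    unfolding u v
    by (simp add: lmi_mult_vec inner_append inner_simps lin_simps symmetric
        XZ[of a\<^sub>1' a\<^sub>1] XZ[of a\<^sub>1' a\<^sub>2] XZ[of a\<^sub>2' a\<^sub>1] XZ[of a\<^sub>2' a\<^sub>2]
        XZ[of b\<^sub>1' b\<^sub>1] XZ[of b\<^sub>1' b\<^sub>2] XZ[of b\<^sub>2' b\<^sub>1] XZ[of b\<^sub>2' b\<^sub>2]
        inner_commute[of c' c] inner_commute[of d' d])
  then show "u \<bullet> (lmi *\<^sub>v v) = v \<bullet> (lmi *\<^sub>v u)" by simp
qed

text \<open>
  The bounded real inequality in completed form: residuals paired with the multipliers \<open>a\<^sub>1\<close> and \<open>a\<close>, the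
  storage before and after one step, and the supply rate. Positivity of the block matrix enters the proof
  only through this identity.
\<close>

lemma lmi_quadratic_form:
  assumes v [simp]: "dim_vec a\<^sub>1 = k" "dim_vec a = k" "dim_vec b\<^sub>1 = k" "dim_vec b = k"
      "dim_vec c = p" "dim_vec d = p"
  shows "test_vec a\<^sub>1 a b\<^sub>1 b c d \<bullet> (lmi *\<^sub>v test_vec a\<^sub>1 a b\<^sub>1 b c d) =
      2 * (a\<^sub>1 \<bullet> (plant_residual a\<^sub>1 a b\<^sub>1 b c - filter_residual a b c)) + 2 * (a \<bullet> filter_residual a b c)
      - (a\<^sub>1 \<bullet> (\<Delta> *\<^sub>v a\<^sub>1) + a \<bullet> (Z *\<^sub>v a)) + (b\<^sub>1 \<bullet> (\<Delta> *\<^sub>v b\<^sub>1) + b \<bullet> (Z *\<^sub>v b))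
      + c \<bullet> c + 2 * (d \<bullet> error_output b\<^sub>1 b c) + \<epsilon>\<^sup>2 * (d \<bullet> d)"
proof -
  let ?\<xi> = "test_vec a\<^sub>1 a b\<^sub>1 b c d"
  define a\<^sub>2 b\<^sub>2 where ab: "a\<^sub>2 = a - a\<^sub>1" "b\<^sub>2 = b - b\<^sub>1"
  have dims_ab [simp]: "dim_vec a\<^sub>2 = k" "dim_vec b\<^sub>2 = k"
    by (simp_all add: ab)
  have form: "?\<xi> \<bullet> (lmi *\<^sub>v ?\<xi>) =
      (a\<^sub>1 \<bullet> (X *\<^sub>v a\<^sub>1) + 2 * (a\<^sub>1 \<bullet> (Z *\<^sub>v a\<^sub>2)) + a\<^sub>2 \<bullet> (Z *\<^sub>v a\<^sub>2))
      + (b\<^sub>1 \<bullet> (X *\<^sub>v b\<^sub>1) + 2 * (b\<^sub>1 \<bullet> (Z *\<^sub>v b\<^sub>2)) + b\<^sub>2 \<bullet> (Z *\<^sub>v b\<^sub>2))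
      + 2 * (a\<^sub>1 \<bullet> (f\<^sub>1 *\<^sub>v b\<^sub>1) + a\<^sub>1 \<bullet> (f\<^sub>2 *\<^sub>v b\<^sub>2) + a\<^sub>1 \<bullet> (f\<^sub>3 *\<^sub>v c))
      + 2 * (a\<^sub>2 \<bullet> (Q *\<^sub>v b\<^sub>1) + a\<^sub>2 \<bullet> (Q *\<^sub>v b\<^sub>2) + a\<^sub>2 \<bullet> (F *\<^sub>v c))
      + c \<bullet> c + 2 * (b\<^sub>1 \<bullet> (f\<^sub>4 *\<^sub>v d) + b\<^sub>2 \<bullet> (f\<^sub>5 *\<^sub>v d) + c \<bullet> (f\<^sub>6 *\<^sub>v d)) + \<epsilon>\<^sup>2 * (d \<bullet> d)"
    unfolding test_vec_def ab[symmetric]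
    by (simp add: lmi_mult_vec inner_append inner_simps lin_simps)
  have Xs: "dim_vec u = k \<Longrightarrow> dim_vec w = k \<Longrightarrow> (X *\<^sub>v u) \<bullet> w = u \<bullet> (X *\<^sub>v w)"
    and Zs: "dim_vec u = k \<Longrightarrow> dim_vec w = k \<Longrightarrow> (Z *\<^sub>v u) \<bullet> w = u \<bullet> (Z *\<^sub>v w)" for u w
    using inner_transpose(2)[of w X u] inner_transpose(2)[of w Z u] symmetric by auto
  have sym: "a\<^sub>1 \<bullet> (Z *\<^sub>v a) = a \<bullet> (Z *\<^sub>v a\<^sub>1)" "b\<^sub>1 \<bullet> (Z *\<^sub>v b) = b \<bullet> (Z *\<^sub>v b\<^sub>1)"
    using inner_transpose(1)[of a\<^sub>1 Z a] inner_transpose(1)[of b\<^sub>1 Z b] symmetric by auto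
  have f4: "b\<^sub>1 \<bullet> (f\<^sub>4 *\<^sub>v d) = d \<bullet> (C *\<^sub>v (X *\<^sub>v b\<^sub>1)) + d \<bullet> (D\<^sub>M *\<^sub>v (L\<^sub>X *\<^sub>v b\<^sub>1)) - d \<bullet> (D\<^sub>N *\<^sub>v (L\<^sub>Y *\<^sub>v b\<^sub>1))"
    unfolding f_defs by (simp add: lin_simps inner_simps del: transpose_mult)
  have f5: "b\<^sub>2 \<bullet> (f\<^sub>5 *\<^sub>v d) = d \<bullet> (C *\<^sub>v (Z *\<^sub>v b\<^sub>2)) + d \<bullet> (D\<^sub>M *\<^sub>v (L\<^sub>X *\<^sub>v b\<^sub>2)) - d \<bullet> (D\<^sub>N *\<^sub>v (L\<^sub>Y *\<^sub>v b\<^sub>2))"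
    unfolding f_defs by (simp add: lin_simps inner_simps del: transpose_mult)
  have f6: "c \<bullet> (f\<^sub>6 *\<^sub>v d) = d \<bullet> (D\<^sub>M *\<^sub>v (R\<^sub>X *\<^sub>v c)) - d \<bullet> (D\<^sub>N *\<^sub>v (R\<^sub>Y *\<^sub>v c)) - d \<bullet> c"
    unfolding f_defs using inner_commute[of c d]
    by (simp add: lin_simps inner_simps del: transpose_mult)
  show ?thesis
    unfolding form f4 f5 f6 unfolding f_defs(1-3) \<Delta>_def plant_residual_def filter_residual_def
      error_output_def ab
    by (simp add: lin_simps inner_simps sym)
qed

end

section \<open>Dissipation and stability\<close>

text \<open>
  A complex vector is treated as the pair of its real and imaginary parts. The two vectors on the left
  are the parts of \<open>- z (u + i w)\<close> for \<open>z = c + i s\<close>, so this is \<open>|z|\<^sup>2\<close> times the Hermitian form.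
\<close>

lemma rotation_preserves_form:
  fixes S :: "real mat"
  assumes S: "S \<in> carrier_mat k k" "S\<^sup>T = S" and [simp]: "dim_vec u = k" "dim_vec w = k"
  shows "(s \<cdot>\<^sub>v w - c \<cdot>\<^sub>v u) \<bullet> (S *\<^sub>v (s \<cdot>\<^sub>v w - c \<cdot>\<^sub>v u))
       + (- (c \<cdot>\<^sub>v w) - s \<cdot>\<^sub>v u) \<bullet> (S *\<^sub>v (- (c \<cdot>\<^sub>v w) - s \<cdot>\<^sub>v u))
       = (c\<^sup>2 + s\<^sup>2) * (u \<bullet> (S *\<^sub>v u) + w \<bullet> (S *\<^sub>v w))"
proof -
  have [simp]: "dim_row S = k" "dim_col S = k" using S by auto
  have "u \<bullet> (S *\<^sub>v w) = w \<bullet> (S *\<^sub>v u)"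
    using inner_transpose(1)[of u S w] S(2) by simp
  then show ?thesis
    by (simp add: lin_simps inner_simps power2_eq_square algebra_simps)
qed

context lmi_variables
begin

lemma lmi_form_pos:
  assumes "pos_def lmi"
    and v [simp]: "dim_vec a\<^sub>1 = k" "dim_vec a = k" "dim_vec b\<^sub>1 = k" "dim_vec b = k"
      "dim_vec c = p" "dim_vec d = p"
    and nz: "a\<^sub>1 \<noteq> 0\<^sub>v k \<or> a \<noteq> 0\<^sub>v k \<or> b \<noteq> 0\<^sub>v k"
  shows "0 < test_vec a\<^sub>1 a b\<^sub>1 b c d \<bullet> (lmi *\<^sub>v test_vec a\<^sub>1 a b\<^sub>1 b c d)"
proof -
  let ?t = "test_vec a\<^sub>1 a b\<^sub>1 b c d"
  have "?t \<noteq> 0\<^sub>v (4 * k + 2 * p)"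
  proof
    assume "?t = 0\<^sub>v (4 * k + 2 * p)"
    then have "?t \<bullet> ?t = 0" by (simp add: inner_zero)
    then have "a\<^sub>1 \<bullet> a\<^sub>1 + ((a - a\<^sub>1) \<bullet> (a - a\<^sub>1) + (b\<^sub>1 \<bullet> b\<^sub>1 + ((b - b\<^sub>1) \<bullet> (b - b\<^sub>1)
        + (c \<bullet> c + d \<bullet> d)))) = 0"
      unfolding test_vec_def by (simp add: inner_append)
    then have "a\<^sub>1 \<bullet> a\<^sub>1 = 0" "(a - a\<^sub>1) \<bullet> (a - a\<^sub>1) = 0" "b\<^sub>1 \<bullet> b\<^sub>1 = 0" "(b - b\<^sub>1) \<bullet> (b - b\<^sub>1) = 0"
      using inner_self_nonneg[of a\<^sub>1] inner_self_nonneg[of "a - a\<^sub>1"] inner_self_nonneg[of b\<^sub>1]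
        inner_self_nonneg[of "b - b\<^sub>1"] inner_self_nonneg[of c] inner_self_nonneg[of d]
      by linarith+
    then have z: "a\<^sub>1 = 0\<^sub>v k" "a - a\<^sub>1 = 0\<^sub>v k" "b\<^sub>1 = 0\<^sub>v k" "b - b\<^sub>1 = 0\<^sub>v k"
      by (simp_all add: inner_self_eq_0_iff)
    have "a = (a - a\<^sub>1) + a\<^sub>1" "b = (b - b\<^sub>1) + b\<^sub>1" by (auto intro!: eq_vecI)
    then show False using nz z by simp
  qed
  then show ?thesis
    using assms(1) dim_lmi dim_test_vec[OF v] by (auto simp: pos_def_def)
qed

lemma Z_pos:
  assumes "pos_def lmi" "v \<in> carrier_vec k" "v \<noteq> 0\<^sub>v k"
  shows "v \<bullet> (Z *\<^sub>v v) > 0"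
proof -
  have [simp]: "dim_vec v = k" using assms by simp
  have "0 < test_vec (0\<^sub>v k) v (0\<^sub>v k) (0\<^sub>v k) (0\<^sub>v p) (0\<^sub>v p)
      \<bullet> (lmi *\<^sub>v test_vec (0\<^sub>v k) v (0\<^sub>v k) (0\<^sub>v k) (0\<^sub>v p) (0\<^sub>v p))"
    by (rule lmi_form_pos) (use assms in auto)
  then show ?thesis
    by (subst (asm) lmi_quadratic_form) (simp_all add: inner_simps lin_simps filter_residual_def
        plant_residual_def error_output_def)
qed

lemma \<Delta>_pos:
  assumes "pos_def lmi" "v \<in> carrier_vec k" "v \<noteq> 0\<^sub>v k"
  shows "v \<bullet> (\<Delta> *\<^sub>v v) > 0"
proof -
  have [simp]: "dim_vec v = k" using assms by simp
  have "0 < test_vec v (0\<^sub>v k) (0\<^sub>v k) (0\<^sub>v k) (0\<^sub>v p) (0\<^sub>v p)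
      \<bullet> (lmi *\<^sub>v test_vec v (0\<^sub>v k) (0\<^sub>v k) (0\<^sub>v k) (0\<^sub>v p) (0\<^sub>v p))"
    by (rule lmi_form_pos) (use assms in auto)
  then show ?thesis
    by (subst (asm) lmi_quadratic_form) (simp_all add: inner_simps lin_simps filter_residual_def
        plant_residual_def error_output_def)
qed

text \<open>
  The premises say that \<open>u + i w\<close> is a mode of \<open>Z\<^sup>-\<^sup>1 Q\<close> with eigenvalue \<open>\<lambda> = co + i si\<close>. The test vector with
  \<open>a = - \<lambda> b\<close> and zero in the other positions makes the filter residual vanish, and its value is
  \<open>(1 - |\<lambda>|\<^sup>2)\<close> times the storage of the mode.
\<close>

lemma filter_mode_stable:
  assumes pd: "pos_def lmi"
    and [simp]: "dim_vec u = k" "dim_vec w = k" and nz: "u \<noteq> 0\<^sub>v k \<or> w \<noteq> 0\<^sub>v k"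
    and re: "Q *\<^sub>v u = co \<cdot>\<^sub>v (Z *\<^sub>v u) - si \<cdot>\<^sub>v (Z *\<^sub>v w)"
    and im: "Q *\<^sub>v w = co \<cdot>\<^sub>v (Z *\<^sub>v w) + si \<cdot>\<^sub>v (Z *\<^sub>v u)"
  shows "co\<^sup>2 + si\<^sup>2 < 1"
proof -
  let ?a = "si \<cdot>\<^sub>v w - co \<cdot>\<^sub>v u" and ?a' = "- (co \<cdot>\<^sub>v w) - si \<cdot>\<^sub>v u"
  have res: "filter_residual ?a u (0\<^sub>v p) = 0\<^sub>v k" "filter_residual ?a' w (0\<^sub>v p) = 0\<^sub>v k"
    unfolding filter_residual_def using re im
    by (auto simp: lin_simps intro!: eq_vecI)
  have form: "test_vec (0\<^sub>v k) a (0\<^sub>v k) b (0\<^sub>v p) (0\<^sub>v p)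
      \<bullet> (lmi *\<^sub>v test_vec (0\<^sub>v k) a (0\<^sub>v k) b (0\<^sub>v p) (0\<^sub>v p)) = b \<bullet> (Z *\<^sub>v b) - a \<bullet> (Z *\<^sub>v a)"
    if "filter_residual a b (0\<^sub>v p) = 0\<^sub>v k" "dim_vec a = k" "dim_vec b = k" for a b
    by (subst lmi_quadratic_form)
      (use that in \<open>simp_all add: inner_simps lin_simps plant_residual_def error_output_def\<close>)
  have pos: "b \<bullet> (Z *\<^sub>v b) - a \<bullet> (Z *\<^sub>v a) > 0"
    if "filter_residual a b (0\<^sub>v p) = 0\<^sub>v k" "dim_vec a = k" "dim_vec b = k" "b \<noteq> 0\<^sub>v k" for a b
    using lmi_form_pos[OF pd, of "0\<^sub>v k" a "0\<^sub>v k" b "0\<^sub>v p" "0\<^sub>v p"] form[of a b] that by auto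
  have nonneg: "b \<bullet> (Z *\<^sub>v b) - a \<bullet> (Z *\<^sub>v a) \<ge> 0"
    if "filter_residual a b (0\<^sub>v p) = 0\<^sub>v k" "dim_vec a = k" "dim_vec b = k" for a b
  proof (cases "a = 0\<^sub>v k \<and> b = 0\<^sub>v k")
    case False
    then show ?thesis
      using lmi_form_pos[OF pd, of "0\<^sub>v k" a "0\<^sub>v k" b "0\<^sub>v p" "0\<^sub>v p"] form[of a b] that by auto
  qed (simp add: inner_simps lin_simps)
  have Zn: "v \<bullet> (Z *\<^sub>v v) \<ge> 0" if "dim_vec v = k" for v
    using Z_pos[OF pd, of v] that by (cases "v = 0\<^sub>v k") (auto simp: inner_simps lin_simps less_imp_le intro: carrier_vecI)
  define E where "E = u \<bullet> (Z *\<^sub>v u) + w \<bullet> (Z *\<^sub>v w)"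
  have "?a \<bullet> (Z *\<^sub>v ?a) + ?a' \<bullet> (Z *\<^sub>v ?a') = (co\<^sup>2 + si\<^sup>2) * E"
    unfolding E_def by (rule rotation_preserves_form) (use carriers symmetric in auto)
  moreover have "0 < (u \<bullet> (Z *\<^sub>v u) - ?a \<bullet> (Z *\<^sub>v ?a)) + (w \<bullet> (Z *\<^sub>v w) - ?a' \<bullet> (Z *\<^sub>v ?a'))"
  proof (cases "u = 0\<^sub>v k")
    case True
    then have "w \<noteq> 0\<^sub>v k" using nz by simp
    then have "0 < w \<bullet> (Z *\<^sub>v w) - ?a' \<bullet> (Z *\<^sub>v ?a')" by (intro pos res) auto
    moreover have "0 \<le> u \<bullet> (Z *\<^sub>v u) - ?a \<bullet> (Z *\<^sub>v ?a)" by (intro nonneg res) auto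
    ultimately show ?thesis by linarith
  next
    case False
    then have "0 < u \<bullet> (Z *\<^sub>v u) - ?a \<bullet> (Z *\<^sub>v ?a)" by (intro pos res) auto
    moreover have "0 \<le> w \<bullet> (Z *\<^sub>v w) - ?a' \<bullet> (Z *\<^sub>v ?a')" by (intro nonneg res) auto
    ultimately show ?thesis by linarith
  qed
  ultimately have "(1 - (co\<^sup>2 + si\<^sup>2)) * E > 0" by (simp add: E_def algebra_simps)
  moreover have "E \<ge> 0" unfolding E_def using Zn[of u] Zn[of w] by simp
  ultimately show ?thesis by (simp add: zero_less_mult_iff)
qed

text \<open>
  The premises are the real and imaginary parts of the state equations of the cascade at the frequency
  \<open>z = co + i si\<close>. The vector \<open>b\<close> is determined by \<open>\<Delta> b + Z q = x\<close>, the multipliers are \<open>- z b\<close> and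
  \<open>- z q\<close>, and \<open>d = - y / \<epsilon>\<^sup>2\<close> minimizes the form in \<open>d\<close>.
\<close>

lemma dissipation:
  assumes pd: "pos_def lmi"
    and coercive: "\<And>v. v \<in> carrier_vec (4 * k + 2 * p) \<Longrightarrow> \<eta> * (v \<bullet> v) \<le> v \<bullet> (lmi *\<^sub>v v)" "\<eta> > 0"
    and \<epsilon>: "\<epsilon> > 0" and unit: "co\<^sup>2 + si\<^sup>2 = 1"
    and [simp]: "dim_vec x = k" "dim_vec x' = k" "dim_vec q = k" "dim_vec q' = k"
      "dim_vec v = p" "dim_vec v' = p"
    and x_re: "A *\<^sub>v x + B\<^sub>M *\<^sub>v (L\<^sub>X *\<^sub>v q + R\<^sub>X *\<^sub>v v) - B\<^sub>N *\<^sub>v (L\<^sub>Y *\<^sub>v q + R\<^sub>Y *\<^sub>v v) = co \<cdot>\<^sub>v x - si \<cdot>\<^sub>v x'"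
    and x_im: "A *\<^sub>v x' + B\<^sub>M *\<^sub>v (L\<^sub>X *\<^sub>v q' + R\<^sub>X *\<^sub>v v') - B\<^sub>N *\<^sub>v (L\<^sub>Y *\<^sub>v q' + R\<^sub>Y *\<^sub>v v') = co \<cdot>\<^sub>v x' + si \<cdot>\<^sub>v x"
    and q_re: "Q *\<^sub>v q + F *\<^sub>v v = co \<cdot>\<^sub>v (Z *\<^sub>v q) - si \<cdot>\<^sub>v (Z *\<^sub>v q')"
    and q_im: "Q *\<^sub>v q' + F *\<^sub>v v' = co \<cdot>\<^sub>v (Z *\<^sub>v q') + si \<cdot>\<^sub>v (Z *\<^sub>v q)"
    and y: "y = C *\<^sub>v x + D\<^sub>M *\<^sub>v (L\<^sub>X *\<^sub>v q + R\<^sub>X *\<^sub>v v) - D\<^sub>N *\<^sub>v (L\<^sub>Y *\<^sub>v q + R\<^sub>Y *\<^sub>v v) - v"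
    and y': "y' = C *\<^sub>v x' + D\<^sub>M *\<^sub>v (L\<^sub>X *\<^sub>v q' + R\<^sub>X *\<^sub>v v') - D\<^sub>N *\<^sub>v (L\<^sub>Y *\<^sub>v q' + R\<^sub>Y *\<^sub>v v') - v'"
  shows "y \<bullet> y + y' \<bullet> y' \<le> \<epsilon>\<^sup>2 * (1 - \<eta>) * (v \<bullet> v + v' \<bullet> v')"
proof -
  obtain \<Delta>i where \<Delta>i: "\<Delta>i \<in> carrier_mat k k" "\<Delta> * \<Delta>i = 1\<^sub>m k"
    using pos_form_inverse[of \<Delta> k] \<Delta>_pos[OF pd] by (metis carrier_matI dims(29,30))
  have [simp]: "dim_row \<Delta>i = k" "dim_col \<Delta>i = k" using \<Delta>i by auto
  define b b' where "b = \<Delta>i *\<^sub>v (x - Z *\<^sub>v q)" and "b' = \<Delta>i *\<^sub>v (x' - Z *\<^sub>v q')"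
  have [simp]: "dim_vec b = k" "dim_vec b' = k" by (simp_all add: b_def b'_def)
  have \<Delta>b: "\<Delta> *\<^sub>v b = x - Z *\<^sub>v q" "\<Delta> *\<^sub>v b' = x' - Z *\<^sub>v q'"
    unfolding b_def b'_def using \<Delta>i
    by (simp_all flip: mult_mat_mult_vec add: one_mat_mult_vec)
  have [simp]: "dim_vec y = p" "dim_vec y' = p" by (simp_all add: y y')
  let ?a\<^sub>1 = "si \<cdot>\<^sub>v b' - co \<cdot>\<^sub>v b" and ?a\<^sub>1' = "- (co \<cdot>\<^sub>v b') - si \<cdot>\<^sub>v b"
  let ?a = "si \<cdot>\<^sub>v q' - co \<cdot>\<^sub>v q" and ?a' = "- (co \<cdot>\<^sub>v q') - si \<cdot>\<^sub>v q"
  have xb: "\<Delta> *\<^sub>v b + Z *\<^sub>v q = x" "\<Delta> *\<^sub>v b' + Z *\<^sub>v q' = x'"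
    unfolding \<Delta>b by (auto intro!: eq_vecI)
  have fr: "filter_residual ?a q v = 0\<^sub>v k" "filter_residual ?a' q' v' = 0\<^sub>v k"
  proof -
    have "filter_residual ?a q v = Z *\<^sub>v ?a + (Q *\<^sub>v q + F *\<^sub>v v)"
      "filter_residual ?a' q' v' = Z *\<^sub>v ?a' + (Q *\<^sub>v q' + F *\<^sub>v v')"
      unfolding filter_residual_def by (auto intro!: eq_vecI)
    then show "filter_residual ?a q v = 0\<^sub>v k" "filter_residual ?a' q' v' = 0\<^sub>v k"
      unfolding q_re q_im by (auto simp: lin_simps intro!: eq_vecI)
  qed
  have pr: "plant_residual ?a\<^sub>1 ?a b q v = 0\<^sub>v k" "plant_residual ?a\<^sub>1' ?a' b' q' v' = 0\<^sub>v k"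
  proof -
    have "plant_residual ?a\<^sub>1 ?a b q v = \<Delta> *\<^sub>v ?a\<^sub>1 + Z *\<^sub>v ?a
        + (A *\<^sub>v x + B\<^sub>M *\<^sub>v (L\<^sub>X *\<^sub>v q + R\<^sub>X *\<^sub>v v) - B\<^sub>N *\<^sub>v (L\<^sub>Y *\<^sub>v q + R\<^sub>Y *\<^sub>v v))"
      unfolding plant_residual_def xb by (intro eq_vecI) (simp_all del: index_mult_mat_vec)
    moreover have "plant_residual ?a\<^sub>1' ?a' b' q' v' = \<Delta> *\<^sub>v ?a\<^sub>1' + Z *\<^sub>v ?a'
        + (A *\<^sub>v x' + B\<^sub>M *\<^sub>v (L\<^sub>X *\<^sub>v q' + R\<^sub>X *\<^sub>v v') - B\<^sub>N *\<^sub>v (L\<^sub>Y *\<^sub>v q' + R\<^sub>Y *\<^sub>v v'))"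
      unfolding plant_residual_def xb by (intro eq_vecI) (simp_all del: index_mult_mat_vec)
    ultimately show "plant_residual ?a\<^sub>1 ?a b q v = 0\<^sub>v k" "plant_residual ?a\<^sub>1' ?a' b' q' v' = 0\<^sub>v k"
      unfolding x_re x_im
      by (auto simp: lin_simps \<Delta>b algebra_simps intro!: eq_vecI simp del: index_mult_mat_vec)
  qed
  have eo: "error_output b q v = y" "error_output b' q' v' = y'"
    unfolding error_output_def xb y y' by simp_all
  \<comment> \<open>Evaluated at either part alone the storage terms do not cancel; they do in the sum of both parts.\<close>
  have key: "\<eta> * (v \<bullet> v) \<le> b \<bullet> (\<Delta> *\<^sub>v b) + q \<bullet> (Z *\<^sub>v q) - (a\<^sub>1 \<bullet> (\<Delta> *\<^sub>v a\<^sub>1) + a \<bullet> (Z *\<^sub>v a))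
      + v \<bullet> v - 1 / \<epsilon>\<^sup>2 * (y \<bullet> y)"
    if [simp]: "dim_vec a\<^sub>1 = k" "dim_vec a = k" "dim_vec b = k" "dim_vec q = k" "dim_vec v = p" "dim_vec y = p"
      and res: "filter_residual a q v = 0\<^sub>v k" "plant_residual a\<^sub>1 a b q v = 0\<^sub>v k" "error_output b q v = y"
    for a\<^sub>1 a b q v y
  proof -
    let ?t = "test_vec a\<^sub>1 a b q v (- (1 / \<epsilon>\<^sup>2) \<cdot>\<^sub>v y)"
    have "?t \<bullet> ?t = a\<^sub>1 \<bullet> a\<^sub>1 + ((a - a\<^sub>1) \<bullet> (a - a\<^sub>1) + (b \<bullet> b + ((q - b) \<bullet> (q - b)
        + (v \<bullet> v + (- (1 / \<epsilon>\<^sup>2) \<cdot>\<^sub>v y) \<bullet> (- (1 / \<epsilon>\<^sup>2) \<cdot>\<^sub>v y)))))"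
      unfolding test_vec_def by (simp add: inner_append del: scalar_prod_smult_left)
    then have "v \<bullet> v \<le> ?t \<bullet> ?t"
      using inner_self_nonneg[of a\<^sub>1] inner_self_nonneg[of "a - a\<^sub>1"] inner_self_nonneg[of b]
        inner_self_nonneg[of "q - b"] inner_self_nonneg[of "- (1 / \<epsilon>\<^sup>2) \<cdot>\<^sub>v y"] by linarith
    then have "\<eta> * (v \<bullet> v) \<le> \<eta> * (?t \<bullet> ?t)" using coercive(2) by simp
    also have "\<dots> \<le> ?t \<bullet> (lmi *\<^sub>v ?t)"
      by (intro coercive dim_test_vec) auto
    also have "\<dots> = - (a\<^sub>1 \<bullet> (\<Delta> *\<^sub>v a\<^sub>1) + a \<bullet> (Z *\<^sub>v a)) + (b \<bullet> (\<Delta> *\<^sub>v b) + q \<bullet> (Z *\<^sub>v q))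
        + v \<bullet> v - 2 / \<epsilon>\<^sup>2 * (y \<bullet> y) + \<epsilon>\<^sup>2 * (1 / \<epsilon>\<^sup>2 * (1 / \<epsilon>\<^sup>2 * (y \<bullet> y)))"
      by (subst lmi_quadratic_form) (simp_all add: res inner_simps)
    also have "\<epsilon>\<^sup>2 * (1 / \<epsilon>\<^sup>2 * (1 / \<epsilon>\<^sup>2 * (y \<bullet> y))) = 1 / \<epsilon>\<^sup>2 * (y \<bullet> y)"
      using \<epsilon> by (simp add: field_simps power2_eq_square)
    finally show ?thesis by (simp add: algebra_simps)
  qed
  have rot: "?a\<^sub>1 \<bullet> (\<Delta> *\<^sub>v ?a\<^sub>1) + ?a\<^sub>1' \<bullet> (\<Delta> *\<^sub>v ?a\<^sub>1') = b \<bullet> (\<Delta> *\<^sub>v b) + b' \<bullet> (\<Delta> *\<^sub>v b')"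
    "?a \<bullet> (Z *\<^sub>v ?a) + ?a' \<bullet> (Z *\<^sub>v ?a') = q \<bullet> (Z *\<^sub>v q) + q' \<bullet> (Z *\<^sub>v q')"
    using rotation_preserves_form[OF _ symmetric_\<Delta>, of k b b' si co] carrier_matI[of \<Delta> k k]
      rotation_preserves_form[OF carriers(8) symmetric(2), of q q' si co] unit by simp_all
  have "\<eta> * (v \<bullet> v) + \<eta> * (v' \<bullet> v') \<le> v \<bullet> v + v' \<bullet> v' - (1 / \<epsilon>\<^sup>2 * (y \<bullet> y) + 1 / \<epsilon>\<^sup>2 * (y' \<bullet> y'))"
    using key[OF _ _ _ _ _ _ fr(1) pr(1) eo(1)] key[OF _ _ _ _ _ _ fr(2) pr(2) eo(2)] rot by simp
  then have "1 / \<epsilon>\<^sup>2 * (y \<bullet> y + y' \<bullet> y') \<le> (1 - \<eta>) * (v \<bullet> v + v' \<bullet> v')"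
    by (simp add: algebra_simps add_divide_distrib)
  then have "\<epsilon>\<^sup>2 * (1 / \<epsilon>\<^sup>2 * (y \<bullet> y + y' \<bullet> y')) \<le> \<epsilon>\<^sup>2 * ((1 - \<eta>) * (v \<bullet> v + v' \<bullet> v'))"
    by (intro mult_left_mono) auto
  then show ?thesis using \<epsilon> by (simp add: mult.assoc)
qed

end

section \<open>Stable proper rational functions\<close>

interpretation of_real_poly: map_poly_comm_ring_hom complex_of_real ..

abbreviation cpoly :: "real poly \<Rightarrow> complex \<Rightarrow> complex" where
  "cpoly q z \<equiv> poly (map_poly complex_of_real q) z"

text \<open>
  The entries of matrices in \<open>RH_inf\<close> form a ring on which evaluation at a point outside the open unit
  disc is a homomorphism, so identities between such rational functions carry over to their values there.
\<close>

definition stable_rf :: "rfun \<Rightarrow> bool" where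
  "stable_rf f \<longleftrightarrow> rf_proper f \<and> rf_poles f \<subseteq> {z. cmod z < 1}"

lemma rf_num_den:
  "f = to_fract (rf_num f) / to_fract (rf_den f)" "rf_den f \<noteq> 0" "coprime (rf_num f) (rf_den f)"
  by (simp_all add: rf_num_def rf_den_def coprime_quot_of_fract flip: Fract_conv_to_fract)

lemma lowest_terms:
  assumes "b \<noteq> 0" and f: "f = to_fract a / to_fract b"
  obtains c where "c \<noteq> 0" "a = rf_num f * c" "b = rf_den f * c"
proof -
  have "to_fract a / to_fract b = to_fract (rf_num f) / to_fract (rf_den f)"
    using rf_num_den(1)[of f] f by simp
  then have "to_fract (a * rf_den f) = to_fract (rf_num f * b)"
    using assms(1) rf_num_den(2)[of f] by (simp add: frac_eq_eq)
  then have eq: "a * rf_den f = rf_num f * b" by (simp only: to_fract_eq_iff)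
  then have "rf_den f dvd b * rf_num f" by (metis dvd_triv_right mult.commute)
  then have "rf_den f dvd b"
    using rf_num_den(3)[of f] by (simp add: coprime_commute coprime_dvd_mult_left_iff)
  then obtain c where c: "b = rf_den f * c" by (elim dvdE)
  then have "c \<noteq> 0" using assms(1) by auto
  moreover have "a = rf_num f * c"
    using eq rf_num_den(2)[of f] unfolding c by (simp add: mult.left_commute mult.commute)
  ultimately show thesis using c that by blast
qed

text \<open>
  Closure under sums and products is easier to see from arbitrary fractions than from lowest terms, since
  the latter do not multiply.
\<close>

lemma stable_rf_iff_fraction:
  "stable_rf f \<longleftrightarrow> (\<exists>a b. b \<noteq> 0 \<and> f = to_fract a / to_fract b \<and> degree a \<le> degree b \<and>
     (\<forall>z. cpoly b z = 0 \<longrightarrow> cmod z < 1))"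
proof
  assume "stable_rf f"
  then show "\<exists>a b. b \<noteq> 0 \<and> f = to_fract a / to_fract b \<and> degree a \<le> degree b \<and>
     (\<forall>z. cpoly b z = 0 \<longrightarrow> cmod z < 1)"
    using rf_num_den[of f] unfolding stable_rf_def rf_proper_def rf_poles_def by blast
next
  assume "\<exists>a b. b \<noteq> 0 \<and> f = to_fract a / to_fract b \<and> degree a \<le> degree b \<and>
     (\<forall>z. cpoly b z = 0 \<longrightarrow> cmod z < 1)"
  then obtain a b where ab: "b \<noteq> 0" "f = to_fract a / to_fract b" "degree a \<le> degree b"
    and roots: "\<And>z. cpoly b z = 0 \<Longrightarrow> cmod z < 1" by blast
  obtain c where c: "c \<noteq> 0" "a = rf_num f * c" "b = rf_den f * c"
    using lowest_terms[OF ab(1,2)] by blast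
  have "degree (rf_num f) \<le> degree (rf_den f)"
  proof (cases "rf_num f = 0")
    case False
    then show ?thesis using ab(3) c rf_num_den(2)[of f] by (simp add: degree_mult_eq)
  qed simp
  moreover have "cmod z < 1" if "cpoly (rf_den f) z = 0" for z
    using roots[of z] that c by (simp add: of_real_poly.hom_mult)
  ultimately show "stable_rf f" by (auto simp: stable_rf_def rf_proper_def rf_poles_def)
qed

lemma rf_eval_fraction:
  assumes "cpoly b z \<noteq> 0" "f = to_fract a / to_fract b"
  shows "rf_eval f z = cpoly a z / cpoly b z"
proof -
  have "b \<noteq> 0" using assms(1) by auto
  then obtain c where c: "c \<noteq> 0" "a = rf_num f * c" "b = rf_den f * c"
    using lowest_terms assms(2) by blast
  have "cpoly b z = cpoly (rf_den f) z * cpoly c z" "cpoly a z = cpoly (rf_num f) z * cpoly c z"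
    unfolding c(2,3)[THEN arg_cong[where f="\<lambda>q. cpoly q z"]] by (simp_all add: of_real_poly.hom_mult)
  then show ?thesis using assms(1) by (simp add: rf_eval_def)
qed

lemma stable_rf_fractionE:
  assumes "stable_rf f"
  obtains a b where "b \<noteq> 0" "f = to_fract a / to_fract b" "degree a \<le> degree b"
    "\<And>z. 1 \<le> cmod z \<Longrightarrow> cpoly b z \<noteq> 0" "\<And>z. cpoly b z = 0 \<Longrightarrow> cmod z < 1"
  using assms unfolding stable_rf_iff_fraction by (metis linorder_not_le)

lemma stable_rf_add_mult:
  assumes "stable_rf f" "stable_rf g"
  shows "stable_rf (f + g)" "stable_rf (f * g)"
    "1 \<le> cmod z \<Longrightarrow> rf_eval (f + g) z = rf_eval f z + rf_eval g z"
    "1 \<le> cmod z \<Longrightarrow> rf_eval (f * g) z = rf_eval f z * rf_eval g z"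
proof -
  obtain a b where f: "b \<noteq> 0" "f = to_fract a / to_fract b" "degree a \<le> degree b"
    "\<And>z. 1 \<le> cmod z \<Longrightarrow> cpoly b z \<noteq> 0" "\<And>z. cpoly b z = 0 \<Longrightarrow> cmod z < 1"
    using stable_rf_fractionE[OF assms(1)] by blast
  obtain c d where g: "d \<noteq> 0" "g = to_fract c / to_fract d" "degree c \<le> degree d"
    "\<And>z. 1 \<le> cmod z \<Longrightarrow> cpoly d z \<noteq> 0" "\<And>z. cpoly d z = 0 \<Longrightarrow> cmod z < 1"
    using stable_rf_fractionE[OF assms(2)] by blast
  have sum: "f + g = to_fract (a * d + c * b) / to_fract (b * d)"
    using f g by (simp add: add_frac_eq)
  have prod: "f * g = to_fract (a * c) / to_fract (b * d)"
    using f g by simp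
  have bd: "b * d \<noteq> 0" "\<And>z. cpoly (b * d) z = 0 \<Longrightarrow> cmod z < 1"
    "\<And>z. 1 \<le> cmod z \<Longrightarrow> cpoly (b * d) z \<noteq> 0"
    using f g by (auto simp: of_real_poly.hom_mult)
  have deg: "degree (b * d) = degree b + degree d" using f g by (simp add: degree_mult_eq)
  have "degree (a * d + c * b) \<le> degree (b * d)"
    unfolding deg using f(3) g(3) degree_mult_le[of a d] degree_mult_le[of c b]
    by (intro degree_add_le) linarith+
  then show "stable_rf (f + g)" unfolding stable_rf_iff_fraction using sum bd by blast
  have "degree (a * c) \<le> degree (b * d)"
    unfolding deg using f(3) g(3) degree_mult_le[of a c] by linarith
  then show "stable_rf (f * g)" unfolding stable_rf_iff_fraction using prod bd by blast
  assume z: "1 \<le> cmod z"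
  show "rf_eval (f + g) z = rf_eval f z + rf_eval g z"
    using rf_eval_fraction[OF bd(3)[OF z] sum] rf_eval_fraction[OF f(4)[OF z] f(2)]
      rf_eval_fraction[OF g(4)[OF z] g(2)] f(4)[OF z] g(4)[OF z]
    by (simp add: of_real_poly.hom_mult of_real_poly.hom_add add_frac_eq)
  show "rf_eval (f * g) z = rf_eval f z * rf_eval g z"
    using rf_eval_fraction[OF bd(3)[OF z] prod] rf_eval_fraction[OF f(4)[OF z] f(2)]
      rf_eval_fraction[OF g(4)[OF z] g(2)]
    by (simp add: of_real_poly.hom_mult)
qed

lemma stable_rf_const: "stable_rf (to_fract [:a:])" "rf_eval (to_fract [:a:]) z = of_real a"
  by (simp_all add: stable_rf_def rf_proper_def rf_poles_def rf_num_def rf_den_def rf_eval_def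
      of_real_hom.map_poly_pCons_hom)

lemma stable_rf_0_1: "stable_rf 0" "stable_rf 1" "rf_eval 0 z = 0" "rf_eval 1 z = 1"
  using stable_rf_const[of 0] stable_rf_const[of 1] by (simp_all flip: one_pCons)

lemma stable_rf_uminus:
  assumes "stable_rf f"
  shows "stable_rf (- f)" "1 \<le> cmod z \<Longrightarrow> rf_eval (- f) z = - rf_eval f z"
proof -
  have "[:- 1:] = - (1 :: real poly)" by (simp add: one_pCons)
  then have "- f = to_fract [:- 1:] * f" by simp
  then show "stable_rf (- f)" "1 \<le> cmod z \<Longrightarrow> rf_eval (- f) z = - rf_eval f z"
    using stable_rf_add_mult(2,4)[OF stable_rf_const(1)[of "- 1"] assms] stable_rf_const(2)[of "-1"]
    by auto
qed

lemma stable_rf_minus: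
  assumes "stable_rf f" "stable_rf g"
  shows "stable_rf (f - g)" "1 \<le> cmod z \<Longrightarrow> rf_eval (f - g) z = rf_eval f z - rf_eval g z"
  using stable_rf_add_mult(1,3)[OF assms(1) stable_rf_uminus(1)[OF assms(2)]]
    stable_rf_uminus(2)[OF assms(2)] by auto

lemma stable_rf_sum:
  assumes "\<And>i. i \<in> I \<Longrightarrow> stable_rf (f i)"
  shows "stable_rf (\<Sum>i\<in>I. f i)" "1 \<le> cmod z \<Longrightarrow> rf_eval (\<Sum>i\<in>I. f i) z = (\<Sum>i\<in>I. rf_eval (f i) z)"
proof -
  have "stable_rf (\<Sum>i\<in>I. f i) \<and> (1 \<le> cmod z \<longrightarrow> rf_eval (\<Sum>i\<in>I. f i) z = (\<Sum>i\<in>I. rf_eval (f i) z))"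
    using assms
    by (induction I rule: infinite_finite_induct) (simp_all add: stable_rf_0_1 stable_rf_add_mult)
  then show "stable_rf (\<Sum>i\<in>I. f i)"
    "1 \<le> cmod z \<Longrightarrow> rf_eval (\<Sum>i\<in>I. f i) z = (\<Sum>i\<in>I. rf_eval (f i) z)" by auto
qed

section \<open>Stable transfer matrices and their values outside the unit disc\<close>

lemma RH_inf_iff:
  "T \<in> RH_inf r c \<longleftrightarrow> T \<in> carrier_mat r c \<and> (\<forall>i<r. \<forall>j<c. stable_rf (T $$ (i, j)))"
  by (simp add: RH_inf_def stable_rf_def)

lemma RH_inf_dims: "T \<in> RH_inf r c \<Longrightarrow> dim_row T = r" "T \<in> RH_inf r c \<Longrightarrow> dim_col T = c"
  by (auto simp: RH_inf_iff)

lemma RH_inf_mult: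
  assumes "S \<in> RH_inf r n" "T \<in> RH_inf n c"
  shows "S * T \<in> RH_inf r c" "1 \<le> cmod z \<Longrightarrow> tf_eval (S * T) z = tf_eval S z * tf_eval T z"
proof -
  have st: "stable_rf (S $$ (i, l) * T $$ (l, j))"
    "1 \<le> cmod z \<Longrightarrow> rf_eval (S $$ (i, l) * T $$ (l, j)) z = rf_eval (S $$ (i, l)) z * rf_eval (T $$ (l, j)) z"
    if "i < r" "l < n" "j < c" for i l j
    using assms that by (auto simp: RH_inf_iff stable_rf_add_mult)
  have entry: "(S * T) $$ (i, j) = (\<Sum>l<n. S $$ (i, l) * T $$ (l, j))" if "i < r" "j < c" for i j
    using assms that by (auto simp: RH_inf_iff scalar_prod_def lessThan_atLeast0)
  show "S * T \<in> RH_inf r c"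
  proof (unfold RH_inf_iff, intro conjI allI impI)
    show "S * T \<in> carrier_mat r c" using assms by (auto simp: RH_inf_iff)
    show "stable_rf ((S * T) $$ (i, j))" if "i < r" "j < c" for i j
      unfolding entry[OF that] using st that by (intro stable_rf_sum) auto
  qed
  assume z: "1 \<le> cmod z"
  show "tf_eval (S * T) z = tf_eval S z * tf_eval T z"
  proof (rule eq_matI)
    fix i j assume "i < dim_row (tf_eval S z * tf_eval T z)" "j < dim_col (tf_eval S z * tf_eval T z)"
    then have ij: "i < r" "j < c" using assms by (auto simp: tf_eval_def RH_inf_dims)
    then have "tf_eval (S * T) z $$ (i, j) = rf_eval (\<Sum>l<n. S $$ (i, l) * T $$ (l, j)) z"
      using assms entry[OF ij] by (simp add: tf_eval_def RH_inf_dims)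
    also have "\<dots> = (\<Sum>l<n. rf_eval (S $$ (i, l)) z * rf_eval (T $$ (l, j)) z)"
      using st ij z by (subst stable_rf_sum(2)) auto
    also have "\<dots> = (tf_eval S z * tf_eval T z) $$ (i, j)"
      using ij assms by (auto simp: tf_eval_def RH_inf_dims scalar_prod_def lessThan_atLeast0)
    finally show "tf_eval (S * T) z $$ (i, j) = (tf_eval S z * tf_eval T z) $$ (i, j)" .
  qed (use assms in \<open>auto simp: tf_eval_def RH_inf_dims\<close>)
qed

lemma RH_inf_add_minus:
  assumes "S \<in> RH_inf r c" "T \<in> RH_inf r c"
  shows "S + T \<in> RH_inf r c" "1 \<le> cmod z \<Longrightarrow> tf_eval (S + T) z = tf_eval S z + tf_eval T z"
    "S - T \<in> RH_inf r c" "1 \<le> cmod z \<Longrightarrow> tf_eval (S - T) z = tf_eval S z - tf_eval T z"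
  using assms
  by (auto simp: RH_inf_iff stable_rf_add_mult stable_rf_minus tf_eval_def intro!: eq_matI)

lemma RH_inf_const:
  assumes "D \<in> carrier_mat r c"
  shows "const_tf D \<in> RH_inf r c" "tf_eval (const_tf D) z = map_mat of_real D"
  using assms by (auto simp: RH_inf_iff const_tf_def tf_eval_def stable_rf_const)

lemma RH_inf_one: "1\<^sub>m r \<in> RH_inf r r" "tf_eval (1\<^sub>m r) z = 1\<^sub>m r"
  by (auto simp: RH_inf_iff tf_eval_def stable_rf_0_1)

section \<open>The resolvent of a stable matrix\<close>

text \<open>\<^const>\<open>mat_inv\<close> is computed by Gauss elimination; a right inverse of a square matrix is its value.\<close>

lemma mat_inv_eqI:
  fixes M :: "'a::field mat"
  assumes M: "M \<in> carrier_mat n n" and N: "N \<in> carrier_mat n n" and MN: "M * N = 1\<^sub>m n"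
  shows "mat_inv M = N"
proof -
  have NM: "N * M = 1\<^sub>m n" by (rule mat_mult_left_right_inverse[OF M N MN])
  then have "M \<in> Units (ring_mat TYPE('a) n ())"
    using M N MN by (auto simp: Units_def ring_mat_def)
  then obtain N' where N': "mat_inverse M = Some N'"
    using mat_inverse(1)[OF M, of "()"] by (cases "mat_inverse M") auto
  note N'_props = mat_inverse(2)[OF M N']
  have "N' = (N * M) * N'" using N'_props unfolding NM by auto
  also have "\<dots> = N" using M N N'_props by (simp add: assoc_mult_mat[of _ n n _ n _ n])
  finally show ?thesis by (simp add: mat_inv_def N')
qed

lemma mat_inv_invertible:
  fixes M :: "'a::field mat"
  assumes M: "M \<in> carrier_mat n n" and "invertible_mat M"
  shows "mat_inv M \<in> carrier_mat n n" "M * mat_inv M = 1\<^sub>m n" "mat_inv M * M = 1\<^sub>m n"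
proof -
  obtain N where N: "M * N = 1\<^sub>m n" "N * M = 1\<^sub>m (dim_row N)"
    using assms by (auto simp: invertible_mat_def inverts_mat_def)
  have "dim_row (N * M) = dim_col (N * M)" "dim_col (M * N) = n"
    unfolding N by simp_all
  then have Nc: "N \<in> carrier_mat n n" using M by auto
  have "mat_inv M = N" by (rule mat_inv_eqI[OF M Nc N(1)])
  then show "mat_inv M \<in> carrier_mat n n" "M * mat_inv M = 1\<^sub>m n" "mat_inv M * M = 1\<^sub>m n"
    using N Nc by auto
qed

text \<open>The minor has size \<open>n - 1\<close> and entries of degree at most one, so Cramer's rule gives a proper resolvent.\<close>

lemma degree_cofactor_char_poly_matrix:
  fixes A :: "real mat"
  assumes A: "A \<in> carrier_mat n n" and ij: "i < n" "j < n"
  shows "degree (cofactor (char_poly_matrix A) i j) \<le> n"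
proof -
  let ?M = "mat_delete (char_poly_matrix A) i j"
  have "degree (char_poly_matrix A $$ (a, b)) \<le> 1" if "a < n" "b < n" for a b
    using A that by (auto simp: char_poly_matrix_def intro!: degree_add_le)
  then have "degree (det ?M) \<le> 1 * (n - 1)"
    using carrier_matD[OF char_poly_matrix_closed[OF A]] ij
    by (intro degree_det_le) (auto simp: mat_delete_def)
  moreover have "degree (cofactor (char_poly_matrix A) i j) \<le> degree (det ?M)"
    unfolding cofactor_def by (cases "even (i + j)") (simp_all add: degree_mult_le)
  ultimately show ?thesis by simp
qed

lemma resolvent:
  assumes A: "A \<in> carrier_mat k k" and stable: "schur_stable A"
  defines "V \<equiv> mat_inv (z_var \<cdot>\<^sub>m 1\<^sub>m k - const_tf A)"
  shows "V \<in> RH_inf k k" "(z_var \<cdot>\<^sub>m 1\<^sub>m k - const_tf A) * V = 1\<^sub>m k" "z_var \<cdot>\<^sub>m V \<in> RH_inf k k"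
proof -
  let ?P = "char_poly_matrix A" and ?\<chi> = "char_poly A"
  let ?h = "to_fract :: real poly \<Rightarrow> rfun"
  interpret h: inj_comm_ring_hom ?h by unfold_locales auto
  note adj = adj_mat[OF char_poly_matrix_closed[OF A]]
  have neg: "to_fract [:- a:] = - to_fract [:a:]" "to_fract (pCons (- a) 1) = to_fract [:0, 1:] - to_fract [:a:]"
    for a :: real by (simp_all add: one_pCons flip: to_fract_uminus to_fract_diff)
  have zA: "z_var \<cdot>\<^sub>m 1\<^sub>m k - const_tf A = map_mat ?h ?P"
    using A by (auto simp: z_var_def const_tf_def char_poly_matrix_def neg intro!: eq_matI)
  have \<chi>: "?\<chi> \<noteq> 0" "degree ?\<chi> = k" using degree_monic_char_poly[OF A] by auto
  define W where "W = (1 / ?h ?\<chi>) \<cdot>\<^sub>m map_mat ?h (adj_mat ?P)"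
  have W: "W \<in> carrier_mat k k" using adj by (simp add: W_def)
  have "map_mat ?h ?P * map_mat ?h (adj_mat ?P) = map_mat ?h (?\<chi> \<cdot>\<^sub>m 1\<^sub>m k)"
    using h.mat_hom_mult[OF char_poly_matrix_closed[OF A] adj(1)] adj(2)
    unfolding char_poly_def by simp
  also have "\<dots> = ?h ?\<chi> \<cdot>\<^sub>m 1\<^sub>m k" by (auto intro!: eq_matI)
  finally have "map_mat ?h ?P * W = (1 / ?h ?\<chi>) \<cdot>\<^sub>m (?h ?\<chi> \<cdot>\<^sub>m 1\<^sub>m k)"
    unfolding W_def using adj A char_poly_matrix_closed[OF A]
    by (subst mult_smult_distrib[of _ k k _ k]) auto
  also have "\<dots> = 1\<^sub>m k" using \<chi> by (auto intro!: eq_matI)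
  finally have inv: "map_mat ?h ?P * W = 1\<^sub>m k" .
  have VW: "V = W"
    unfolding V_def zA by (rule mat_inv_eqI[OF _ W inv]) (use A in auto)
  then show "(z_var \<cdot>\<^sub>m 1\<^sub>m k - const_tf A) * V = 1\<^sub>m k" unfolding zA using inv by simp
  have roots: "cmod z < 1" if "cpoly ?\<chi> z = 0" for z
  proof -
    have "poly (char_poly (map_mat complex_of_real A)) z = 0"
      unfolding of_real_hom.char_poly_hom[OF A] by (rule that)
    then have "eigenvalue (map_mat complex_of_real A) z"
      using eigenvalue_root_char_poly[of "map_mat complex_of_real A" k] A by auto
    then show ?thesis using stable by (simp add: schur_stable_def)
  qed
  have entry: "W $$ (i, j) = ?h (cofactor ?P j i) / ?h ?\<chi>" if "i < k" "j < k" for i j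
    using that A by (simp add: W_def adj_mat_def char_poly_matrix_closed[OF A, THEN carrier_matD(1)]
        char_poly_matrix_closed[OF A, THEN carrier_matD(2)])
  have "stable_rf (W $$ (i, j))" if "i < k" "j < k" for i j
    unfolding stable_rf_iff_fraction entry[OF that]
    using \<chi> roots degree_cofactor_char_poly_matrix[OF A that(2,1)] by metis
  then show "V \<in> RH_inf k k" using W VW by (auto simp: RH_inf_iff)
  \<comment> \<open>Multiplication by \<open>z\<close> could destroy properness; here it does not, because \<open>z V = I + A V\<close>.\<close>
  have "z_var \<cdot>\<^sub>m V = 1\<^sub>m k + const_tf A * V"
  proof -
    have "(z_var \<cdot>\<^sub>m 1\<^sub>m k - const_tf A) * V = z_var \<cdot>\<^sub>m V - const_tf A * V"
      using W A unfolding VW const_tf_def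
      by (subst minus_mult_distrib_mat[of _ k k _ _ k]) auto
    then have "1\<^sub>m k = z_var \<cdot>\<^sub>m V - const_tf A * V"
      using \<open>(z_var \<cdot>\<^sub>m 1\<^sub>m k - const_tf A) * V = 1\<^sub>m k\<close> by simp
    then show ?thesis using W A unfolding VW const_tf_def by (auto intro!: eq_matI)
  qed
  then show "z_var \<cdot>\<^sub>m V \<in> RH_inf k k"
    using RH_inf_add_minus(1)[OF RH_inf_one(1) RH_inf_mult(1)[OF RH_inf_const(1)[OF A] \<open>V \<in> RH_inf k k\<close>]]
    by simp
qed

section \<open>State-space responses\<close>

lemma stable_rf_inverse_z: "stable_rf (1 / z_var)" "z \<noteq> 0 \<Longrightarrow> rf_eval (1 / z_var) z = 1 / z"
proof -
  have c: "cpoly [:0, 1:] w = w" for w by (simp add: of_real_hom.map_poly_pCons_hom)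
  have f: "1 / z_var = to_fract 1 / to_fract [:0, 1:]" by (simp add: z_var_def)
  show "stable_rf (1 / z_var)"
    unfolding stable_rf_iff_fraction using f c by (intro exI[of _ 1] exI[of _ "[:0, 1:]"]) auto
  show "rf_eval (1 / z_var) z = 1 / z" if "z \<noteq> 0"
    using rf_eval_fraction[OF _ f, of z] that by (simp add: c)
qed

lemma z_var_neq_0: "z_var \<noteq> 0"
  by (simp add: z_var_def)

text \<open>\<open>z\<close> itself is not proper, but \<open>1 / z\<close> is, so the product rule applies to \<open>f = 1 / z * (z f)\<close>.\<close>

lemma rf_eval_z_var_mult:
  assumes "stable_rf (z_var * f)" "1 \<le> cmod z"
  shows "rf_eval (z_var * f) z = z * rf_eval f z"
proof -
  have "z \<noteq> 0" using assms(2) by auto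
  moreover have "f = 1 / z_var * (z_var * f)" using z_var_neq_0 by simp
  ultimately have "rf_eval f z = 1 / z * rf_eval (z_var * f) z"
    using stable_rf_add_mult(4)[OF stable_rf_inverse_z(1) assms] stable_rf_inverse_z(2) by metis
  then show ?thesis using \<open>z \<noteq> 0\<close> by simp
qed

lemma ss_tf_RH_inf:
  assumes "A \<in> carrier_mat k k" "schur_stable A" "B \<in> carrier_mat k c" "C \<in> carrier_mat r k"
    "D \<in> carrier_mat r c"
  shows "ss_tf A B C D \<in> RH_inf r c"
proof -
  have "dim_row A = k" using assms(1) by auto
  then show ?thesis
    unfolding ss_tf_def
    using RH_inf_mult(1)[OF RH_inf_mult(1)[OF RH_inf_const(1)[OF assms(4)] resolvent(1)[OF assms(1,2)]]
        RH_inf_const(1)[OF assms(3)]] RH_inf_const(1)[OF assms(5)]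
    by (auto intro: RH_inf_add_minus(1))
qed

abbreviation cmat :: "real mat \<Rightarrow> complex mat" where
  "cmat \<equiv> map_mat complex_of_real"

text \<open>
  The resolvent value \<open>W\<close> depends on \<open>A\<close> and \<open>z\<close> alone. Transfer matrices with the same \<open>A\<close> thus have the
  same state, which is what couples \<open>Xt\<close> with \<open>Yt\<close> and \<open>M\<^sub>l\<close> with \<open>N\<^sub>l\<close>.
\<close>

lemma ss_tf_response:
  assumes A: "A \<in> carrier_mat k k" and stable: "schur_stable A" and z: "1 \<le> cmod z"
  obtains W where "W \<in> carrier_mat k k"
    "\<And>y. y \<in> carrier_vec k \<Longrightarrow> z \<cdot>\<^sub>v (W *\<^sub>v y) = cmat A *\<^sub>v (W *\<^sub>v y) + y"
    "\<And>r c B C D v. B \<in> carrier_mat k c \<Longrightarrow> C \<in> carrier_mat r k \<Longrightarrow> D \<in> carrier_mat r c \<Longrightarrow>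
       v \<in> carrier_vec c \<Longrightarrow>
       tf_eval (ss_tf A B C D) z *\<^sub>v v = cmat C *\<^sub>v (W *\<^sub>v (cmat B *\<^sub>v v)) + cmat D *\<^sub>v v"
proof -
  define V where "V = mat_inv (z_var \<cdot>\<^sub>m 1\<^sub>m k - const_tf A)"
  note V = resolvent[OF A stable, folded V_def]
  have Vc: "V \<in> carrier_mat k k" using V(1) by (auto simp: RH_inf_iff)
  define W where "W = tf_eval V z"
  have W: "W \<in> carrier_mat k k" using Vc by (simp add: W_def tf_eval_def)
  have "(z_var \<cdot>\<^sub>m 1\<^sub>m k - const_tf A) * V = z_var \<cdot>\<^sub>m V - const_tf A * V"
    using Vc A unfolding const_tf_def by (subst minus_mult_distrib_mat[of _ k k _ _ k]) auto
  then have "z_var \<cdot>\<^sub>m V - const_tf A * V = 1\<^sub>m k" using V(2) by (rule trans[OF sym])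
  then have "tf_eval (z_var \<cdot>\<^sub>m V - const_tf A * V) z = 1\<^sub>m k" by (simp only: RH_inf_one(2))
  then have "tf_eval (z_var \<cdot>\<^sub>m V) z - cmat A * W = 1\<^sub>m k"
    using RH_inf_add_minus(4)[OF V(3) RH_inf_mult(1)[OF RH_inf_const(1)[OF A] V(1)] z]
      RH_inf_mult(2)[OF RH_inf_const(1)[OF A] V(1) z] RH_inf_const(2)[OF A] by (simp add: W_def)
  moreover have "tf_eval (z_var \<cdot>\<^sub>m V) z = z \<cdot>\<^sub>m W"
    unfolding W_def using V(3) Vc z
    by (intro eq_matI) (auto simp: tf_eval_def RH_inf_iff rf_eval_z_var_mult)
  ultimately have res: "z \<cdot>\<^sub>m W - cmat A * W = 1\<^sub>m k" by simp
  note dims = carrier_matD[OF A] carrier_matD[OF W]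
  show thesis
  proof (rule that[OF W])
    fix y :: "complex vec" assume "y \<in> carrier_vec k"
    then have dy: "dim_vec y = k" by simp
    define x where "x = W *\<^sub>v y"
    have "(z \<cdot>\<^sub>m W - cmat A * W) *\<^sub>v y = z \<cdot>\<^sub>v x - cmat A *\<^sub>v x"
      unfolding x_def by (simp add: lin_simps dims dy)
    then have "y = z \<cdot>\<^sub>v x - cmat A *\<^sub>v x"
      unfolding res by (simp add: lin_simps dims dy)
    then have "cmat A *\<^sub>v x + y = cmat A *\<^sub>v x + (z \<cdot>\<^sub>v x - cmat A *\<^sub>v x)" by simp
    also have "\<dots> = z \<cdot>\<^sub>v x"
      by (intro eq_vecI) (simp_all add: x_def dims dy del: index_mult_mat_vec)
    finally show "z \<cdot>\<^sub>v (W *\<^sub>v y) = cmat A *\<^sub>v (W *\<^sub>v y) + y" by (simp add: x_def)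
  next
    fix r c and B C D :: "real mat" and v :: "complex vec"
    assume B: "B \<in> carrier_mat k c" and C: "C \<in> carrier_mat r k" and D: "D \<in> carrier_mat r c"
      and v: "v \<in> carrier_vec c"
    have "tf_eval (ss_tf A B C D) z = cmat C * W * cmat B + cmat D"
      unfolding ss_tf_def dims(1) V_def[symmetric] W_def
      using RH_inf_const[OF C] RH_inf_const[OF B] RH_inf_const[OF D] V(1) z
      by (simp add: RH_inf_add_minus(2)[of _ r c] RH_inf_mult[of _ r k _ k] RH_inf_mult[of _ r k _ c])
    then show "tf_eval (ss_tf A B C D) z *\<^sub>v v = cmat C *\<^sub>v (W *\<^sub>v (cmat B *\<^sub>v v)) + cmat D *\<^sub>v v"
      using carrier_matD[OF B] carrier_matD[OF C] carrier_matD[OF D] carrier_vecD[OF v]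
      by (simp add: lin_simps dims)
  qed
qed

lemma Re_Im_mult_mat_vec:
  assumes "dim_vec x = dim_col M"
  shows "map_vec Re (cmat M *\<^sub>v x) = M *\<^sub>v map_vec Re x" "map_vec Im (cmat M *\<^sub>v x) = M *\<^sub>v map_vec Im x"
  using assms by (auto simp: scalar_prod_def intro!: eq_vecI)

lemma Re_Im_smult:
  "map_vec Re (z \<cdot>\<^sub>v x) = Re z \<cdot>\<^sub>v map_vec Re x - Im z \<cdot>\<^sub>v map_vec Im x"
  "map_vec Im (z \<cdot>\<^sub>v x) = Re z \<cdot>\<^sub>v map_vec Im x + Im z \<cdot>\<^sub>v map_vec Re x"
  by (auto intro!: eq_vecI)

lemma Re_Im_add_minus:
  assumes "dim_vec x = dim_vec y"
  shows "map_vec Re (x + y) = map_vec Re x + map_vec Re y" "map_vec Im (x + y) = map_vec Im x + map_vec Im y"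
    "map_vec Re (x - y) = map_vec Re x - map_vec Re y" "map_vec Im (x - y) = map_vec Im x - map_vec Im y"
  using assms by (auto intro!: eq_vecI)

lemmas Re_Im_simps = Re_Im_mult_mat_vec Re_Im_smult Re_Im_add_minus

section \<open>Bounds on singular values\<close>

definition norm_sq :: "complex vec \<Rightarrow> real" where
  "norm_sq v = map_vec Re v \<bullet> map_vec Re v + map_vec Im v \<bullet> map_vec Im v"

lemma norm_sq_conjugate: "conjugate v \<bullet> v = of_real (norm_sq v)"
  by (auto simp: norm_sq_def scalar_prod_def complex_eq_iff algebra_simps sum.distrib
      conjugate_complex_def conjugate_vec_def)

lemma norm_sq_pos: "v \<noteq> 0\<^sub>v (dim_vec v) \<Longrightarrow> norm_sq v > 0"
proof (rule ccontr)
  assume v: "v \<noteq> 0\<^sub>v (dim_vec v)" and "\<not> norm_sq v > 0"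
  then have "map_vec Re v \<bullet> map_vec Re v = 0" "map_vec Im v \<bullet> map_vec Im v = 0"
    using inner_self_nonneg[of "map_vec Re v"] inner_self_nonneg[of "map_vec Im v"]
    by (auto simp: norm_sq_def)
  then have z: "map_vec Re v = 0\<^sub>v (dim_vec v)" "map_vec Im v = 0\<^sub>v (dim_vec v)"
    by (simp_all add: inner_self_eq_0_iff)
  have "v $ i = 0" if "i < dim_vec v" for i
    using arg_cong[OF z(1), of "\<lambda>w. vec_index w i"] arg_cong[OF z(2), of "\<lambda>w. vec_index w i"] that
    by (simp add: complex_eq_iff)
  then show False using v by (auto intro!: eq_vecI)
qed

lemma mat_adjoint_eq: "mat_adjoint M = (map_mat cnj M)\<^sup>T"
  unfolding mat_adjoint_def
  by (rule eq_matI) (auto simp: mat_of_rows_def conjugate_complex_def conjugate_vec_def)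

lemma inner_adjoint_mult:
  assumes "dim_vec v = dim_col M"
  shows "conjugate v \<bullet> ((mat_adjoint M * M) *\<^sub>v v) = of_real (norm_sq (M *\<^sub>v v))"
proof -
  have conj: "map_mat cnj M *\<^sub>v conjugate v = conjugate (M *\<^sub>v v)"
    using assms by (auto simp: scalar_prod_def conjugate_complex_def conjugate_vec_def intro!: eq_vecI)
  have "conjugate v \<bullet> ((mat_adjoint M * M) *\<^sub>v v) = (M *\<^sub>v v) \<bullet> (map_mat cnj M *\<^sub>v conjugate v)"
    unfolding mat_adjoint_eq using assms
    by (simp add: lin_simps inner_transpose)
  then show ?thesis unfolding conj using inner_commute[of "M *\<^sub>v v" "conjugate (M *\<^sub>v v)"]
    by (simp add: norm_sq_conjugate)
qed

text \<open>
  \<^const>\<open>sigma_max\<close> is a maximum over a set of eigenvalues, so besides the bound one needs that the set is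
  finite and nonempty: \<open>M\<^sup>* M\<close> has an eigenvalue, and each of its eigenvalues is the quotient
  \<open>|M v|\<^sup>2 / |v|\<^sup>2\<close> for an eigenvector \<open>v\<close>.
\<close>

lemma sigma_max_le:
  assumes M: "M \<in> carrier_mat n n" and n: "0 < n" and b: "0 \<le> b"
    and bound: "\<And>v. v \<in> carrier_vec n \<Longrightarrow> norm_sq (M *\<^sub>v v) \<le> b\<^sup>2 * norm_sq v"
  shows "sigma_max M \<le> b"
proof -
  let ?N = "mat_adjoint M * M"
  have N: "?N \<in> carrier_mat n n" using M by (auto simp: mat_adjoint_eq)
  let ?S = "{s. 0 \<le> s \<and> eigenvalue ?N (of_real (s\<^sup>2))}"
  have ev: "\<exists>t\<ge>0. t \<le> b \<and> \<mu> = of_real (t\<^sup>2)" if \<mu>: "eigenvalue ?N \<mu>" for \<mu>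
  proof -
    obtain v where v: "v \<in> carrier_vec n" "v \<noteq> 0\<^sub>v n" "?N *\<^sub>v v = \<mu> \<cdot>\<^sub>v v"
      using \<mu> N unfolding eigenvalue_def eigenvector_def by auto
    have dv: "dim_vec v = n" using v(1) by simp
    have pos: "norm_sq v > 0" using norm_sq_pos v dv by simp
    have "of_real (norm_sq (M *\<^sub>v v)) = \<mu> * of_real (norm_sq v)"
      using inner_adjoint_mult[of v M] M dv unfolding v(3)
      by (simp add: inner_smult norm_sq_conjugate del: scalar_prod_smult_right)
    then have \<mu>_eq: "\<mu> = of_real (norm_sq (M *\<^sub>v v) / norm_sq v)"
      using pos by (simp add: field_simps)
    have quot: "norm_sq (M *\<^sub>v v) / norm_sq v \<le> b\<^sup>2" "norm_sq (M *\<^sub>v v) / norm_sq v \<ge> 0"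
      using bound[OF v(1)] pos inner_self_nonneg by (auto simp: field_simps norm_sq_def)
    then show ?thesis
      using b real_sqrt_le_mono[OF quot(1)]
      by (intro exI[of _ "sqrt (norm_sq (M *\<^sub>v v) / norm_sq v)"]) (auto simp: \<mu>_eq)
  qed
  have cp: "char_poly ?N \<noteq> 0" "degree (char_poly ?N) = n" using degree_monic_char_poly[OF N] by auto
  have "finite {\<mu>. eigenvalue ?N \<mu>}"
    unfolding eigenvalue_root_char_poly[OF N] using poly_roots_finite[OF cp(1)] .
  moreover have "inj_on (\<lambda>s. complex_of_real (s\<^sup>2)) ?S"
    by (intro inj_onI) (simp add: power2_eq_iff_nonneg del: of_real_power)
  ultimately have fin: "finite ?S"
    by (intro inj_on_finite[of "\<lambda>s. complex_of_real (s\<^sup>2)"]) auto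
  have "\<not> constant (poly (char_poly ?N))" using cp n by (simp add: constant_degree)
  then obtain \<mu> where "eigenvalue ?N \<mu>"
    using fundamental_theorem_of_algebra eigenvalue_root_char_poly[OF N] by blast
  then obtain t where "t \<ge> 0" "\<mu> = of_real (t\<^sup>2)" "eigenvalue ?N \<mu>" using ev by blast
  then have "t \<in> ?S" by (simp del: of_real_power)
  then have "?S \<noteq> {}" unfolding ex_in_conv[symmetric] by (rule exI)
  moreover have "s \<le> b" if s: "s \<in> ?S" for s
  proof -
    obtain t where t: "t \<ge> 0" "t \<le> b" "complex_of_real (s\<^sup>2) = of_real (t\<^sup>2)"
      using ev[of "of_real (s\<^sup>2)"] s by auto
    then have "s\<^sup>2 = t\<^sup>2" by (simp only: of_real_eq_iff)
    then show ?thesis using t s by (simp add: power2_eq_iff_nonneg)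
  qed
  ultimately show ?thesis unfolding sigma_max_def using fin by (intro Max.boundedI) auto
qed

lemma Hinf_norm_le:
  assumes T: "T \<in> carrier_mat n n" and n: "0 < n" and b: "0 \<le> b"
    and bound: "\<And>z v. cmod z = 1 \<Longrightarrow> v \<in> carrier_vec n \<Longrightarrow> norm_sq (tf_eval T z *\<^sub>v v) \<le> b\<^sup>2 * norm_sq v"
  shows "Hinf_norm T \<le> b"
  unfolding Hinf_norm_def
proof (rule cSUP_least)
  show "{z. cmod z = 1} \<noteq> {}" using norm_one by blast
  show "sigma_max (tf_eval T z) \<le> b" if "z \<in> {z. cmod z = 1}" for z
    using that T by (intro sigma_max_le[OF _ n b bound]) (auto simp: tf_eval_def)
qed

section \<open>The controller obtained from the matrix inequality\<close>

context lmi_variables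
begin

lemma Z_invertible:
  assumes "pos_def lmi"
  shows "invertible_mat Z" "mat_inv Z \<in> carrier_mat k k" "Z * mat_inv Z = 1\<^sub>m k"
proof -
  obtain N where N: "N \<in> carrier_mat k k" "Z * N = 1\<^sub>m k" "N * Z = 1\<^sub>m k"
    using pos_form_inverse[OF carriers(8)] Z_pos[OF assms] by metis
  then show inv: "invertible_mat Z"
    by (auto simp: invertible_mat_def inverts_mat_def intro!: exI[of _ N])
  show "mat_inv Z \<in> carrier_mat k k" "Z * mat_inv Z = 1\<^sub>m k"
    using mat_inv_invertible[OF carriers(8) inv] by auto
qed

text \<open>
  \<open>W\<close> is the inverse of \<open>U\<close>. If \<open>x\<close> is the state of the given realization, then \<open>q = W\<^sup>T x\<close> satisfies
  \<open>Z q\<^sup>+ = Q q + F v\<close> and \<open>u = L q + R v\<close>, the equations that the matrix inequality speaks about.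
\<close>

lemma lmi_sufficient:
  assumes pd: "pos_def lmi" and \<epsilon>: "\<epsilon> > 0" and p: "0 < p" and A_stable: "schur_stable A"
    and U: "U \<in> carrier_mat k k" "W \<in> carrier_mat k k" "U * W = 1\<^sub>m k"
    and Ah: "Ah = U\<^sup>T * (mat_inv Z * (Q * W\<^sup>T))" and Bh: "Bh = U\<^sup>T * (mat_inv Z * F)"
    and CX: "CX = L\<^sub>X * W\<^sup>T" and CY: "CY = L\<^sub>Y * W\<^sup>T"
  shows "ss_tf Ah Bh CX R\<^sub>X \<in> RH_inf p p" "ss_tf Ah Bh CY R\<^sub>Y \<in> RH_inf m p"
    "Hinf_norm (ss_tf A B\<^sub>M C D\<^sub>M * ss_tf Ah Bh CX R\<^sub>X - ss_tf A B\<^sub>N C D\<^sub>N * ss_tf Ah Bh CY R\<^sub>Y - 1\<^sub>m p) < \<epsilon>"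
proof -
  note Zi = Z_invertible[OF pd]
  have [simp]: "dim_row U = k" "dim_col U = k" "dim_row W = k" "dim_col W = k"
    "dim_row (mat_inv Z) = k" "dim_col (mat_inv Z) = k"
    using U Zi by auto
  have carr: "Ah \<in> carrier_mat k k" "Bh \<in> carrier_mat k p" "CX \<in> carrier_mat p k" "CY \<in> carrier_mat m k"
    by (auto simp: Ah Bh CX CY)
  note [simp] = carr[THEN carrier_matD(1)] carr[THEN carrier_matD(2)]
  have WU: "W\<^sup>T * U\<^sup>T = 1\<^sub>m k"
    using U by (simp flip: transpose_mult)
  have UW: "U\<^sup>T * W\<^sup>T = 1\<^sub>m k"
    by (rule mat_mult_left_right_inverse[OF _ _ WU]) auto
  have WU_vec: "W\<^sup>T *\<^sub>v (U\<^sup>T *\<^sub>v x) = x" "U\<^sup>T *\<^sub>v (W\<^sup>T *\<^sub>v x) = x" "Z *\<^sub>v (mat_inv Z *\<^sub>v x) = x"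
    if "dim_vec x = k" for x
    using WU UW Zi that by (simp_all flip: mult_mat_mult_vec add: one_mat_mult_vec)
  have ZAh: "Z *\<^sub>v (W\<^sup>T *\<^sub>v (Ah *\<^sub>v x)) = Q *\<^sub>v (W\<^sup>T *\<^sub>v x)" if "dim_vec x = k" for x
    unfolding Ah using that by (simp add: lin_simps WU_vec)
  have ZBh: "Z *\<^sub>v (W\<^sup>T *\<^sub>v (Bh *\<^sub>v x)) = F *\<^sub>v x" if "dim_vec x = p" for x
    unfolding Bh using that by (simp add: lin_simps WU_vec)
  have stable: "schur_stable Ah"
    unfolding schur_stable_def
  proof (intro allI impI)
    fix \<mu> assume "eigenvalue (cmat Ah) \<mu>"
    then obtain v where v: "v \<in> carrier_vec k" "v \<noteq> 0\<^sub>v k" "cmat Ah *\<^sub>v v = \<mu> \<cdot>\<^sub>v v"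
      unfolding eigenvalue_def eigenvector_def by auto
    have dv [simp]: "dim_vec v = k" using v(1) by simp
    define u w where "u = W\<^sup>T *\<^sub>v map_vec Re v" and "w = W\<^sup>T *\<^sub>v map_vec Im v"
    have eqs: "Ah *\<^sub>v map_vec Re v = Re \<mu> \<cdot>\<^sub>v map_vec Re v - Im \<mu> \<cdot>\<^sub>v map_vec Im v"
      "Ah *\<^sub>v map_vec Im v = Re \<mu> \<cdot>\<^sub>v map_vec Im v + Im \<mu> \<cdot>\<^sub>v map_vec Re v"
      using arg_cong[OF v(3), of "map_vec Re"] arg_cong[OF v(3), of "map_vec Im"]
      by (simp_all add: Re_Im_simps)
    have "(Re \<mu>)\<^sup>2 + (Im \<mu>)\<^sup>2 < 1"
    proof (rule filter_mode_stable[OF pd])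
      show "Q *\<^sub>v u = Re \<mu> \<cdot>\<^sub>v (Z *\<^sub>v u) - Im \<mu> \<cdot>\<^sub>v (Z *\<^sub>v w)"
        "Q *\<^sub>v w = Re \<mu> \<cdot>\<^sub>v (Z *\<^sub>v w) + Im \<mu> \<cdot>\<^sub>v (Z *\<^sub>v u)"
        using ZAh[of "map_vec Re v"] ZAh[of "map_vec Im v"] unfolding eqs u_def w_def
        by (simp_all add: lin_simps)
      show "u \<noteq> 0\<^sub>v k \<or> w \<noteq> 0\<^sub>v k"
      proof (rule ccontr)
        assume "\<not> (u \<noteq> 0\<^sub>v k \<or> w \<noteq> 0\<^sub>v k)"
        then have "U\<^sup>T *\<^sub>v u = 0\<^sub>v k" "U\<^sup>T *\<^sub>v w = 0\<^sub>v k"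
          by (simp_all add: lin_simps)
        then have "map_vec Re v = 0\<^sub>v k" "map_vec Im v = 0\<^sub>v k"
          by (simp_all add: u_def w_def WU_vec)
        then have "norm_sq v = 0" by (simp add: norm_sq_def inner_zero)
        then show False using norm_sq_pos[of v] v by simp
      qed
    qed (simp_all add: u_def w_def)
    then show "cmod \<mu> < 1" by (simp add: cmod_def)
  qed
  show RHX: "ss_tf Ah Bh CX R\<^sub>X \<in> RH_inf p p" and RHY: "ss_tf Ah Bh CY R\<^sub>Y \<in> RH_inf m p"
    by (intro ss_tf_RH_inf[OF carr(1) stable carr(2)] carr carriers)+
  have RHM: "ss_tf A B\<^sub>M C D\<^sub>M \<in> RH_inf p p" and RHN: "ss_tf A B\<^sub>N C D\<^sub>N \<in> RH_inf p m"
    by (intro ss_tf_RH_inf[OF carriers(1) A_stable] carriers)+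
  let ?H = "ss_tf A B\<^sub>M C D\<^sub>M * ss_tf Ah Bh CX R\<^sub>X - ss_tf A B\<^sub>N C D\<^sub>N * ss_tf Ah Bh CY R\<^sub>Y - 1\<^sub>m p"
  obtain \<eta>\<^sub>0 where \<eta>\<^sub>0: "\<eta>\<^sub>0 > 0"
    "\<And>v. v \<in> carrier_vec (4 * k + 2 * p) \<Longrightarrow> \<eta>\<^sub>0 * (v \<bullet> v) \<le> v \<bullet> (lmi *\<^sub>v v)"
    using pos_def_coercive[OF dim_lmi pd] by blast
  \<comment> \<open>Below \<open>1\<close>, so that the bound is the square of a real number even for \<open>\<eta>\<^sub>0 > 1\<close>.\<close>
  define \<eta> where "\<eta> = min \<eta>\<^sub>0 (1 / 2)"
  have \<eta>: "\<eta> > 0" "\<eta> \<le> 1 / 2" using \<eta>\<^sub>0 by (auto simp: \<eta>_def)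
  have coercive: "\<eta> * (v \<bullet> v) \<le> v \<bullet> (lmi *\<^sub>v v)" if "v \<in> carrier_vec (4 * k + 2 * p)" for v
    using \<eta>\<^sub>0(2)[OF that] mult_right_mono[of \<eta> \<eta>\<^sub>0 "v \<bullet> v"] inner_self_nonneg[of v]
    by (auto simp: \<eta>_def)
  \<comment> \<open>A single bound for all frequencies, strictly below \<open>\<epsilon>\<close>.\<close>
  define b where "b = \<epsilon> * sqrt (1 - \<eta>)"
  have b: "0 \<le> b" "b < \<epsilon>" "b\<^sup>2 = \<epsilon>\<^sup>2 * (1 - \<eta>)"
    using \<epsilon> \<eta> by (auto simp: b_def power_mult_distrib)
  have "Hinf_norm ?H \<le> b"
  proof (rule Hinf_norm_le[OF _ p b(1)])
    show "?H \<in> carrier_mat p p"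
      using RHM RHX RHN RHY by (auto simp: RH_inf_iff)
    fix z and v :: "complex vec" assume z: "cmod z = 1" and v: "v \<in> carrier_vec p"
    have z1: "1 \<le> cmod z" using z by simp
    have dv [simp]: "dim_vec v = p" using v by simp
    obtain Wh where Wh: "Wh \<in> carrier_mat k k"
      "\<And>y. y \<in> carrier_vec k \<Longrightarrow> z \<cdot>\<^sub>v (Wh *\<^sub>v y) = cmat Ah *\<^sub>v (Wh *\<^sub>v y) + y"
      "\<And>r c B C D v. B \<in> carrier_mat k c \<Longrightarrow> C \<in> carrier_mat r k \<Longrightarrow> D \<in> carrier_mat r c \<Longrightarrow>
         v \<in> carrier_vec c \<Longrightarrow>
         tf_eval (ss_tf Ah B C D) z *\<^sub>v v = cmat C *\<^sub>v (Wh *\<^sub>v (cmat B *\<^sub>v v)) + cmat D *\<^sub>v v"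
      using ss_tf_response[OF carr(1) stable z1] by blast
    obtain Wp where Wp: "Wp \<in> carrier_mat k k"
      "\<And>y. y \<in> carrier_vec k \<Longrightarrow> z \<cdot>\<^sub>v (Wp *\<^sub>v y) = cmat A *\<^sub>v (Wp *\<^sub>v y) + y"
      "\<And>r c B C D v. B \<in> carrier_mat k c \<Longrightarrow> C \<in> carrier_mat r k \<Longrightarrow> D \<in> carrier_mat r c \<Longrightarrow>
         v \<in> carrier_vec c \<Longrightarrow>
         tf_eval (ss_tf A B C D) z *\<^sub>v v = cmat C *\<^sub>v (Wp *\<^sub>v (cmat B *\<^sub>v v)) + cmat D *\<^sub>v v"
      using ss_tf_response[OF carriers(1) A_stable z1] by blast
    have [simp]: "dim_row Wh = k" "dim_col Wh = k" "dim_row Wp = k" "dim_col Wp = k"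
      using Wh Wp by auto
    define xh where "xh = Wh *\<^sub>v (cmat Bh *\<^sub>v v)"
    define uX where "uX = cmat CX *\<^sub>v xh + cmat R\<^sub>X *\<^sub>v v"
    define uY where "uY = cmat CY *\<^sub>v xh + cmat R\<^sub>Y *\<^sub>v v"
    define w where "w = cmat B\<^sub>M *\<^sub>v uX - cmat B\<^sub>N *\<^sub>v uY"
    define x where "x = Wp *\<^sub>v w"
    define y where "y = cmat C *\<^sub>v x + cmat D\<^sub>M *\<^sub>v uX - cmat D\<^sub>N *\<^sub>v uY - v"
    have [simp]: "dim_vec xh = k" "dim_vec uX = p" "dim_vec uY = m" "dim_vec w = k" "dim_vec x = k"
      "dim_vec y = p"
      by (simp_all add: xh_def uX_def uY_def w_def x_def y_def)
    have evX: "tf_eval (ss_tf Ah Bh CX R\<^sub>X) z *\<^sub>v v = uX" and evY: "tf_eval (ss_tf Ah Bh CY R\<^sub>Y) z *\<^sub>v v = uY"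
      unfolding uX_def uY_def xh_def
      by (rule Wh(3)[OF carr(2,3) carriers(13) v], rule Wh(3)[OF carr(2,4) carriers(14) v])
    have evM: "tf_eval (ss_tf A B\<^sub>M C D\<^sub>M) z *\<^sub>v uX = cmat C *\<^sub>v (Wp *\<^sub>v (cmat B\<^sub>M *\<^sub>v uX)) + cmat D\<^sub>M *\<^sub>v uX"
      and evN: "tf_eval (ss_tf A B\<^sub>N C D\<^sub>N) z *\<^sub>v uY = cmat C *\<^sub>v (Wp *\<^sub>v (cmat B\<^sub>N *\<^sub>v uY)) + cmat D\<^sub>N *\<^sub>v uY"
      by (rule Wp(3)[OF carriers(2,4,5)], auto intro: carrier_vecI,
          rule Wp(3)[OF carriers(3,4,6)], auto intro: carrier_vecI)
    have "tf_eval ?H z = tf_eval (ss_tf A B\<^sub>M C D\<^sub>M) z * tf_eval (ss_tf Ah Bh CX R\<^sub>X) z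
        - tf_eval (ss_tf A B\<^sub>N C D\<^sub>N) z * tf_eval (ss_tf Ah Bh CY R\<^sub>Y) z - 1\<^sub>m p"
      using RH_inf_mult(1)[OF RHM RHX] RH_inf_mult(1)[OF RHN RHY] RH_inf_mult(2)[OF RHM RHX z1]
        RH_inf_mult(2)[OF RHN RHY z1] RH_inf_one[of p] z1
      by (simp add: RH_inf_add_minus[of _ p p])
    then have "tf_eval ?H z *\<^sub>v v = tf_eval (ss_tf A B\<^sub>M C D\<^sub>M) z *\<^sub>v uX
        - tf_eval (ss_tf A B\<^sub>N C D\<^sub>N) z *\<^sub>v uY - v"
      using RHM RHX RHN RHY
      by (simp add: lin_simps tf_eval_def RH_inf_dims flip: evX evY)
    also have "\<dots> = y"
      unfolding evM evN y_def x_def w_def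
      by (intro eq_vecI) (simp_all add: lin_simps del: index_mult_mat_vec)
    finally have Hv: "tf_eval ?H z *\<^sub>v v = y" .
    have zx: "z \<cdot>\<^sub>v x = cmat A *\<^sub>v x + w"
      unfolding x_def by (rule Wp(2)) (auto intro: carrier_vecI)
    have zxh: "z \<cdot>\<^sub>v xh = cmat Ah *\<^sub>v xh + cmat Bh *\<^sub>v v"
      unfolding xh_def by (rule Wh(2)) (auto intro: carrier_vecI)
    define q q' where "q = W\<^sup>T *\<^sub>v map_vec Re xh" and "q' = W\<^sup>T *\<^sub>v map_vec Im xh"
    have [simp]: "dim_vec q = k" "dim_vec q' = k" by (simp_all add: q_def q'_def)
    have u_re: "map_vec Re uX = L\<^sub>X *\<^sub>v q + R\<^sub>X *\<^sub>v map_vec Re v" "map_vec Re uY = L\<^sub>Y *\<^sub>v q + R\<^sub>Y *\<^sub>v map_vec Re v"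
      and u_im: "map_vec Im uX = L\<^sub>X *\<^sub>v q' + R\<^sub>X *\<^sub>v map_vec Im v" "map_vec Im uY = L\<^sub>Y *\<^sub>v q' + R\<^sub>Y *\<^sub>v map_vec Im v"
      unfolding uX_def uY_def q_def q'_def CX CY by (simp_all add: Re_Im_simps lin_simps)
    have zxh_re: "Re z \<cdot>\<^sub>v map_vec Re xh - Im z \<cdot>\<^sub>v map_vec Im xh = Ah *\<^sub>v map_vec Re xh + Bh *\<^sub>v map_vec Re v"
      and zxh_im: "Re z \<cdot>\<^sub>v map_vec Im xh + Im z \<cdot>\<^sub>v map_vec Re xh = Ah *\<^sub>v map_vec Im xh + Bh *\<^sub>v map_vec Im v"
      using arg_cong[OF zxh, of "map_vec Re"] arg_cong[OF zxh, of "map_vec Im"]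
      by (simp_all add: Re_Im_simps)
    have zx_re: "Re z \<cdot>\<^sub>v map_vec Re x - Im z \<cdot>\<^sub>v map_vec Im x
        = A *\<^sub>v map_vec Re x + (B\<^sub>M *\<^sub>v map_vec Re uX - B\<^sub>N *\<^sub>v map_vec Re uY)"
      and zx_im: "Re z \<cdot>\<^sub>v map_vec Im x + Im z \<cdot>\<^sub>v map_vec Re x
        = A *\<^sub>v map_vec Im x + (B\<^sub>M *\<^sub>v map_vec Im uX - B\<^sub>N *\<^sub>v map_vec Im uY)"
      using arg_cong[OF zx, of "map_vec Re"] arg_cong[OF zx, of "map_vec Im"]
      by (simp_all add: Re_Im_simps w_def)
    have "map_vec Re y \<bullet> map_vec Re y + map_vec Im y \<bullet> map_vec Im y
        \<le> \<epsilon>\<^sup>2 * (1 - \<eta>) * (map_vec Re v \<bullet> map_vec Re v + map_vec Im v \<bullet> map_vec Im v)"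
    proof (rule dissipation[OF pd coercive \<eta>(1) \<epsilon>])
      show "(Re z)\<^sup>2 + (Im z)\<^sup>2 = 1" using z by (simp add: cmod_def)
      show "A *\<^sub>v map_vec Re x + B\<^sub>M *\<^sub>v (L\<^sub>X *\<^sub>v q + R\<^sub>X *\<^sub>v map_vec Re v)
          - B\<^sub>N *\<^sub>v (L\<^sub>Y *\<^sub>v q + R\<^sub>Y *\<^sub>v map_vec Re v) = Re z \<cdot>\<^sub>v map_vec Re x - Im z \<cdot>\<^sub>v map_vec Im x"
        unfolding zx_re u_re by (intro eq_vecI) (simp_all del: index_mult_mat_vec)
      show "A *\<^sub>v map_vec Im x + B\<^sub>M *\<^sub>v (L\<^sub>X *\<^sub>v q' + R\<^sub>X *\<^sub>v map_vec Im v)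
          - B\<^sub>N *\<^sub>v (L\<^sub>Y *\<^sub>v q' + R\<^sub>Y *\<^sub>v map_vec Im v) = Re z \<cdot>\<^sub>v map_vec Im x + Im z \<cdot>\<^sub>v map_vec Re x"
        unfolding zx_im u_im by (intro eq_vecI) (simp_all del: index_mult_mat_vec)
      show "Q *\<^sub>v q + F *\<^sub>v map_vec Re v = Re z \<cdot>\<^sub>v (Z *\<^sub>v q) - Im z \<cdot>\<^sub>v (Z *\<^sub>v q')"
        using arg_cong[OF zxh_re, of "\<lambda>x. Z *\<^sub>v (W\<^sup>T *\<^sub>v x)"]
        by (simp add: lin_simps ZAh ZBh q_def q'_def)
      show "Q *\<^sub>v q' + F *\<^sub>v map_vec Im v = Re z \<cdot>\<^sub>v (Z *\<^sub>v q') + Im z \<cdot>\<^sub>v (Z *\<^sub>v q)"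
        using arg_cong[OF zxh_im, of "\<lambda>x. Z *\<^sub>v (W\<^sup>T *\<^sub>v x)"]
        by (simp add: lin_simps ZAh ZBh q_def q'_def)
      show "map_vec Re y = C *\<^sub>v map_vec Re x + D\<^sub>M *\<^sub>v (L\<^sub>X *\<^sub>v q + R\<^sub>X *\<^sub>v map_vec Re v)
          - D\<^sub>N *\<^sub>v (L\<^sub>Y *\<^sub>v q + R\<^sub>Y *\<^sub>v map_vec Re v) - map_vec Re v"
        unfolding y_def u_re[symmetric] by (simp add: Re_Im_simps)
      show "map_vec Im y = C *\<^sub>v map_vec Im x + D\<^sub>M *\<^sub>v (L\<^sub>X *\<^sub>v q' + R\<^sub>X *\<^sub>v map_vec Im v)
          - D\<^sub>N *\<^sub>v (L\<^sub>Y *\<^sub>v q' + R\<^sub>Y *\<^sub>v map_vec Im v) - map_vec Im v"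
        unfolding y_def u_im[symmetric] by (simp add: Re_Im_simps)
    qed simp_all
    then show "norm_sq (tf_eval ?H z *\<^sub>v v) \<le> b\<^sup>2 * norm_sq v"
      unfolding Hv b(3) by (simp add: norm_sq_def)
  qed
  then show "Hinf_norm ?H < \<epsilon>" using b(2) by linarith
qed

end

section \<open>Markov parameters\<close>

text \<open>
  The polynomial \<open>q\<close> in the shift operator, applied to a sequence. The expansion at infinity of \<open>a / b\<close> is
  annihilated by \<open>b\<close> in this sense at all positive indices.
\<close>

definition shift_poly :: "'a::comm_ring_1 poly \<Rightarrow> (int \<Rightarrow> 'a) \<Rightarrow> int \<Rightarrow> 'a" where
  "shift_poly q s n = (\<Sum>j\<le>degree q. coeff q j * s (n + int j))"

lemma shift_poly_bound:
  assumes "degree q \<le> N"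
  shows "shift_poly q s n = (\<Sum>j\<le>N. coeff q j * s (n + int j))"
  unfolding shift_poly_def using assms
  by (intro sum.mono_neutral_left) (auto simp: coeff_eq_0 not_le)

lemma shift_poly_pCons:
  "shift_poly (pCons a q) s n = a * s n + shift_poly q s (n + 1)"
proof -
  have "shift_poly (pCons a q) s n = (\<Sum>j\<le>Suc (degree q). coeff (pCons a q) j * s (n + int j))"
    by (rule shift_poly_bound) (simp add: degree_pCons_le)
  also have "\<dots> = a * s n + (\<Sum>j\<le>degree q. coeff q j * s (n + 1 + int j))"
    by (subst sum.atMost_Suc_shift) (simp add: algebra_simps)
  finally show ?thesis by (simp add: shift_poly_def)
qed

text \<open>A linear factor is peeled off, so that a recurrence can be solved one root at a time.\<close>

lemma shift_poly_linear_factor: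
  "shift_poly ([:- \<alpha>, 1:] * q) s n = shift_poly q s (n + 1) - \<alpha> * shift_poly q s n"
proof -
  let ?N = "Suc (degree q)"
  have "degree ([:- \<alpha>, 1:] * q) \<le> ?N"
    by (rule order.trans[OF degree_mult_le]) simp
  then have "shift_poly ([:- \<alpha>, 1:] * q) s n = (\<Sum>j\<le>?N. coeff ([:- \<alpha>, 1:] * q) j * s (n + int j))"
    by (rule shift_poly_bound)
  also have "\<dots> = (\<Sum>j\<le>?N. coeff (pCons 0 q) j * s (n + int j)) - \<alpha> * (\<Sum>j\<le>?N. coeff q j * s (n + int j))"
    unfolding sum_distrib_left sum_subtractf[symmetric]
    by (intro sum.cong) (simp_all add: algebra_simps)
  also have "\<dots> = shift_poly (pCons 0 q) s n - \<alpha> * shift_poly q s n"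
    using shift_poly_bound[of "pCons 0 q" ?N s n] shift_poly_bound[of q ?N s n] degree_pCons_le[of 0 q] by simp
  finally show ?thesis by (simp add: shift_poly_pCons)
qed

text \<open>After the index \<open>N\<close> from which \<open>|e\<^sub>n| < \<delta> (1 - |\<alpha>|) / 2\<close>, the perturbations add up to at most \<open>\<delta> / 2\<close>.\<close>

lemma first_order_recurrence_tendsto_0:
  fixes t e :: "nat \<Rightarrow> complex"
  assumes rec: "\<And>n. t (Suc n) = \<alpha> * t n + e n" and \<alpha>: "cmod \<alpha> < 1" and e: "e \<longlonglongrightarrow> 0"
  shows "t \<longlonglongrightarrow> 0"
proof (rule LIMSEQ_I)
  fix \<delta> :: real assume \<delta>: "0 < \<delta>"
  define r where "r = cmod \<alpha>"
  have r: "0 \<le> r" "r < 1" using \<alpha> by (auto simp: r_def)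
  have "0 < \<delta> / 2 * (1 - r)" using r \<delta> by simp
  then obtain N where N: "\<And>n. n \<ge> N \<Longrightarrow> cmod (e n) < \<delta> / 2 * (1 - r)"
    using LIMSEQ_D[OF e] by (metis diff_zero)
  have bound: "cmod (t (N + i)) \<le> r ^ i * cmod (t N) + \<delta> / 2" for i
  proof (induction i)
    case 0
    then show ?case using \<delta> by simp
  next
    case (Suc i)
    have "cmod (t (N + Suc i)) \<le> r * cmod (t (N + i)) + cmod (e (N + i))"
      using norm_triangle_ineq[of "\<alpha> * t (N + i)" "e (N + i)"] by (simp add: rec norm_mult r_def)
    also have "\<dots> \<le> r * (r ^ i * cmod (t N) + \<delta> / 2) + \<delta> / 2 * (1 - r)"
      using Suc r N[of "N + i"] by (intro add_mono mult_left_mono) auto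
    also have "\<dots> = r ^ Suc i * cmod (t N) + \<delta> / 2"
      by (simp add: algebra_simps diff_divide_distrib)
    finally show ?case .
  qed
  have "(\<lambda>i. r ^ i * cmod (t N)) \<longlonglongrightarrow> 0 * cmod (t N)"
    using r by (intro tendsto_mult LIMSEQ_power_zero tendsto_const) auto
  then obtain M where M: "\<And>i. i \<ge> M \<Longrightarrow> r ^ i * cmod (t N) < \<delta> / 2"
    using LIMSEQ_D[of "\<lambda>i. r ^ i * cmod (t N)" 0 "\<delta> / 2"] \<delta> by force
  show "\<exists>no. \<forall>n\<ge>no. norm (t n - 0) < \<delta>"
  proof (intro exI allI impI)
    fix n assume n: "n \<ge> N + M"
    then have "cmod (t n) \<le> r ^ (n - N) * cmod (t N) + \<delta> / 2" using bound[of "n - N"] by simp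
    moreover have "r ^ (n - N) * cmod (t N) < \<delta> / 2" using n by (intro M) simp
    ultimately show "norm (t n - 0) < \<delta>" by simp
  qed
qed

text \<open>
  Induction on the degree: for a root \<open>\<alpha>\<close> of \<open>b = (x - \<alpha>) q\<close> the sequence \<open>q(shift) s\<close> solves a first-order
  recurrence with multiplier \<open>\<alpha>\<close>.
\<close>

lemma stable_recurrence_tendsto_0:
  fixes b :: "complex poly"
  assumes "b \<noteq> 0" "\<And>z. poly b z = 0 \<Longrightarrow> cmod z < 1"
    and "(\<lambda>n. shift_poly b s (int n)) \<longlonglongrightarrow> 0"
  shows "(\<lambda>n. s (int n)) \<longlonglongrightarrow> 0"
  using assms
proof (induction "degree b" arbitrary: b)
  case 0
  then obtain c where c: "b = [:c:]" by (metis degree_eq_zeroE)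
  then have "(\<lambda>n. c * s (int n)) \<longlonglongrightarrow> 0" using 0 by (simp add: shift_poly_def)
  then have "(\<lambda>n. 1 / c * (c * s (int n))) \<longlonglongrightarrow> 1 / c * 0" by (intro tendsto_mult tendsto_const)
  then show ?case using 0 c by simp
next
  case (Suc d)
  then have "\<not> constant (poly b)" by (simp add: constant_degree)
  then obtain \<alpha> where \<alpha>: "poly b \<alpha> = 0" using fundamental_theorem_of_algebra by blast
  then obtain q where q: "b = [:- \<alpha>, 1:] * q" by (metis dvdE poly_eq_0_iff_dvd)
  have q0: "q \<noteq> 0" using Suc.prems(1) q by auto
  show ?case
  proof (rule Suc.hyps(1)[OF _ q0])
    show "d = degree q" using Suc.hyps(2) q0 unfolding q by (subst (asm) degree_mult_eq) auto
    show "cmod z < 1" if "poly q z = 0" for z using Suc.prems(2)[of z] that q by simp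
    show "(\<lambda>n. shift_poly q s (int n)) \<longlonglongrightarrow> 0"
    proof (rule first_order_recurrence_tendsto_0)
      show "shift_poly q s (int (Suc n)) = \<alpha> * shift_poly q s (int n) + shift_poly b s (int n)" for n
        unfolding q shift_poly_linear_factor by (simp add: add.commute)
      show "cmod \<alpha> < 1" using Suc.prems(2) \<alpha> by blast
    qed (rule Suc.prems(3))
  qed
qed

text \<open>
  The expansion at \<open>z = \<infinity>\<close>: the Laurent series variable stands for \<open>1 / z\<close>. The map is an injective ring
  homomorphism into a field and extends to all rational functions.
\<close>

definition laurent_poly :: "real poly \<Rightarrow> real fls" where
  "laurent_poly q = poly (map_poly fls_const q) fls_X_inv"

interpretation fls_const: comm_ring_hom "fls_const :: real \<Rightarrow> real fls"
  by unfold_locales (simp_all add: fls_plus_const)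

interpretation fls_const_poly: map_poly_comm_ring_hom "fls_const :: real \<Rightarrow> real fls" ..

lemma laurent_poly_hom:
  "laurent_poly (p + q) = laurent_poly p + laurent_poly q" "laurent_poly (p * q) = laurent_poly p * laurent_poly q"
  "laurent_poly [:a:] = fls_const a" "laurent_poly [:0, 1:] = fls_X_inv"
  by (simp_all add: laurent_poly_def fls_const_poly.hom_add fls_const_poly.hom_mult fls_const.map_poly_pCons_hom)

lemma laurent_poly_mult_nth: "fls_nth (laurent_poly q * g) n = shift_poly q (fls_nth g) n"
proof (induction q arbitrary: n)
  case 0
  then show ?case by (simp add: laurent_poly_def shift_poly_def)
next
  case (pCons a q)
  have "laurent_poly (pCons a q) * g = fls_const a * g + fls_X_inv * (laurent_poly q * g)"
    by (simp add: laurent_poly_def fls_const.map_poly_pCons_hom algebra_simps)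
  then show ?case by (simp add: shift_poly_pCons pCons fls_X_inv_times_conv_shift)
qed

lemma laurent_poly_nth: "fls_nth (laurent_poly q) n = (if n \<le> 0 then coeff q (nat (- n)) else 0)"
proof -
  have "fls_nth (laurent_poly q) n = (\<Sum>j\<le>degree q. coeff q j * fls_nth 1 (n + int j))"
    using laurent_poly_mult_nth[of q 1 n] by (simp add: shift_poly_def)
  also have "\<dots> = (\<Sum>j\<le>degree q. if j = nat (- n) then (if n \<le> 0 then coeff q j else 0) else 0)"
    by (intro sum.cong) auto
  also have "\<dots> = (if n \<le> 0 then coeff q (nat (- n)) else 0)"
    by (auto simp: coeff_eq_0)
  finally show ?thesis .
qed

lemma laurent_poly_eq_0_iff: "laurent_poly q = 0 \<longleftrightarrow> q = 0"
proof
  assume "laurent_poly q = 0"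
  then have "coeff q j = 0" for j using laurent_poly_nth[of q "- int j"] by simp
  then show "q = 0" by (simp add: poly_eq_iff)
qed (simp add: laurent_poly_def)

lemma laurent_poly_subdegree:
  assumes "q \<noteq> 0"
  shows "fls_subdegree (laurent_poly q) = - int (degree q)"
  by (rule fls_subdegree_eqI) (use assms in \<open>auto simp: laurent_poly_nth intro!: coeff_eq_0\<close>)

definition laurent :: "rfun \<Rightarrow> real fls" where
  "laurent f = laurent_poly (rf_num f) / laurent_poly (rf_den f)"

text \<open>
  Indices are integers, so that division by \<open>z\<close> is a shift without exception; properness is the vanishing at
  negative indices.
\<close>

definition markov :: "rfun \<Rightarrow> int \<Rightarrow> real" where
  "markov f n = fls_nth (laurent f) n"

lemma laurent_fraction:
  assumes "b \<noteq> 0" "f = to_fract a / to_fract b"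
  shows "laurent f = laurent_poly a / laurent_poly b"
proof -
  obtain c where c: "c \<noteq> 0" "a = rf_num f * c" "b = rf_den f * c"
    using lowest_terms[OF assms] by blast
  have "laurent_poly c \<noteq> 0" "laurent_poly a = laurent_poly (rf_num f) * laurent_poly c"
    "laurent_poly b = laurent_poly (rf_den f) * laurent_poly c"
    using c by (simp_all add: laurent_poly_eq_0_iff flip: laurent_poly_hom)
  then show ?thesis unfolding laurent_def by simp
qed

lemma laurent_hom:
  "laurent (f + g) = laurent f + laurent g" "laurent (f * g) = laurent f * laurent g"
  "laurent (to_fract [:a:]) = fls_const a"
proof -
  have nz: "rf_den f \<noteq> 0" "rf_den g \<noteq> 0" by (simp_all add: rf_num_den)
  have lnz: "laurent_poly (rf_den f) \<noteq> 0" "laurent_poly (rf_den g) \<noteq> 0"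
    using nz by (simp_all add: laurent_poly_eq_0_iff)
  have nz2: "rf_den f * rf_den g \<noteq> 0" using nz by simp
  have sum: "f + g = to_fract (rf_num f * rf_den g + rf_num g * rf_den f) / to_fract (rf_den f * rf_den g)"
    by (subst rf_num_den(1)[of f], subst rf_num_den(1)[of g]) (use nz in \<open>simp add: add_frac_eq\<close>)
  then show "laurent (f + g) = laurent f + laurent g"
    using lnz unfolding laurent_fraction[OF nz2 sum] by (simp add: laurent_def laurent_poly_hom add_frac_eq)
  have prod: "f * g = to_fract (rf_num f * rf_num g) / to_fract (rf_den f * rf_den g)"
    by (subst rf_num_den(1)[of f], subst rf_num_den(1)[of g]) simp
  then show "laurent (f * g) = laurent f * laurent g"
    unfolding laurent_fraction[OF nz2 prod] by (simp add: laurent_def laurent_poly_hom)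
  have "laurent_poly 1 = 1" using laurent_poly_hom(3)[of 1] by (simp flip: one_pCons)
  then show "laurent (to_fract [:a:]) = fls_const a"
    using laurent_fraction[of 1 "to_fract [:a:]" "[:a:]"] by (simp add: laurent_poly_hom)
qed

lemma markov_add: "markov (f + g) n = markov f n + markov g n"
  by (simp add: markov_def laurent_hom)

lemma markov_const_mult: "markov (to_fract [:a:] * f) n = a * markov f n"
  by (simp add: markov_def laurent_hom)

lemma markov_const: "markov (to_fract [:a:]) n = (if n = 0 then a else 0)"
  by (simp add: markov_def laurent_hom)

lemma markov_div_z: "markov (1 / z_var * f) n = markov f (n - 1)"
proof -
  have "laurent (1 / z_var) = laurent_poly [:1:] / laurent_poly [:0, 1:]"
    by (rule laurent_fraction) (simp_all add: z_var_def flip: one_pCons)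
  also have "\<dots> = fls_X"
    unfolding laurent_poly_hom by (simp add: divide_inverse fls_inverse_X_inv)
  finally have X: "laurent (1 / z_var) = fls_X" .
  show ?thesis
    unfolding markov_def laurent_hom(2) X fls_X_times_conv_shift by simp
qed

lemma markov_sum: "markov (\<Sum>i\<in>I. f i) n = (\<Sum>i\<in>I. markov (f i) n)"
proof (induction I rule: infinite_finite_induct)
qed (use markov_const[of 0] in \<open>simp_all add: markov_add\<close>)

lemma markov_negative:
  assumes "stable_rf f" "n < 0"
  shows "markov f n = 0"
proof (cases "f = 0")
  case True
  then show ?thesis using markov_const[of 0] by simp
next
  case False
  let ?a = "rf_num f" and ?b = "rf_den f"
  have nz: "?a \<noteq> 0" "?b \<noteq> 0" using False rf_num_den(1)[of f] rf_num_den(2)[of f] by auto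
  have deg: "degree ?a \<le> degree ?b" using assms(1) by (simp add: stable_rf_def rf_proper_def)
  have lnz: "laurent_poly ?a \<noteq> 0" "laurent_poly ?b \<noteq> 0" using nz by (simp_all add: laurent_poly_eq_0_iff)
  have "laurent_poly ?a = laurent f * laurent_poly ?b" using lnz by (simp add: laurent_def)
  moreover have "laurent f \<noteq> 0" using lnz by (simp add: laurent_def)
  ultimately have "fls_subdegree (laurent_poly ?a) = fls_subdegree (laurent f) + fls_subdegree (laurent_poly ?b)"
    using lnz by simp
  then have "0 \<le> fls_subdegree (laurent f)"
    using deg nz by (simp add: laurent_poly_subdegree)
  then show ?thesis using assms(2) by (simp add: markov_def)
qed

lemma markov_tendsto_0:
  assumes "stable_rf f"
  shows "(\<lambda>n. markov f (int n)) \<longlonglongrightarrow> 0"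
proof -
  let ?a = "rf_num f" and ?b = "rf_den f"
  let ?bc = "map_poly complex_of_real ?b"
  have nz: "?b \<noteq> 0" by (rule rf_num_den)
  have roots: "cmod z < 1" if "poly ?bc z = 0" for z
    using assms that by (auto simp: stable_rf_def rf_poles_def)
  have eq: "laurent_poly ?b * laurent f = laurent_poly ?a"
    using nz by (simp add: laurent_def laurent_poly_eq_0_iff)
  have "shift_poly ?bc (\<lambda>n. complex_of_real (markov f n)) n = of_real (fls_nth (laurent_poly ?a) n)" for n
    using laurent_poly_mult_nth[of ?b "laurent f" n]
    by (simp add: shift_poly_def eq markov_def)
  then have "shift_poly ?bc (\<lambda>n. complex_of_real (markov f n)) (int n) = 0" if "n \<ge> 1" for n
    using that by (simp add: laurent_poly_nth)
  then have "eventually (\<lambda>n. 0 = shift_poly ?bc (\<lambda>n. complex_of_real (markov f n)) (int n)) sequentially"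
    by (auto simp: eventually_sequentially)
  then have "(\<lambda>n. shift_poly ?bc (\<lambda>n. complex_of_real (markov f n)) (int n)) \<longlonglongrightarrow> 0"
    by (rule Lim_transform_eventually[OF tendsto_const])
  then have "(\<lambda>n. complex_of_real (markov f (int n))) \<longlonglongrightarrow> 0"
    by (intro stable_recurrence_tendsto_0[of ?bc "\<lambda>n. complex_of_real (markov f n)"] roots) (simp_all add: nz)
  then show ?thesis by (simp add: tendsto_of_real_iff[where c = "0::real", simplified])
qed

section \<open>Truncated Gramians\<close>

text \<open>\<open>\<Sum>i<n. S\<^sub>i W T\<^sub>i\<^sup>T\<close>. The dimensions are parameters because the empty sum must have them too.\<close>

primrec gram :: "nat \<Rightarrow> nat \<Rightarrow> (nat \<Rightarrow> real mat) \<Rightarrow> real mat \<Rightarrow> (nat \<Rightarrow> real mat) \<Rightarrow> nat \<Rightarrow> real mat" where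
  "gram r c S W T 0 = 0\<^sub>m r c"
| "gram r c S W T (Suc n) = gram r c S W T n + S n * (W * (T n)\<^sup>T)"

lemma dim_gram [simp]:
  assumes "\<And>n. dim_row (S n) = r" "\<And>n. dim_row (T n) = c"
  shows "dim_row (gram r c S W T n) = r" "dim_col (gram r c S W T n) = c"
  using assms by (induction n) auto

lemma gram_Suc_mult_vec:
  assumes "\<And>n. S n \<in> carrier_mat r k" "\<And>n. T n \<in> carrier_mat c k" "W \<in> carrier_mat k k" "dim_vec v = c"
  shows "gram r c S W T (Suc n) *\<^sub>v v = gram r c S W T n *\<^sub>v v + S n *\<^sub>v (W *\<^sub>v ((T n)\<^sup>T *\<^sub>v v))"
proof -
  have [simp]: "dim_row (S n) = r" "dim_col (S n) = k" "dim_row (T n) = c" "dim_col (T n) = k"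
    "dim_row W = k" "dim_col W = k" for n
    using assms(1)[of n] assms(2)[of n] assms(3) by auto
  show ?thesis using assms(4) by (simp add: lin_simps)
qed

lemma gram_symmetric:
  assumes "\<And>n. T n \<in> carrier_mat c k" "W \<in> carrier_mat k k" "W\<^sup>T = W"
  shows "(gram c c T W T n)\<^sup>T = gram c c T W T n"
proof (induction n)
  case (Suc n)
  have G: "gram c c T W T n \<in> carrier_mat c c"
    using assms(1) by (intro carrier_matI) (auto simp: carrier_matD[OF assms(1)])
  have WT: "W * (T n)\<^sup>T \<in> carrier_mat k c" using assms(1)[of n] assms(2) by auto
  have "(T n * (W * (T n)\<^sup>T))\<^sup>T = (T n * W\<^sup>T) * (T n)\<^sup>T"
    using transpose_mult[OF assms(1)[of n] WT] transpose_mult[OF assms(2), of "(T n)\<^sup>T" c] assms(1)[of n]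
    by simp
  also have "\<dots> = T n * (W * (T n)\<^sup>T)"
    unfolding assms(3) using assms(1)[of n] assms(2) by (intro assoc_mult_mat) auto
  finally show ?case
    using Suc transpose_add[OF G, of "T n * (W * (T n)\<^sup>T)"] assms(1)[of n] WT by simp
qed simp

text \<open>The term with index zero is \<open>W\<close>, which dominates the identity, and the others are nonnegative.\<close>

lemma inner_gram_ge:
  assumes T: "\<And>n. T n \<in> carrier_mat c k" and W: "W \<in> carrier_mat k k"
    and T0: "T 0 = 1\<^sub>m c" "k = c" and psd: "\<And>v. dim_vec v = k \<Longrightarrow> v \<bullet> v \<le> v \<bullet> (W *\<^sub>v v)"
    and v: "dim_vec v = c"
  shows "0 < n \<Longrightarrow> v \<bullet> v \<le> v \<bullet> (gram c c T W T n *\<^sub>v v)"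
proof -
  have [simp]: "dim_row (T n) = c" "dim_col (T n) = k" "dim_row W = k" "dim_col W = k" for n
    using T[of n] W by auto
  have step: "v \<bullet> (gram c c T W T (Suc n) *\<^sub>v v) = v \<bullet> (gram c c T W T n *\<^sub>v v)
      + ((T n)\<^sup>T *\<^sub>v v) \<bullet> (W *\<^sub>v ((T n)\<^sup>T *\<^sub>v v))" for n
    unfolding gram_Suc_mult_vec[OF T T W v] using v by (simp add: inner_simps)
  have nonneg: "0 \<le> u \<bullet> (W *\<^sub>v u)" if "dim_vec u = k" for u
    using psd[OF that] inner_self_nonneg[of u] by linarith
  have ge: "v \<bullet> v \<le> v \<bullet> (gram c c T W T (Suc n) *\<^sub>v v)" for n
  proof (induction n)
    case 0
    have "(1\<^sub>m c :: real mat)\<^sup>T *\<^sub>v v = v" using v by (simp add: lin_simps)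
    then show ?case
      unfolding step[of 0] using psd[of v] v T0 by (simp add: lin_simps inner_simps)
  next
    case (Suc n)
    then show ?case unfolding step[of "Suc n"] using nonneg[of "(T (Suc n))\<^sup>T *\<^sub>v v"] by simp
  qed
  then show "v \<bullet> v \<le> v \<bullet> (gram c c T W T n *\<^sub>v v)" if "0 < n"
    using that by (metis Suc_pred)
qed

text \<open>The truncated sum solves the Lyapunov equation \<open>A S A\<^sup>T = S - I\<close> up to the last term, by telescoping.\<close>

lemma lyapunov_gram:
  assumes T: "\<And>n. T n \<in> carrier_mat k k" "T 0 = 1\<^sub>m k" "\<And>n. T (Suc n) = A * T n"
    and A: "A \<in> carrier_mat k k" and v: "dim_vec v = k"
  shows "(A\<^sup>T *\<^sub>v v) \<bullet> (gram k k T (1\<^sub>m k) T n *\<^sub>v (A\<^sup>T *\<^sub>v v))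
    = v \<bullet> (gram k k T (1\<^sub>m k) T n *\<^sub>v v) - v \<bullet> v + ((T n)\<^sup>T *\<^sub>v v) \<bullet> ((T n)\<^sup>T *\<^sub>v v)"
proof -
  have [simp]: "dim_row (T n) = k" "dim_col (T n) = k" "dim_row A = k" "dim_col A = k" for n
    using T(1)[of n] A by auto
  have step: "u \<bullet> (gram k k T (1\<^sub>m k) T (Suc n) *\<^sub>v u) = u \<bullet> (gram k k T (1\<^sub>m k) T n *\<^sub>v u)
      + ((T n)\<^sup>T *\<^sub>v u) \<bullet> ((T n)\<^sup>T *\<^sub>v u)" if "dim_vec u = k" for u n
    by (subst gram_Suc_mult_vec[of _ _ k]) (use T that in \<open>auto simp: inner_simps lin_simps\<close>)
  have AT: "(T n)\<^sup>T *\<^sub>v (A\<^sup>T *\<^sub>v v) = (T (Suc n))\<^sup>T *\<^sub>v v" for n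
    unfolding T(3) transpose_mult[OF A T(1)] using v by (simp add: lin_simps)
  show ?thesis
  proof (induction n)
    case 0
    have "(1\<^sub>m k :: real mat)\<^sup>T *\<^sub>v v = v" using v by (simp add: lin_simps)
    then show ?case using v T(2) by (simp add: lin_simps inner_simps)
  next
    case (Suc n)
    then show ?case using v step[of v n] step[of "A\<^sup>T *\<^sub>v v" n] unfolding AT by (simp del: gram.simps)
  qed
qed

section \<open>A solution from zero-output trajectories\<close>

text \<open>
  The form of the bounded real inequality for the system \<open>(A, 0, C, 0)\<close> with storage \<open>\<delta> S\<close>. Completing the
  square in \<open>b\<close> with \<open>g = A\<^sup>T a + C\<^sup>T d\<close> leaves \<open>\<delta> (a \<bullet> S a - g \<bullet> S g) + \<epsilon>\<^sup>2 |d|\<^sup>2\<close>. The Lyapunov inequality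
  gives \<open>|a|\<^sup>2 / 2\<close>, of which half absorbs the mixed term; all that remains is a multiple of \<open>\<delta> |d|\<^sup>2\<close>,
  which \<open>\<epsilon>\<^sup>2 |d|\<^sup>2\<close> dominates for small \<open>\<delta>\<close>.
\<close>

lemma completed_square_pos:
  fixes S A C :: "real mat"
  assumes S: "S \<in> carrier_mat k k" "S\<^sup>T = S" and A: "A \<in> carrier_mat k k" and C: "C \<in> carrier_mat p k"
    and S_ge: "\<And>v. dim_vec v = k \<Longrightarrow> v \<bullet> v \<le> v \<bullet> (S *\<^sub>v v)"
    and lyap: "\<And>v. dim_vec v = k \<Longrightarrow> (A\<^sup>T *\<^sub>v v) \<bullet> (S *\<^sub>v (A\<^sup>T *\<^sub>v v)) \<le> v \<bullet> (S *\<^sub>v v) - 1 / 2 * (v \<bullet> v)"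
    and \<epsilon>: "\<epsilon> > 0"
  obtains \<delta> where "\<delta> > 0" "\<And>a b d. dim_vec a = k \<Longrightarrow> dim_vec b = k \<Longrightarrow> dim_vec d = p \<Longrightarrow>
      \<delta> * (((b + (A\<^sup>T *\<^sub>v a + C\<^sup>T *\<^sub>v d)) \<bullet> (b + (A\<^sup>T *\<^sub>v a + C\<^sup>T *\<^sub>v d))) + 1 / 4 * (a \<bullet> a) + d \<bullet> d)
      \<le> \<delta> * (a \<bullet> (S *\<^sub>v a) + 2 * (a \<bullet> (A *\<^sub>v (S *\<^sub>v b))) + b \<bullet> (S *\<^sub>v b) + 2 * (d \<bullet> (C *\<^sub>v (S *\<^sub>v b))))
        + \<epsilon>\<^sup>2 * (d \<bullet> d)"
proof -
  have [simp]: "dim_row S = k" "dim_col S = k" "dim_row A = k" "dim_col A = k" "dim_row C = p" "dim_col C = k"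
    using S A C by auto
  define c\<^sub>1 where "c\<^sub>1 = frob (A * (S * C\<^sup>T))"
  define c\<^sub>2 where "c\<^sub>2 = frob (C\<^sup>T) + frob (S * C\<^sup>T)"
  \<comment> \<open>\<open>4 c\<^sub>1\<close> pays for the mixed term, \<open>c\<^sub>2\<close> for \<open>C\<^sup>T d \<bullet> S (C\<^sup>T d)\<close>, and \<open>1\<close> leaves \<open>\<delta> |d|\<^sup>2\<close>.\<close>
  define \<delta> where "\<delta> = \<epsilon>\<^sup>2 / (4 * c\<^sub>1 + c\<^sub>2 + 1)"
  have c: "0 \<le> c\<^sub>1" "0 \<le> c\<^sub>2" using frob_nonneg by (auto simp: c\<^sub>1_def c\<^sub>2_def)
  then have pos: "0 < 4 * c\<^sub>1 + c\<^sub>2 + 1" by linarith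
  have \<delta>: "\<delta> > 0" "\<delta> * (4 * c\<^sub>1 + c\<^sub>2 + 1) = \<epsilon>\<^sup>2"
    using \<epsilon> pos by (auto simp: \<delta>_def)
  show thesis
  proof (rule that[OF \<delta>(1)])
    fix a b d :: "real vec" assume [simp]: "dim_vec a = k" "dim_vec b = k" "dim_vec d = p"
    define h where "h = C\<^sup>T *\<^sub>v d"
    define g where "g = A\<^sup>T *\<^sub>v a + h"
    define w where "w = A *\<^sub>v (S *\<^sub>v h)"
    have [simp]: "dim_vec h = k" "dim_vec g = k" "dim_vec w = k" by (simp_all add: h_def g_def w_def)
    have Ssym: "x \<bullet> (S *\<^sub>v y) = y \<bullet> (S *\<^sub>v x)" if "dim_vec x = k" "dim_vec y = k" for x y
      using inner_transpose(1)[of x S y] S(2) that by simp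
    have sq: "a \<bullet> (S *\<^sub>v a) + 2 * (a \<bullet> (A *\<^sub>v (S *\<^sub>v b))) + b \<bullet> (S *\<^sub>v b) + 2 * (d \<bullet> (C *\<^sub>v (S *\<^sub>v b)))
        = (b + g) \<bullet> (S *\<^sub>v (b + g)) - g \<bullet> (S *\<^sub>v g) + a \<bullet> (S *\<^sub>v a)"
    proof -
      have "(A\<^sup>T *\<^sub>v a) \<bullet> (S *\<^sub>v b) = a \<bullet> (A *\<^sub>v (S *\<^sub>v b))" "h \<bullet> (S *\<^sub>v b) = d \<bullet> (C *\<^sub>v (S *\<^sub>v b))"
        unfolding h_def by (simp_all add: inner_transpose)
      then have "g \<bullet> (S *\<^sub>v b) = a \<bullet> (A *\<^sub>v (S *\<^sub>v b)) + d \<bullet> (C *\<^sub>v (S *\<^sub>v b))"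
        unfolding g_def by (simp add: inner_add)
      then show ?thesis using Ssym[of b g] by (simp add: lin_simps inner_add)
    qed
    have gg: "g \<bullet> (S *\<^sub>v g) = (A\<^sup>T *\<^sub>v a) \<bullet> (S *\<^sub>v (A\<^sup>T *\<^sub>v a)) + 2 * (a \<bullet> w) + h \<bullet> (S *\<^sub>v h)"
    proof -
      have "(A\<^sup>T *\<^sub>v a) \<bullet> (S *\<^sub>v h) = a \<bullet> w" unfolding w_def by (simp add: inner_transpose)
      then show ?thesis using Ssym[of h "A\<^sup>T *\<^sub>v a"] unfolding g_def
        by (simp add: lin_simps inner_add del: inner_transpose)
    qed
    have aw: "2 * (a \<bullet> w) \<le> 1 / 4 * (a \<bullet> a) + 4 * (w \<bullet> w)"
      using inner_self_nonneg[of "(1 / 2) \<cdot>\<^sub>v a - 2 \<cdot>\<^sub>v w"] inner_commute[of w a]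
      by (simp add: inner_simps)
    have "w = (A * (S * C\<^sup>T)) *\<^sub>v d" unfolding w_def h_def by (simp add: lin_simps)
    then have ww: "w \<bullet> w \<le> c\<^sub>1 * (d \<bullet> d)"
      using inner_mult_mat_vec_le_frob[of d "A * (S * C\<^sup>T)"] by (simp add: c\<^sub>1_def)
    have hh: "h \<bullet> (S *\<^sub>v h) \<le> c\<^sub>2 * (d \<bullet> d)"
    proof -
      have "2 * (h \<bullet> (S *\<^sub>v h)) \<le> h \<bullet> h + (S *\<^sub>v h) \<bullet> (S *\<^sub>v h)"
        using inner_self_nonneg[of "h - S *\<^sub>v h"] inner_commute[of h "S *\<^sub>v h"] by (simp add: inner_simps)
      moreover have "h \<bullet> h \<le> frob (C\<^sup>T) * (d \<bullet> d)"
        unfolding h_def by (rule inner_mult_mat_vec_le_frob) simp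
      moreover have "S *\<^sub>v h = (S * C\<^sup>T) *\<^sub>v d" unfolding h_def by (simp add: lin_simps)
      then have "(S *\<^sub>v h) \<bullet> (S *\<^sub>v h) \<le> frob (S * C\<^sup>T) * (d \<bullet> d)"
        using inner_mult_mat_vec_le_frob[of d "S * C\<^sup>T"] by simp
      moreover have "0 \<le> h \<bullet> h" "0 \<le> (S *\<^sub>v h) \<bullet> (S *\<^sub>v h)" by (rule inner_self_nonneg)+
      ultimately show ?thesis unfolding c\<^sub>2_def distrib_right by linarith
    qed
    have "(b + g) \<bullet> (b + g) \<le> (b + g) \<bullet> (S *\<^sub>v (b + g))" by (rule S_ge) simp
    with lyap[of a] aw ww hh
    have "(b + g) \<bullet> (b + g) + 1 / 4 * (a \<bullet> a) - (4 * c\<^sub>1 + c\<^sub>2) * (d \<bullet> d)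
        \<le> (b + g) \<bullet> (S *\<^sub>v (b + g)) - g \<bullet> (S *\<^sub>v g) + a \<bullet> (S *\<^sub>v a)"
      unfolding gg by (simp add: algebra_simps)
    then have "\<delta> * ((b + g) \<bullet> (b + g) + 1 / 4 * (a \<bullet> a) - (4 * c\<^sub>1 + c\<^sub>2) * (d \<bullet> d))
        \<le> \<delta> * ((b + g) \<bullet> (S *\<^sub>v (b + g)) - g \<bullet> (S *\<^sub>v g) + a \<bullet> (S *\<^sub>v a))"
      using \<delta>(1) by simp
    then show "\<delta> * (((b + (A\<^sup>T *\<^sub>v a + C\<^sup>T *\<^sub>v d)) \<bullet> (b + (A\<^sup>T *\<^sub>v a + C\<^sup>T *\<^sub>v d))) + 1 / 4 * (a \<bullet> a) + d \<bullet> d)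
      \<le> \<delta> * (a \<bullet> (S *\<^sub>v a) + 2 * (a \<bullet> (A *\<^sub>v (S *\<^sub>v b))) + b \<bullet> (S *\<^sub>v b) + 2 * (d \<bullet> (C *\<^sub>v (S *\<^sub>v b))))
        + \<epsilon>\<^sup>2 * (d \<bullet> d)"
      unfolding sq h_def[symmetric] g_def[symmetric] \<delta>(2)[symmetric] by (simp add: algebra_simps)
  qed
qed

text \<open>
  With \<open>s\<^sub>n = \<Phi>\<^sub>n\<^sup>T a\<close> and \<open>t\<^sub>n = \<Phi>\<^sub>n\<^sup>T q\<close>, the recurrence for \<open>\<Phi>\<close> turns the mixed term into \<open>s\<^sub>n\<^sub>+\<^sub>1 \<bullet> W t\<^sub>n\<close>. The
  summand with index \<open>n\<close> is then the \<open>W\<close>-square of \<open>s\<^sub>n\<^sub>+\<^sub>1 + t\<^sub>n\<close> plus \<open>s\<^sub>n \<bullet> W s\<^sub>n - s\<^sub>n\<^sub>+\<^sub>1 \<bullet> W s\<^sub>n\<^sub>+\<^sub>1\<close>, and the last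
  difference telescopes.
\<close>

lemma feedback_gram_ge:
  fixes A :: "real mat"
  assumes A: "A \<in> carrier_mat k k" and B: "B\<^sub>M \<in> carrier_mat k p" "B\<^sub>N \<in> carrier_mat k m"
    and \<Phi>: "\<And>n. \<Phi> n \<in> carrier_mat k k" and \<Upsilon>: "\<And>n. \<Upsilon>\<^sub>X n \<in> carrier_mat p k" "\<And>n. \<Upsilon>\<^sub>Y n \<in> carrier_mat m k"
    and \<Phi>_0: "\<Phi> 0 = 1\<^sub>m k" and \<Phi>_Suc: "\<And>n. \<Phi> (Suc n) = A * \<Phi> n + B\<^sub>M * \<Upsilon>\<^sub>X n - B\<^sub>N * \<Upsilon>\<^sub>Y n"
    and W: "W \<in> carrier_mat k k" "W\<^sup>T = W" and psd: "\<And>v. dim_vec v = k \<Longrightarrow> 0 \<le> v \<bullet> (W *\<^sub>v v)"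
    and [simp]: "dim_vec a = k" "dim_vec q = k"
  shows "a \<bullet> (W *\<^sub>v a) - ((\<Phi> n)\<^sup>T *\<^sub>v a) \<bullet> (W *\<^sub>v ((\<Phi> n)\<^sup>T *\<^sub>v a))
    \<le> a \<bullet> (gram k k \<Phi> W \<Phi> n *\<^sub>v a)
      + 2 * (a \<bullet> (A *\<^sub>v (gram k k \<Phi> W \<Phi> n *\<^sub>v q) + B\<^sub>M *\<^sub>v (gram p k \<Upsilon>\<^sub>X W \<Phi> n *\<^sub>v q)
                 - B\<^sub>N *\<^sub>v (gram m k \<Upsilon>\<^sub>Y W \<Phi> n *\<^sub>v q)))
      + q \<bullet> (gram k k \<Phi> W \<Phi> n *\<^sub>v q)"
proof -
  have [simp]: "dim_row (\<Phi> n) = k" "dim_col (\<Phi> n) = k" "dim_row (\<Upsilon>\<^sub>X n) = p" "dim_col (\<Upsilon>\<^sub>X n) = k"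
    "dim_row (\<Upsilon>\<^sub>Y n) = m" "dim_col (\<Upsilon>\<^sub>Y n) = k" "dim_row A = k" "dim_col A = k"
    "dim_row B\<^sub>M = k" "dim_col B\<^sub>M = p" "dim_row B\<^sub>N = k" "dim_col B\<^sub>N = m" "dim_row W = k" "dim_col W = k" for n
    using \<Phi>[of n] \<Upsilon>(1)[of n] \<Upsilon>(2)[of n] A B W by auto
  show ?thesis
  proof (induction n)
    case 0
    have "(1\<^sub>m k :: real mat)\<^sup>T *\<^sub>v a = a" by (simp add: lin_simps)
    then show ?case using \<Phi>_0 by (simp add: lin_simps inner_simps)
  next
    case (Suc n)
    define s t r w where "s = (\<Phi> n)\<^sup>T *\<^sub>v a" and "t = (\<Phi> n)\<^sup>T *\<^sub>v q" and "r = (\<Phi> (Suc n))\<^sup>T *\<^sub>v a" and "w = W *\<^sub>v t"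
    have [simp]: "dim_vec s = k" "dim_vec t = k" "dim_vec r = k" "dim_vec w = k"
      by (simp_all add: s_def t_def r_def w_def)
    have "a \<bullet> (A *\<^sub>v (\<Phi> n *\<^sub>v w)) + a \<bullet> (B\<^sub>M *\<^sub>v (\<Upsilon>\<^sub>X n *\<^sub>v w)) - a \<bullet> (B\<^sub>N *\<^sub>v (\<Upsilon>\<^sub>Y n *\<^sub>v w)) = a \<bullet> (\<Phi> (Suc n) *\<^sub>v w)"
      unfolding \<Phi>_Suc by (simp add: lin_simps inner_simps)
    also have "\<dots> = r \<bullet> (W *\<^sub>v t)" unfolding r_def w_def by (simp add: inner_transpose)
    finally have cross: "a \<bullet> (A *\<^sub>v (\<Phi> n *\<^sub>v w)) + a \<bullet> (B\<^sub>M *\<^sub>v (\<Upsilon>\<^sub>X n *\<^sub>v w)) - a \<bullet> (B\<^sub>N *\<^sub>v (\<Upsilon>\<^sub>Y n *\<^sub>v w))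
      = r \<bullet> (W *\<^sub>v t)" .
    have sq: "0 \<le> r \<bullet> (W *\<^sub>v r) + 2 * (r \<bullet> (W *\<^sub>v t)) + t \<bullet> (W *\<^sub>v t)"
      using psd[of "r + t"] inner_transpose(1)[of t W r] W(2) by (simp add: lin_simps inner_add)
    have aa: "a \<bullet> (\<Phi> n *\<^sub>v (W *\<^sub>v s)) = s \<bullet> (W *\<^sub>v s)" "q \<bullet> (\<Phi> n *\<^sub>v w) = t \<bullet> (W *\<^sub>v t)"
      unfolding s_def t_def w_def by (simp_all add: inner_transpose)
    note G = gram_Suc_mult_vec[of _ _ k \<Phi> k W, OF _ \<Phi> W(1)]
    show ?case
      using Suc cross sq
      unfolding G[of \<Phi> k, OF \<Phi>] G[of \<Upsilon>\<^sub>X p, OF \<Upsilon>(1)] G[of \<Upsilon>\<^sub>Y m, OF \<Upsilon>(2)] if_True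
      by (simp add: G[of \<Phi> k, OF \<Phi>] G[of \<Upsilon>\<^sub>X p, OF \<Upsilon>(1)] G[of \<Upsilon>\<^sub>Y m, OF \<Upsilon>(2)] lin_simps inner_add inner_minus
          aa flip: s_def t_def r_def w_def del: gram.simps)
  qed
qed

lemma frob_eq: "M \<in> carrier_mat r c \<Longrightarrow> frob M = (\<Sum>i<r. \<Sum>j<c. (M $$ (i, j))\<^sup>2)"
  by (auto simp: frob_def scalar_prod_def power2_eq_square lessThan_atLeast0 intro!: sum.cong)

lemma frob_transpose_tendsto_0:
  assumes "\<And>n. T n \<in> carrier_mat k k" "\<And>i j. i < k \<Longrightarrow> j < k \<Longrightarrow> (\<lambda>n. T n $$ (i, j)) \<longlonglongrightarrow> 0"
  shows "(\<lambda>n. frob ((T n)\<^sup>T)) \<longlonglongrightarrow> 0"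
proof -
  have "frob ((T n)\<^sup>T) = (\<Sum>i<k. \<Sum>j<k. (T n $$ (j, i))\<^sup>2)" for n
    using assms(1)[of n] by (subst frob_eq[of _ k k]) auto
  moreover have "(\<lambda>n. \<Sum>i<k. \<Sum>j<k. (T n $$ (j, i))\<^sup>2) \<longlonglongrightarrow> (\<Sum>i<k. \<Sum>j<k. 0\<^sup>2)"
    using assms(2) by (intro tendsto_sum tendsto_power) auto
  ultimately show ?thesis by simp
qed

text \<open>\<open>\<Psi>\<^sub>n = A\<^sup>n\<close> serves for the component \<open>\<Delta>\<close> of the storage, \<open>\<Phi>\<close> and \<open>\<Upsilon>\<close> for \<open>Z\<close>, \<open>L\<close> and \<open>Q\<close>.\<close>

lemma lmi_feasible:
  fixes A :: "real mat"
  assumes A: "A \<in> carrier_mat k k" and B: "B\<^sub>M \<in> carrier_mat k p" "B\<^sub>N \<in> carrier_mat k m"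
    and C: "C \<in> carrier_mat p k" and D: "D\<^sub>M \<in> carrier_mat p p" "D\<^sub>N \<in> carrier_mat p m" and \<epsilon>: "\<epsilon> > 0"
    and \<Psi>: "\<And>n. \<Psi> n \<in> carrier_mat k k" "\<Psi> 0 = 1\<^sub>m k" "\<And>n. \<Psi> (Suc n) = A * \<Psi> n"
      "\<And>i j. i < k \<Longrightarrow> j < k \<Longrightarrow> (\<lambda>n. \<Psi> n $$ (i, j)) \<longlonglongrightarrow> 0"
    and \<Phi>: "\<And>n. \<Phi> n \<in> carrier_mat k k" and \<Upsilon>: "\<And>n. \<Upsilon>\<^sub>X n \<in> carrier_mat p k" "\<And>n. \<Upsilon>\<^sub>Y n \<in> carrier_mat m k"
    and \<Phi>_0: "\<Phi> 0 = 1\<^sub>m k" and \<Phi>_Suc: "\<And>n. \<Phi> (Suc n) = A * \<Phi> n + B\<^sub>M * \<Upsilon>\<^sub>X n - B\<^sub>N * \<Upsilon>\<^sub>Y n"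
    and \<Phi>_lim: "\<And>i j. i < k \<Longrightarrow> j < k \<Longrightarrow> (\<lambda>n. \<Phi> n $$ (i, j)) \<longlonglongrightarrow> 0"
    and zero_output: "\<And>n. C * \<Phi> n + D\<^sub>M * \<Upsilon>\<^sub>X n - D\<^sub>N * \<Upsilon>\<^sub>Y n = 0\<^sub>m p k"
    and R: "R\<^sub>X \<in> carrier_mat p p" "R\<^sub>Y \<in> carrier_mat m p" "D\<^sub>M * R\<^sub>X - D\<^sub>N * R\<^sub>Y = 1\<^sub>m p"
  shows "\<exists>X Z Q F L\<^sub>X L\<^sub>Y R\<^sub>X R\<^sub>Y. lmi_holds k p m \<epsilon> A B\<^sub>M B\<^sub>N C D\<^sub>M D\<^sub>N X Z Q F L\<^sub>X L\<^sub>Y R\<^sub>X R\<^sub>Y"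
proof -
  have [simp]: "dim_row (\<Phi> n) = k" "dim_col (\<Phi> n) = k" "dim_row (\<Upsilon>\<^sub>X n) = p" "dim_col (\<Upsilon>\<^sub>X n) = k"
    "dim_row (\<Upsilon>\<^sub>Y n) = m" "dim_col (\<Upsilon>\<^sub>Y n) = k" "dim_row A = k" "dim_col A = k"
    "dim_row B\<^sub>M = k" "dim_col B\<^sub>M = p" "dim_row B\<^sub>N = k" "dim_col B\<^sub>N = m" "dim_row C = p" "dim_col C = k"
    "dim_row D\<^sub>M = p" "dim_col D\<^sub>M = p" "dim_row D\<^sub>N = p" "dim_col D\<^sub>N = m"
    "dim_row R\<^sub>X = p" "dim_col R\<^sub>X = p" "dim_row R\<^sub>Y = m" "dim_col R\<^sub>Y = p"
    "dim_row (\<Psi> n) = k" "dim_col (\<Psi> n) = k" for n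
    using \<Phi>[of n] \<Upsilon>(1)[of n] \<Upsilon>(2)[of n] \<Psi>(1)[of n] A B C D R by auto
  define F where "F = B\<^sub>M * R\<^sub>X - B\<^sub>N * R\<^sub>Y"
  \<comment> \<open>The summand \<open>F F\<^sup>T\<close> weighs the states that follow an impulse of \<open>v\<close>: after one step the state is \<open>F v\<close>,
      and a zero-output trajectory starts from there. It pays for the square \<open>|F\<^sup>T a + c|\<^sup>2\<close> below.\<close>
  define W where "W = 1\<^sub>m k + F * F\<^sup>T"
  have [simp]: "dim_row F = k" "dim_col F = p" "dim_row W = k" "dim_col W = k"
    by (simp_all add: F_def W_def)
  have Wc: "W \<in> carrier_mat k k" and Fc: "F \<in> carrier_mat k p" by (auto intro: carrier_matI)
  have W_form: "u \<bullet> (W *\<^sub>v u) = u \<bullet> u + (F\<^sup>T *\<^sub>v u) \<bullet> (F\<^sup>T *\<^sub>v u)" if "dim_vec u = k" for u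
    unfolding W_def using that by (simp add: lin_simps inner_add inner_transpose(2)[of _ F])
  have W_ge: "u \<bullet> u \<le> u \<bullet> (W *\<^sub>v u)" if "dim_vec u = k" for u
    using W_form[OF that] inner_self_nonneg[of "F\<^sup>T *\<^sub>v u"] by simp
  have W_sym: "W\<^sup>T = W"
  proof (rule symmetric_of_form[OF Wc])
    fix u v :: "real vec" assume "u \<in> carrier_vec k" "v \<in> carrier_vec k"
    then show "u \<bullet> (W *\<^sub>v v) = v \<bullet> (W *\<^sub>v u)"
      unfolding W_def using inner_commute[of u v] inner_commute[of "F\<^sup>T *\<^sub>v u" "F\<^sup>T *\<^sub>v v"]
        inner_transpose(2)[of "F\<^sup>T *\<^sub>v u" F v] inner_transpose(2)[of "F\<^sup>T *\<^sub>v v" F u]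
      by (simp add: lin_simps inner_add)
  qed
  have "(\<lambda>n. frob ((\<Phi> n)\<^sup>T) * (1 + frob (F\<^sup>T))) \<longlonglongrightarrow> 0 * (1 + frob (F\<^sup>T))"
    by (intro tendsto_mult frob_transpose_tendsto_0[of \<Phi> k] \<Phi> \<Phi>_lim tendsto_const)
  then have "\<forall>\<^sub>F n in sequentially. frob ((\<Phi> n)\<^sup>T) * (1 + frob (F\<^sup>T)) < 1 / 2"
    by (rule order_tendstoD(2)) simp
  moreover have "\<forall>\<^sub>F n in sequentially. frob ((\<Psi> n)\<^sup>T) < 1 / 2"
    by (rule order_tendstoD(2)[OF frob_transpose_tendsto_0[of \<Psi> k]]) (use \<Psi> in auto)
  moreover have "\<forall>\<^sub>F n in sequentially. (0::nat) < n" by (rule eventually_gt_at_top)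
  ultimately have "\<forall>\<^sub>F n in sequentially. frob ((\<Phi> n)\<^sup>T) * (1 + frob (F\<^sup>T)) < 1 / 2 \<and> frob ((\<Psi> n)\<^sup>T) < 1 / 2 \<and> 0 < n"
    by (intro eventually_conj)
  then obtain N where N: "frob ((\<Phi> N)\<^sup>T) * (1 + frob (F\<^sup>T)) < 1 / 2" "frob ((\<Psi> N)\<^sup>T) < 1 / 2" "0 < N"
    using eventually_happens by (metis (no_types, lifting) trivial_limit_sequentially)
  define S where "S = gram k k \<Psi> (1\<^sub>m k) \<Psi> N"
  define Z where "Z = gram k k \<Phi> W \<Phi> N"
  define L\<^sub>X where "L\<^sub>X = gram p k \<Upsilon>\<^sub>X W \<Phi> N"
  define L\<^sub>Y where "L\<^sub>Y = gram m k \<Upsilon>\<^sub>Y W \<Phi> N"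
  define Q where "Q = A * Z + B\<^sub>M * L\<^sub>X - B\<^sub>N * L\<^sub>Y"
  have [simp]: "dim_row S = k" "dim_col S = k" "dim_row Z = k" "dim_col Z = k" "dim_row L\<^sub>X = p" "dim_col L\<^sub>X = k"
    "dim_row L\<^sub>Y = m" "dim_col L\<^sub>Y = k"
    unfolding S_def Z_def L\<^sub>X_def L\<^sub>Y_def by simp_all
  have [simp]: "dim_row Q = k" "dim_col Q = k" by (simp_all add: Q_def)
  have S_sym: "S\<^sup>T = S" unfolding S_def by (rule gram_symmetric) (use \<Psi> in auto)
  have Z_sym: "Z\<^sup>T = Z" unfolding Z_def by (rule gram_symmetric[OF \<Phi> Wc W_sym])
  have S_ge: "v \<bullet> v \<le> v \<bullet> (S *\<^sub>v v)" if "dim_vec v = k" for v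
    unfolding S_def using \<Psi> N that by (intro inner_gram_ge[of \<Psi> k k]) (auto simp: lin_simps)
  have lyap: "(A\<^sup>T *\<^sub>v v) \<bullet> (S *\<^sub>v (A\<^sup>T *\<^sub>v v)) \<le> v \<bullet> (S *\<^sub>v v) - 1 / 2 * (v \<bullet> v)" if v: "dim_vec v = k" for v
  proof -
    have "((\<Psi> N)\<^sup>T *\<^sub>v v) \<bullet> ((\<Psi> N)\<^sup>T *\<^sub>v v) \<le> frob ((\<Psi> N)\<^sup>T) * (v \<bullet> v)"
      by (rule inner_mult_mat_vec_le_frob) (simp add: v)
    also have "\<dots> \<le> 1 / 2 * (v \<bullet> v)" using N inner_self_nonneg by (intro mult_right_mono) auto
    finally show ?thesis unfolding S_def lyapunov_gram[OF \<Psi>(1,2,3) A v] by simp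
  qed
  have zero: "C *\<^sub>v (Z *\<^sub>v v) + D\<^sub>M *\<^sub>v (L\<^sub>X *\<^sub>v v) - D\<^sub>N *\<^sub>v (L\<^sub>Y *\<^sub>v v) = 0\<^sub>v p" if v: "dim_vec v = k" for v
    unfolding Z_def L\<^sub>X_def L\<^sub>Y_def
  proof (induction N)
    case 0
    then show ?case using v by (simp add: lin_simps)
  next
    case (Suc n)
    define w where "w = W *\<^sub>v ((\<Phi> n)\<^sup>T *\<^sub>v v)"
    have [simp]: "dim_vec w = k" by (simp add: w_def)
    have "C *\<^sub>v (\<Phi> n *\<^sub>v w) + D\<^sub>M *\<^sub>v (\<Upsilon>\<^sub>X n *\<^sub>v w) - D\<^sub>N *\<^sub>v (\<Upsilon>\<^sub>Y n *\<^sub>v w) = 0\<^sub>v p"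
      using arg_cong[OF zero_output[of n], of "\<lambda>M. M *\<^sub>v w"] by (simp add: lin_simps)
    moreover have "C *\<^sub>v (gram k k \<Phi> W \<Phi> (Suc n) *\<^sub>v v) + D\<^sub>M *\<^sub>v (gram p k \<Upsilon>\<^sub>X W \<Phi> (Suc n) *\<^sub>v v)
          - D\<^sub>N *\<^sub>v (gram m k \<Upsilon>\<^sub>Y W \<Phi> (Suc n) *\<^sub>v v)
        = (C *\<^sub>v (gram k k \<Phi> W \<Phi> n *\<^sub>v v) + D\<^sub>M *\<^sub>v (gram p k \<Upsilon>\<^sub>X W \<Phi> n *\<^sub>v v)
          - D\<^sub>N *\<^sub>v (gram m k \<Upsilon>\<^sub>Y W \<Phi> n *\<^sub>v v))
        + (C *\<^sub>v (\<Phi> n *\<^sub>v w) + D\<^sub>M *\<^sub>v (\<Upsilon>\<^sub>X n *\<^sub>v w) - D\<^sub>N *\<^sub>v (\<Upsilon>\<^sub>Y n *\<^sub>v w))"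
      unfolding gram_Suc_mult_vec[OF \<Phi> \<Phi> Wc v] gram_Suc_mult_vec[OF \<Upsilon>(1) \<Phi> Wc v]
        gram_Suc_mult_vec[OF \<Upsilon>(2) \<Phi> Wc v] w_def[symmetric]
      using v by (intro eq_vecI) (simp_all add: lin_simps del: index_mult_mat_vec)
    ultimately show ?case using Suc by (simp del: gram.simps)
  qed
  \<comment> \<open>\<open>X = Z\<close> would make the leading block singular; a small multiple of \<open>S\<close> separates them.\<close>
  obtain \<delta> where \<delta>: "\<delta> > 0" "\<And>a b d. dim_vec a = k \<Longrightarrow> dim_vec b = k \<Longrightarrow> dim_vec d = p \<Longrightarrow>
      \<delta> * (((b + (A\<^sup>T *\<^sub>v a + C\<^sup>T *\<^sub>v d)) \<bullet> (b + (A\<^sup>T *\<^sub>v a + C\<^sup>T *\<^sub>v d))) + 1 / 4 * (a \<bullet> a) + d \<bullet> d)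
      \<le> \<delta> * (a \<bullet> (S *\<^sub>v a) + 2 * (a \<bullet> (A *\<^sub>v (S *\<^sub>v b))) + b \<bullet> (S *\<^sub>v b) + 2 * (d \<bullet> (C *\<^sub>v (S *\<^sub>v b))))
        + \<epsilon>\<^sup>2 * (d \<bullet> d)"
    by (rule completed_square_pos[OF _ S_sym A C S_ge lyap \<epsilon>]) (auto intro: carrier_matI)
  define X where "X = Z + \<delta> \<cdot>\<^sub>m S"
  have Xc: "X \<in> carrier_mat k k" "Z \<in> carrier_mat k k" "Q \<in> carrier_mat k k" "L\<^sub>X \<in> carrier_mat p k" "L\<^sub>Y \<in> carrier_mat m k"
    by (auto simp: X_def intro: carrier_matI)
  have X_sym: "X\<^sup>T = X"
  proof -
    have "S $$ (j, i) = S $$ (i, j)" "Z $$ (j, i) = Z $$ (i, j)" if "i < k" "j < k" for i j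
      using that S_sym Z_sym index_transpose_mat(1)[of i S j] index_transpose_mat(1)[of i Z j] by simp_all
    then show ?thesis by (intro eq_matI) (simp_all add: X_def)
  qed
  interpret lmi_variables k p m \<epsilon> A B\<^sub>M B\<^sub>N C D\<^sub>M D\<^sub>N X Z Q F L\<^sub>X L\<^sub>Y R\<^sub>X R\<^sub>Y
    by unfold_locales (fact A B C D Xc Fc R X_sym Z_sym)+
  have "X - Z = \<delta> \<cdot>\<^sub>m S" unfolding X_def by (intro eq_matI) auto
  then have \<Delta>: "\<Delta> = \<delta> \<cdot>\<^sub>m S" by (simp only: \<Delta>_def)
  have pos: "0 < \<xi> \<bullet> (lmi *\<^sub>v \<xi>)" if \<xi>: "\<xi> \<in> carrier_vec (4 * k + 2 * p)" "\<xi> \<noteq> 0\<^sub>v (4 * k + 2 * p)" for \<xi>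
  proof -
    obtain a\<^sub>1 a\<^sub>2 b\<^sub>1 b\<^sub>2 c d where \<xi>_eq: "\<xi> = a\<^sub>1 @\<^sub>v a\<^sub>2 @\<^sub>v b\<^sub>1 @\<^sub>v b\<^sub>2 @\<^sub>v c @\<^sub>v d" and
      [simp]: "dim_vec a\<^sub>1 = k" "dim_vec a\<^sub>2 = k" "dim_vec b\<^sub>1 = k" "dim_vec b\<^sub>2 = k" "dim_vec c = p" "dim_vec d = p"
      by (rule six_blocks[OF \<xi>(1)])
    define a q where "a = a\<^sub>1 + a\<^sub>2" and "q = b\<^sub>1 + b\<^sub>2"
    have [simp]: "dim_vec a = k" "dim_vec q = k" by (simp_all add: a_def q_def)
    have "a - a\<^sub>1 = a\<^sub>2" "q - b\<^sub>1 = b\<^sub>2" unfolding a_def q_def by (auto intro!: eq_vecI)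
    then have \<xi>_test: "\<xi> = test_vec a\<^sub>1 a b\<^sub>1 q c d" by (simp add: test_vec_def \<xi>_eq)
    define g where "g = b\<^sub>1 + (A\<^sup>T *\<^sub>v a\<^sub>1 + C\<^sup>T *\<^sub>v d)"
    define E\<^sub>1 where "E\<^sub>1 = \<delta> * (a\<^sub>1 \<bullet> (S *\<^sub>v a\<^sub>1) + 2 * (a\<^sub>1 \<bullet> (A *\<^sub>v (S *\<^sub>v b\<^sub>1))) + b\<^sub>1 \<bullet> (S *\<^sub>v b\<^sub>1)
        + 2 * (d \<bullet> (C *\<^sub>v (S *\<^sub>v b\<^sub>1)))) + \<epsilon>\<^sup>2 * (d \<bullet> d)"
    define E\<^sub>2 where "E\<^sub>2 = a \<bullet> (Z *\<^sub>v a) + 2 * (a \<bullet> (Q *\<^sub>v q)) + q \<bullet> (Z *\<^sub>v q) + 2 * (a \<bullet> (F *\<^sub>v c)) + c \<bullet> c"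
    have Qq: "Q *\<^sub>v q = A *\<^sub>v (Z *\<^sub>v q) + B\<^sub>M *\<^sub>v (L\<^sub>X *\<^sub>v q) - B\<^sub>N *\<^sub>v (L\<^sub>Y *\<^sub>v q)"
      and Fc: "F *\<^sub>v c = B\<^sub>M *\<^sub>v (R\<^sub>X *\<^sub>v c) - B\<^sub>N *\<^sub>v (R\<^sub>Y *\<^sub>v c)"
      unfolding Q_def F_def by (simp_all add: lin_simps)
    have Rc: "D\<^sub>M *\<^sub>v (R\<^sub>X *\<^sub>v c) - D\<^sub>N *\<^sub>v (R\<^sub>Y *\<^sub>v c) = c"
      using arg_cong[OF R(3), of "\<lambda>M. M *\<^sub>v c"] by (simp add: lin_simps)
    have fr: "filter_residual a q c = Z *\<^sub>v a + Q *\<^sub>v q + F *\<^sub>v c" by (simp add: filter_residual_def)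
    have pr: "plant_residual a\<^sub>1 a b\<^sub>1 q c - filter_residual a q c = \<delta> \<cdot>\<^sub>v (S *\<^sub>v a\<^sub>1) + \<delta> \<cdot>\<^sub>v (A *\<^sub>v (S *\<^sub>v b\<^sub>1))"
      unfolding plant_residual_def fr Qq Fc \<Delta>
      by (intro eq_vecI) (simp_all add: lin_simps del: index_mult_mat_vec)
    have eo: "error_output b\<^sub>1 q c = \<delta> \<cdot>\<^sub>v (C *\<^sub>v (S *\<^sub>v b\<^sub>1))"
    proof (rule eq_vecI)
      fix i assume "i < dim_vec (\<delta> \<cdot>\<^sub>v (C *\<^sub>v (S *\<^sub>v b\<^sub>1)))"
      then have i: "i < p" by simp
      show "vec_index (error_output b\<^sub>1 q c) i = vec_index (\<delta> \<cdot>\<^sub>v (C *\<^sub>v (S *\<^sub>v b\<^sub>1))) i"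
        using arg_cong[OF zero[of q], of "\<lambda>u. vec_index u i"] arg_cong[OF Rc, of "\<lambda>u. vec_index u i"] i
        unfolding error_output_def \<Delta> by (simp add: lin_simps del: index_mult_mat_vec)
    qed (simp add: error_output_def)
    \<comment> \<open>The choice of \<open>Q\<close> and \<open>F\<close> removes \<open>a\<close>, \<open>q\<close>, \<open>c\<close> from the plant residual relative to the filter
        residual, and \<open>C Z + D L = 0\<close>, \<open>D R = I\<close> remove them from the error output.\<close>
    have split: "\<xi> \<bullet> (lmi *\<^sub>v \<xi>) = E\<^sub>1 + E\<^sub>2"
      unfolding \<xi>_test
      by (subst lmi_quadratic_form)
        (simp_all add: pr[unfolded fr] fr eo E\<^sub>1_def E\<^sub>2_def \<Delta> inner_add inner_smult lin_simps distrib_left)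
    have E\<^sub>1: "\<delta> * (g \<bullet> g + 1 / 4 * (a\<^sub>1 \<bullet> a\<^sub>1) + d \<bullet> d) \<le> E\<^sub>1"
      unfolding E\<^sub>1_def g_def by (rule \<delta>(2)) simp_all
    have "a \<bullet> (W *\<^sub>v a) - ((\<Phi> N)\<^sup>T *\<^sub>v a) \<bullet> (W *\<^sub>v ((\<Phi> N)\<^sup>T *\<^sub>v a))
        \<le> a \<bullet> (Z *\<^sub>v a) + 2 * (a \<bullet> (Q *\<^sub>v q)) + q \<bullet> (Z *\<^sub>v q)"
      unfolding Qq unfolding Z_def L\<^sub>X_def L\<^sub>Y_def
      using W_ge inner_self_nonneg
      by (intro feedback_gram_ge[OF A B \<Phi> \<Upsilon> \<Phi>_0 \<Phi>_Suc Wc W_sym]) (auto intro: order_trans)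
    moreover have "((\<Phi> N)\<^sup>T *\<^sub>v a) \<bullet> (W *\<^sub>v ((\<Phi> N)\<^sup>T *\<^sub>v a)) \<le> 1 / 2 * (a \<bullet> a)"
    proof -
      define s where "s = (\<Phi> N)\<^sup>T *\<^sub>v a"
      have [simp]: "dim_vec s = k" by (simp add: s_def)
      have "s \<bullet> (W *\<^sub>v s) \<le> (1 + frob (F\<^sup>T)) * (s \<bullet> s)"
        using inner_mult_mat_vec_le_frob[of s "F\<^sup>T"] by (simp add: W_form algebra_simps)
      also have "\<dots> \<le> (1 + frob (F\<^sup>T)) * (frob ((\<Phi> N)\<^sup>T) * (a \<bullet> a))"
        unfolding s_def using frob_nonneg[of "F\<^sup>T"]
        by (intro mult_left_mono inner_mult_mat_vec_le_frob) simp_all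
      also have "\<dots> = (frob ((\<Phi> N)\<^sup>T) * (1 + frob (F\<^sup>T))) * (a \<bullet> a)" by simp
      also have "\<dots> \<le> 1 / 2 * (a \<bullet> a)" using N(1) inner_self_nonneg by (intro mult_right_mono) auto
      finally show ?thesis by (simp add: s_def)
    qed
    moreover have "(F\<^sup>T *\<^sub>v a + c) \<bullet> (F\<^sup>T *\<^sub>v a + c) = (F\<^sup>T *\<^sub>v a) \<bullet> (F\<^sup>T *\<^sub>v a) + 2 * (a \<bullet> (F *\<^sub>v c)) + c \<bullet> c"
      using inner_transpose(2)[of c F a] inner_commute[of c "F\<^sup>T *\<^sub>v a"]
      by (simp add: inner_add)
    ultimately have E\<^sub>2: "1 / 2 * (a \<bullet> a) + (F\<^sup>T *\<^sub>v a + c) \<bullet> (F\<^sup>T *\<^sub>v a + c) \<le> E\<^sub>2"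
      using W_form[of a] unfolding E\<^sub>2_def by simp
    have qZq: "q \<bullet> q \<le> q \<bullet> (Z *\<^sub>v q)"
      unfolding Z_def using \<Phi> \<Phi>_0 Wc W_ge N by (intro inner_gram_ge[of \<Phi> k k]) auto
    have nonneg: "0 \<le> g \<bullet> g" "0 \<le> a\<^sub>1 \<bullet> a\<^sub>1" "0 \<le> d \<bullet> d" "0 \<le> a \<bullet> a" "0 \<le> q \<bullet> q" "0 \<le> c \<bullet> c"
      "0 \<le> (F\<^sup>T *\<^sub>v a + c) \<bullet> (F\<^sup>T *\<^sub>v a + c)"
      by (rule inner_self_nonneg)+
    show ?thesis
    proof (rule ccontr)
      assume "\<not> 0 < \<xi> \<bullet> (lmi *\<^sub>v \<xi>)"
      moreover have "0 \<le> \<delta> * (g \<bullet> g + 1 / 4 * (a\<^sub>1 \<bullet> a\<^sub>1) + d \<bullet> d)" using \<delta>(1) nonneg by simp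
      ultimately have le: "\<delta> * (g \<bullet> g + 1 / 4 * (a\<^sub>1 \<bullet> a\<^sub>1) + d \<bullet> d) \<le> 0" "E\<^sub>2 \<le> 0" "a \<bullet> a = 0"
        using E\<^sub>1 E\<^sub>2 nonneg unfolding split by linarith+
      then have "g \<bullet> g + 1 / 4 * (a\<^sub>1 \<bullet> a\<^sub>1) + d \<bullet> d \<le> 0" using \<delta>(1) by (simp add: mult_le_0_iff)
      then have "g \<bullet> g = 0" "a\<^sub>1 \<bullet> a\<^sub>1 = 0" "d \<bullet> d = 0" using nonneg by linarith+
      then have z: "g = 0\<^sub>v k" "a\<^sub>1 = 0\<^sub>v k" "d = 0\<^sub>v p" "a = 0\<^sub>v k"
        using le(3) by (simp_all add: inner_self_eq_0_iff g_def)
      have "E\<^sub>2 = q \<bullet> (Z *\<^sub>v q) + c \<bullet> c" unfolding E\<^sub>2_def z(4) by (simp add: inner_simps lin_simps)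
      then have "q \<bullet> q = 0" "c \<bullet> c = 0" using le(2) qZq nonneg by linarith+
      then have z': "q = 0\<^sub>v k" "c = 0\<^sub>v p" by (simp_all add: inner_self_eq_0_iff)
      have add0: "u + 0\<^sub>v k = u" "0\<^sub>v k + u = u" if "dim_vec u = k" for u :: "real vec"
        using that by (auto intro!: eq_vecI)
      have "b\<^sub>1 = 0\<^sub>v k" using z(1) unfolding g_def z(2,3) by (simp add: lin_simps add0)
      then have "b\<^sub>2 = 0\<^sub>v k" "a\<^sub>2 = 0\<^sub>v k" using z z' unfolding a_def q_def by (simp_all add: add0)
      then have "\<xi> = 0\<^sub>v (4 * k + 2 * p)"
        unfolding \<xi>_eq using z z' \<open>b\<^sub>1 = 0\<^sub>v k\<close> by (intro eq_vecI) auto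
      then show False using \<xi>(2) by simp
    qed
  qed
  have "pos_def lmi"
    unfolding pos_def_def sym_mat_def using dim_lmi lmi_symmetric pos by auto
  then have "lmi_holds k p m \<epsilon> A B\<^sub>M B\<^sub>N C D\<^sub>M D\<^sub>N X Z Q F L\<^sub>X L\<^sub>Y R\<^sub>X R\<^sub>Y"
    unfolding lmi_holds_def sym_mat_def using carriers symmetric by auto
  then show ?thesis by blast
qed

section \<open>Zero-error trajectories\<close>

definition markov_mat :: "rfun mat \<Rightarrow> int \<Rightarrow> real mat" where
  "markov_mat T n = map_mat (\<lambda>f. markov f n) T"

lemma dim_markov_mat [simp]: "dim_row (markov_mat T n) = dim_row T" "dim_col (markov_mat T n) = dim_col T"
  by (simp_all add: markov_mat_def)

lemma dim_const_tf [simp]: "dim_row (const_tf M) = dim_row M" "dim_col (const_tf M) = dim_col M"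
  by (simp_all add: const_tf_def)

lemma markov_minus: "markov (f - g) n = markov f n - markov g n"
proof -
  have "markov f n = markov (f - g) n + markov g n" by (simp flip: markov_add)
  then show ?thesis by simp
qed

lemma markov_mat_add_minus:
  assumes "dim_row S = dim_row T" "dim_col S = dim_col T"
  shows "markov_mat (S + T) n = markov_mat S n + markov_mat T n"
    "markov_mat (S - T) n = markov_mat S n - markov_mat T n"
  using assms by (auto simp: markov_mat_def markov_add markov_minus intro!: eq_matI)

lemma markov_mat_const_mult:
  assumes "dim_col M = dim_row T"
  shows "markov_mat (const_tf M * T) n = M * markov_mat T n"
  using assms
  by (auto simp: markov_mat_def const_tf_def scalar_prod_def markov_sum markov_const_mult intro!: eq_matI)

lemma markov_mat_div_z: "markov_mat (1 / z_var \<cdot>\<^sub>m T) n = markov_mat T (n - 1)"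
  by (auto simp: markov_mat_def markov_div_z simp del: times_divide_eq_left intro!: eq_matI)

lemma markov_mat_negative:
  assumes "T \<in> RH_inf r c" "n < 0"
  shows "markov_mat T n = 0\<^sub>m r c"
  using assms by (auto simp: markov_mat_def RH_inf_iff markov_negative intro!: eq_matI)

lemma markov_mat_one: "markov_mat (1\<^sub>m r) n = (if n = 0 then 1\<^sub>m r else 0\<^sub>m r r)"
  using markov_const[of 1 n] markov_const[of 0 n]
  by (auto simp: markov_mat_def simp flip: one_pCons intro!: eq_matI)

lemma markov_mat_zero: "markov_mat (0\<^sub>m r c) n = 0\<^sub>m r c"
  using markov_const[of 0 n] by (auto simp: markov_mat_def intro!: eq_matI)

lemma markov_mat_tendsto_0:
  assumes "T \<in> RH_inf r c" "i < r" "j < c"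
  shows "(\<lambda>n. markov_mat T (int n) $$ (i, j)) \<longlonglongrightarrow> 0"
  using assms markov_tendsto_0[of "T $$ (i, j)"] by (auto simp: markov_mat_def RH_inf_iff)

text \<open>
  \<open>P = z (z I - A)\<^sup>-\<^sup>1\<close> has the Markov parameters \<open>A\<^sup>n\<close>: these are the free trajectories, with output \<open>E = C P\<close>. The
  input \<open>\<Upsilon> = - [U; V] E\<close> produces the output \<open>- (M\<^sub>l U - N\<^sub>l V) E = - E\<close> and cancels it. All matrices
  involved are stable and proper, so their Markov parameters tend to zero, and the state equations can be read
  off coefficientwise from \<open>\<Phi> = I + (A \<Phi> + B \<Upsilon>) / z\<close>.
\<close>

lemma right_inverse_imp_lmi_feasible:
  assumes A: "A \<in> carrier_mat k k" and stable: "schur_stable A"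
    and B: "B\<^sub>M \<in> carrier_mat k p" "B\<^sub>N \<in> carrier_mat k m"
    and C: "C \<in> carrier_mat p k" and D: "D\<^sub>M \<in> carrier_mat p p" "D\<^sub>N \<in> carrier_mat p m"
    and U: "U \<in> RH_inf p p" and V: "V \<in> RH_inf m p"
    and inverse: "ss_tf A B\<^sub>M C D\<^sub>M * U - ss_tf A B\<^sub>N C D\<^sub>N * V = 1\<^sub>m p" and \<epsilon>: "\<epsilon> > 0"
  shows "\<exists>X Z Q F L\<^sub>X L\<^sub>Y R\<^sub>X R\<^sub>Y. lmi_holds k p m \<epsilon> A B\<^sub>M B\<^sub>N C D\<^sub>M D\<^sub>N X Z Q F L\<^sub>X L\<^sub>Y R\<^sub>X R\<^sub>Y"
proof -
  note [simp] = carrier_matD[OF A] carrier_matD[OF B(1)] carrier_matD[OF B(2)] carrier_matD[OF C]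
    carrier_matD[OF D(1)] carrier_matD[OF D(2)] RH_inf_dims[OF U] RH_inf_dims[OF V]
  define R where "R = mat_inv (z_var \<cdot>\<^sub>m 1\<^sub>m k - const_tf A)"
  note R = resolvent[OF A stable, folded R_def]
  define P where "P = z_var \<cdot>\<^sub>m R"
  have [simp]: "dim_row R = k" "dim_col R = k" "dim_row P = k" "dim_col P = k"
    using RH_inf_dims[OF R(1)] by (simp_all add: P_def)
  have P_RH: "P \<in> RH_inf k k" using R(3) by (simp add: P_def)
  have R_P: "R = 1 / z_var \<cdot>\<^sub>m P"
    unfolding P_def using z_var_neq_0 by (intro eq_matI) auto
  have res: "z_var \<cdot>\<^sub>v (R *\<^sub>v x) - const_tf A *\<^sub>v (R *\<^sub>v x) = x" if "dim_vec x = k" for x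
    using arg_cong[OF R(2), of "\<lambda>M. M *\<^sub>v x"] that by (simp add: lin_simps)
  have inv: "const_tf C *\<^sub>v (R *\<^sub>v (const_tf B\<^sub>M *\<^sub>v (U *\<^sub>v x))) + const_tf D\<^sub>M *\<^sub>v (U *\<^sub>v x)
      - (const_tf C *\<^sub>v (R *\<^sub>v (const_tf B\<^sub>N *\<^sub>v (V *\<^sub>v x))) + const_tf D\<^sub>N *\<^sub>v (V *\<^sub>v x)) = x"
    if "dim_vec x = p" for x
    using arg_cong[OF inverse, of "\<lambda>M. M *\<^sub>v x"] that
    by (simp add: ss_tf_def R_def[symmetric] lin_simps)
  define E where "E = const_tf C * P"
  define \<Upsilon>\<^sub>X where "\<Upsilon>\<^sub>X = 0\<^sub>m p k - U * E"
  define \<Upsilon>\<^sub>Y where "\<Upsilon>\<^sub>Y = 0\<^sub>m m k - V * E"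
  define H where "H = const_tf B\<^sub>M * \<Upsilon>\<^sub>X - const_tf B\<^sub>N * \<Upsilon>\<^sub>Y"
  define \<Phi> where "\<Phi> = P + R * H"
  have [simp]: "dim_row E = p" "dim_col E = k" "dim_row \<Upsilon>\<^sub>X = p" "dim_col \<Upsilon>\<^sub>X = k" "dim_row \<Upsilon>\<^sub>Y = m" "dim_col \<Upsilon>\<^sub>Y = k"
    "dim_row H = k" "dim_col H = k" "dim_row \<Phi> = k" "dim_col \<Phi> = k"
    by (simp_all add: E_def \<Upsilon>\<^sub>X_def \<Upsilon>\<^sub>Y_def H_def \<Phi>_def)
  have zero_RH: "0\<^sub>m r c \<in> RH_inf r c" for r c by (auto simp: RH_inf_iff stable_rf_0_1)
  have E_RH: "E \<in> RH_inf p k" unfolding E_def by (rule RH_inf_mult(1)[OF RH_inf_const(1)[OF C] P_RH])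
  have \<Upsilon>_RH: "\<Upsilon>\<^sub>X \<in> RH_inf p k" "\<Upsilon>\<^sub>Y \<in> RH_inf m k"
    unfolding \<Upsilon>\<^sub>X_def \<Upsilon>\<^sub>Y_def
    by (intro RH_inf_add_minus(3) zero_RH RH_inf_mult(1)[OF U E_RH] RH_inf_mult(1)[OF V E_RH])+
  have H_RH: "H \<in> RH_inf k k"
    unfolding H_def
    by (intro RH_inf_add_minus(3) RH_inf_mult(1)[OF RH_inf_const(1)[OF B(1)] \<Upsilon>_RH(1)]
        RH_inf_mult(1)[OF RH_inf_const(1)[OF B(2)] \<Upsilon>_RH(2)])
  have \<Phi>_RH: "\<Phi> \<in> RH_inf k k"
    unfolding \<Phi>_def by (intro RH_inf_add_minus(1) P_RH RH_inf_mult(1)[OF R(1) H_RH])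
  have P_eq: "P = 1\<^sub>m k + 1 / z_var \<cdot>\<^sub>m (const_tf A * P)"
  proof (rule mat_eqI_vec[of _ _ k])
    fix x :: "rfun vec" assume x: "dim_vec x = k"
    have "vec_index (z_var \<cdot>\<^sub>v (R *\<^sub>v x)) i = vec_index (x + const_tf A *\<^sub>v (R *\<^sub>v x)) i" if "i < k" for i
      using arg_cong[OF res[OF x], of "\<lambda>u. vec_index u i"] that x
      by (simp del: index_mult_mat_vec add: algebra_simps)
    then show "P *\<^sub>v x = (1\<^sub>m k + 1 / z_var \<cdot>\<^sub>m (const_tf A * P)) *\<^sub>v x"
      unfolding P_def using x z_var_neq_0
      by (intro eq_vecI) (simp_all add: lin_simps del: index_mult_mat_vec)
  qed simp_all
  have \<Phi>_eq: "\<Phi> = 1\<^sub>m k + 1 / z_var \<cdot>\<^sub>m (const_tf A * \<Phi> + H)"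
  proof (rule mat_eqI_vec[of _ _ k])
    fix x :: "rfun vec" assume x: "dim_vec x = k"
    define h where "h = H *\<^sub>v x"
    have [simp]: "dim_vec h = k" by (simp add: h_def)
    have 1: "vec_index (P *\<^sub>v x) i = vec_index x i + 1 / z_var * vec_index (const_tf A *\<^sub>v (P *\<^sub>v x)) i" if "i < k" for i
      using arg_cong[OF P_eq, of "\<lambda>M. vec_index (M *\<^sub>v x) i"] that x
      by (simp add: lin_simps del: index_mult_mat_vec)
    have 2: "vec_index (R *\<^sub>v h) i = 1 / z_var * (vec_index (const_tf A *\<^sub>v (R *\<^sub>v h)) i + vec_index h i)" if "i < k" for i
    proof -
      have "z_var * vec_index (R *\<^sub>v h) i = vec_index (const_tf A *\<^sub>v (R *\<^sub>v h)) i + vec_index h i"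
        using arg_cong[OF res[of h], of "\<lambda>u. vec_index u i"] that
        by (simp del: index_mult_mat_vec add: algebra_simps)
      then show ?thesis using z_var_neq_0 by (metis nonzero_mult_div_cancel_left times_divide_eq_left mult_1)
    qed
    show "\<Phi> *\<^sub>v x = (1\<^sub>m k + 1 / z_var \<cdot>\<^sub>m (const_tf A * \<Phi> + H)) *\<^sub>v x"
    proof (rule eq_vecI)
      fix i assume "i < dim_vec ((1\<^sub>m k + 1 / z_var \<cdot>\<^sub>m (const_tf A * \<Phi> + H)) *\<^sub>v x)"
      then have i: "i < k" by simp
      have "vec_index (\<Phi> *\<^sub>v x) i = vec_index (P *\<^sub>v x) i + vec_index (R *\<^sub>v h) i"
        unfolding \<Phi>_def h_def using x i by (simp add: lin_simps del: index_mult_mat_vec)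
      also have "\<dots> = vec_index x i + 1 / z_var * (vec_index (const_tf A *\<^sub>v (P *\<^sub>v x)) i
          + vec_index (const_tf A *\<^sub>v (R *\<^sub>v h)) i + vec_index h i)"
        using 1[OF i] 2[OF i] by (simp add: algebra_simps add_divide_distrib)
      also have "\<dots> = vec_index ((1\<^sub>m k + 1 / z_var \<cdot>\<^sub>m (const_tf A * \<Phi> + H)) *\<^sub>v x) i"
        unfolding \<Phi>_def h_def using x i by (simp add: lin_simps del: index_mult_mat_vec)
      finally show "vec_index (\<Phi> *\<^sub>v x) i = vec_index ((1\<^sub>m k + 1 / z_var \<cdot>\<^sub>m (const_tf A * \<Phi> + H)) *\<^sub>v x) i" .
    qed simp
  qed simp_all
  have out: "const_tf C * \<Phi> + const_tf D\<^sub>M * \<Upsilon>\<^sub>X - const_tf D\<^sub>N * \<Upsilon>\<^sub>Y = 0\<^sub>m p k"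
  proof (rule mat_eqI_vec[of _ _ k])
    fix x :: "rfun vec" assume x: "dim_vec x = k"
    define e where "e = const_tf C *\<^sub>v (P *\<^sub>v x)"
    have [simp]: "dim_vec e = p" by (simp add: e_def)
    have Ex: "E *\<^sub>v x = e" unfolding E_def e_def using x by (simp add: lin_simps)
    have \<Upsilon>x: "\<Upsilon>\<^sub>X *\<^sub>v x = - (U *\<^sub>v e)" "\<Upsilon>\<^sub>Y *\<^sub>v x = - (V *\<^sub>v e)"
      unfolding \<Upsilon>\<^sub>X_def \<Upsilon>\<^sub>Y_def using x by (auto simp: lin_simps Ex intro!: eq_vecI simp del: index_mult_mat_vec)
    show "(const_tf C * \<Phi> + const_tf D\<^sub>M * \<Upsilon>\<^sub>X - const_tf D\<^sub>N * \<Upsilon>\<^sub>Y) *\<^sub>v x = 0\<^sub>m p k *\<^sub>v x"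
    proof (rule eq_vecI)
      fix i assume "i < dim_vec (0\<^sub>m p k *\<^sub>v x)"
      then have i: "i < p" by simp
      have "vec_index e i = vec_index (const_tf C *\<^sub>v (R *\<^sub>v (const_tf B\<^sub>M *\<^sub>v (U *\<^sub>v e)))) i + vec_index (const_tf D\<^sub>M *\<^sub>v (U *\<^sub>v e)) i
          - (vec_index (const_tf C *\<^sub>v (R *\<^sub>v (const_tf B\<^sub>N *\<^sub>v (V *\<^sub>v e)))) i + vec_index (const_tf D\<^sub>N *\<^sub>v (V *\<^sub>v e)) i)"
        using arg_cong[OF inv[of e], of "\<lambda>u. vec_index u i"] i by (simp del: index_mult_mat_vec)
      then show "vec_index ((const_tf C * \<Phi> + const_tf D\<^sub>M * \<Upsilon>\<^sub>X - const_tf D\<^sub>N * \<Upsilon>\<^sub>Y) *\<^sub>v x) i = vec_index (0\<^sub>m p k *\<^sub>v x) i"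
        unfolding \<Phi>_def H_def using x i
        by (simp add: lin_simps \<Upsilon>x e_def[symmetric] del: index_mult_mat_vec)
    qed simp
  qed simp_all
  define W where "W = const_tf B\<^sub>M * U - const_tf B\<^sub>N * V"
  have W_RH: "W \<in> RH_inf k p"
    unfolding W_def
    by (intro RH_inf_add_minus(3) RH_inf_mult(1)[OF RH_inf_const(1)[OF B(1)] U]
        RH_inf_mult(1)[OF RH_inf_const(1)[OF B(2)] V])
  have [simp]: "dim_row W = k" "dim_col W = p" by (simp_all add: W_def)
  \<comment> \<open>The constant term of this identity is \<open>D R = I\<close> for the constant terms \<open>R\<close> of \<open>U\<close> and \<open>V\<close>, as \<open>P W / z\<close>
      has none.\<close>
  have feed: "const_tf C * (1 / z_var \<cdot>\<^sub>m (P * W)) + (const_tf D\<^sub>M * U - const_tf D\<^sub>N * V) = 1\<^sub>m p"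
  proof (rule mat_eqI_vec[of _ _ p])
    fix x :: "rfun vec" assume x: "dim_vec x = p"
    have PW: "(1 / z_var \<cdot>\<^sub>m (P * W)) *\<^sub>v x = R *\<^sub>v (W *\<^sub>v x)"
      unfolding R_P using x by (simp add: lin_simps)
    have "(const_tf C * (1 / z_var \<cdot>\<^sub>m (P * W)) + (const_tf D\<^sub>M * U - const_tf D\<^sub>N * V)) *\<^sub>v x
        = const_tf C *\<^sub>v (R *\<^sub>v (W *\<^sub>v x)) + (const_tf D\<^sub>M *\<^sub>v (U *\<^sub>v x) - const_tf D\<^sub>N *\<^sub>v (V *\<^sub>v x))"
      using x by (simp add: add_mat_mult_vec minus_mat_mult_vec mult_mat_mult_vec flip: PW)
    also have "\<dots> = const_tf C *\<^sub>v (R *\<^sub>v (const_tf B\<^sub>M *\<^sub>v (U *\<^sub>v x))) + const_tf D\<^sub>M *\<^sub>v (U *\<^sub>v x)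
      - (const_tf C *\<^sub>v (R *\<^sub>v (const_tf B\<^sub>N *\<^sub>v (V *\<^sub>v x))) + const_tf D\<^sub>N *\<^sub>v (V *\<^sub>v x))"
      unfolding W_def using x by (intro eq_vecI) (simp_all add: lin_simps del: index_mult_mat_vec)
    also have "\<dots> = 1\<^sub>m p *\<^sub>v x" using inv[OF x] x by (simp add: one_mat_mult_vec)
    finally show "(const_tf C * (1 / z_var \<cdot>\<^sub>m (P * W)) + (const_tf D\<^sub>M * U - const_tf D\<^sub>N * V)) *\<^sub>v x = 1\<^sub>m p *\<^sub>v x" .
  qed simp_all
  have "C * markov_mat (P * W) (0 - 1) + (D\<^sub>M * markov_mat U 0 - D\<^sub>N * markov_mat V 0) = 1\<^sub>m p"
    using arg_cong[OF feed, of "\<lambda>T. markov_mat T 0"]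
    by (simp add: markov_mat_add_minus markov_mat_const_mult markov_mat_div_z markov_mat_one del: diff_0)
  then have R0: "D\<^sub>M * markov_mat U 0 - D\<^sub>N * markov_mat V 0 = 1\<^sub>m p"
    using markov_mat_negative[OF RH_inf_mult(1)[OF P_RH W_RH], of "0 - 1"] C
      left_add_zero_mat[of "D\<^sub>M * markov_mat U 0 - D\<^sub>N * markov_mat V 0" p p]
    by (simp add: carrier_matI)
  show ?thesis
  proof (rule lmi_feasible[OF A B C D \<epsilon>, where \<Psi> = "\<lambda>n. markov_mat P (int n)" and \<Phi> = "\<lambda>n. markov_mat \<Phi> (int n)"
        and \<Upsilon>\<^sub>X = "\<lambda>n. markov_mat \<Upsilon>\<^sub>X (int n)" and \<Upsilon>\<^sub>Y = "\<lambda>n. markov_mat \<Upsilon>\<^sub>Y (int n)"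
        and R\<^sub>X = "markov_mat U 0" and R\<^sub>Y = "markov_mat V 0"])
    have P_n: "markov_mat P n = (if n = 0 then 1\<^sub>m k else 0\<^sub>m k k) + A * markov_mat P (n - 1)" for n
      by (subst P_eq) (simp add: markov_mat_add_minus markov_mat_div_z markov_mat_const_mult markov_mat_one)
    have \<Phi>_n: "markov_mat \<Phi> n = (if n = 0 then 1\<^sub>m k else 0\<^sub>m k k)
        + (A * markov_mat \<Phi> (n - 1) + (B\<^sub>M * markov_mat \<Upsilon>\<^sub>X (n - 1) - B\<^sub>N * markov_mat \<Upsilon>\<^sub>Y (n - 1)))" for n
      by (subst \<Phi>_eq) (simp add: H_def markov_mat_add_minus markov_mat_div_z markov_mat_const_mult markov_mat_one)
    show "markov_mat P (int 0) = 1\<^sub>m k"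
      using P_n[of 0] markov_mat_negative[OF P_RH, of "-1"] A by simp
    have "(1\<^sub>m k :: real mat) + (0\<^sub>m k k + (0\<^sub>m k k - 0\<^sub>m k k)) = 1\<^sub>m k" by (intro eq_matI) auto
    then show "markov_mat \<Phi> (int 0) = 1\<^sub>m k"
      using \<Phi>_n[of 0] markov_mat_negative[OF \<Phi>_RH, of "-1"] markov_mat_negative[OF \<Upsilon>_RH(1), of "-1"]
        markov_mat_negative[OF \<Upsilon>_RH(2), of "-1"] A B by simp
    show "markov_mat P (int (Suc n)) = A * markov_mat P (int n)" for n
      unfolding P_n[of "int (Suc n)"] by (intro eq_matI) simp_all
    show "markov_mat \<Phi> (int (Suc n)) = A * markov_mat \<Phi> (int n) + B\<^sub>M * markov_mat \<Upsilon>\<^sub>X (int n)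
        - B\<^sub>N * markov_mat \<Upsilon>\<^sub>Y (int n)" for n
      unfolding \<Phi>_n[of "int (Suc n)"] by (intro eq_matI) simp_all
    show "C * markov_mat \<Phi> (int n) + D\<^sub>M * markov_mat \<Upsilon>\<^sub>X (int n) - D\<^sub>N * markov_mat \<Upsilon>\<^sub>Y (int n) = 0\<^sub>m p k" for n
      using arg_cong[OF out, of "\<lambda>T. markov_mat T (int n)"]
      by (simp add: markov_mat_add_minus markov_mat_const_mult markov_mat_zero)
  qed (use R0 markov_mat_tendsto_0[OF P_RH] markov_mat_tendsto_0[OF \<Phi>_RH] in \<open>auto intro: carrier_matI\<close>)
qed

section \<open>The realization and the factorization in blocks\<close>

lemma diag_block_mult_vec:
  fixes M N :: "'a::comm_ring_1 mat"
  assumes "dim_vec v = dim_col M" "dim_vec w = dim_col N"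
  shows "four_block_mat M (0\<^sub>m (dim_row M) (dim_col N)) (0\<^sub>m (dim_row N) (dim_col M)) N *\<^sub>v (v @\<^sub>v w)
    = (M *\<^sub>v v) @\<^sub>v (N *\<^sub>v w)"
proof -
  have "four_block_mat M (0\<^sub>m (dim_row M) (dim_col N)) (0\<^sub>m (dim_row N) (dim_col M)) N *\<^sub>v (v @\<^sub>v w)
    = (M *\<^sub>v v + 0\<^sub>m (dim_row M) (dim_col N) *\<^sub>v w) @\<^sub>v (0\<^sub>m (dim_row N) (dim_col M) *\<^sub>v v + N *\<^sub>v w)"
    by (rule four_block_mat_mult_vec) (use assms in \<open>auto intro: carrier_vecI\<close>)
  also have "\<dots> = (M *\<^sub>v v) @\<^sub>v (N *\<^sub>v w)"
    using assms by (simp add: zero_mat_mult_vec) (auto intro!: eq_vecI simp del: index_mult_mat_vec)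
  finally show ?thesis .
qed

lemma diag_block_mat_Cons_mult_vec:
  fixes M :: "'a::comm_ring_1 mat"
  assumes "dim_vec v = dim_col M" "dim_vec w = dim_col (diag_block_mat Ms)"
  shows "diag_block_mat (M # Ms) *\<^sub>v (v @\<^sub>v w) = (M *\<^sub>v v) @\<^sub>v (diag_block_mat Ms *\<^sub>v w)"
  using diag_block_mult_vec[OF assms] by (simp add: Let_def)

text \<open>
  Both sides are applied to a stacked vector; equality of the results for all vectors gives the equality of
  the blocks.
\<close>

lemma realization_blocks:
  assumes U: "U \<in> carrier_mat k k" and W: "W \<in> carrier_mat k k" and Zi: "Zi \<in> carrier_mat k k"
    and Q: "Q \<in> carrier_mat k k" and F: "F \<in> carrier_mat k p" and L: "L\<^sub>X \<in> carrier_mat p k" "L\<^sub>Y \<in> carrier_mat m k"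
    and R: "R\<^sub>X \<in> carrier_mat p p" "R\<^sub>Y \<in> carrier_mat m p"
    and hat: "Ah \<in> carrier_mat k k" "Bh \<in> carrier_mat k p" "C\<^sub>X \<in> carrier_mat p k" "D\<^sub>X \<in> carrier_mat p p"
      "C\<^sub>Y \<in> carrier_mat m k" "D\<^sub>Y \<in> carrier_mat m p"
    and eq: "(Ah @\<^sub>c Bh) @\<^sub>r (C\<^sub>X @\<^sub>c D\<^sub>X) @\<^sub>r (C\<^sub>Y @\<^sub>c D\<^sub>Y) =
       diag_block_mat [U\<^sup>T * Zi, 1\<^sub>m p, 1\<^sub>m m] *
       ((Q @\<^sub>c F) @\<^sub>r (L\<^sub>X @\<^sub>c R\<^sub>X) @\<^sub>r (L\<^sub>Y @\<^sub>c R\<^sub>Y)) * (diag_block_mat [W, 1\<^sub>m p])\<^sup>T"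
  shows "Ah = U\<^sup>T * (Zi * (Q * W\<^sup>T))" "Bh = U\<^sup>T * (Zi * F)" "C\<^sub>X = L\<^sub>X * W\<^sup>T" "D\<^sub>X = R\<^sub>X"
    "C\<^sub>Y = L\<^sub>Y * W\<^sup>T" "D\<^sub>Y = (R\<^sub>Y :: real mat)"
proof -
  note [simp] = assms(1-15)[THEN carrier_matD(1)] assms(1-15)[THEN carrier_matD(2)]
  have left: "diag_block_mat [U\<^sup>T * Zi, 1\<^sub>m p, 1\<^sub>m m] *\<^sub>v (x @\<^sub>v y @\<^sub>v w) = (U\<^sup>T * Zi *\<^sub>v x) @\<^sub>v y @\<^sub>v w"
    if "dim_vec x = k" "dim_vec y = p" "dim_vec w = m" for x y w :: "real vec"
    using that by (simp add: diag_block_mat_Cons_mult_vec one_mat_mult_vec dim_diag_block_mat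
        del: diag_block_mat.simps)
  have right: "(diag_block_mat [W, 1\<^sub>m p])\<^sup>T *\<^sub>v (x @\<^sub>v w) = (W\<^sup>T *\<^sub>v x) @\<^sub>v w"
    if "dim_vec x = k" "dim_vec w = p" for x w :: "real vec"
  proof -
    have "(diag_block_mat [W, 1\<^sub>m p])\<^sup>T = four_block_mat (W\<^sup>T) (0\<^sub>m k p) (0\<^sub>m p k) (1\<^sub>m p)"
      unfolding diag_block_mat.simps(2)[of W] diag_block_mat_singleton Let_def
      using transpose_four_block_mat[OF W, of "0\<^sub>m k p" p "0\<^sub>m p k" p "1\<^sub>m p"] by simp
    then show ?thesis
      using diag_block_mult_vec[of x "W\<^sup>T" w "1\<^sub>m p"] that by (simp add: one_mat_mult_vec)
  qed
  have dims: "dim_col (diag_block_mat [U\<^sup>T * Zi, 1\<^sub>m p, 1\<^sub>m m]) = k + (p + m)"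
    "dim_row (diag_block_mat [W, 1\<^sub>m p]) = k + p" "dim_col (diag_block_mat [W, 1\<^sub>m p]) = k + p"
    by (simp_all add: dim_diag_block_mat)
  have comp: "Ah *\<^sub>v x + Bh *\<^sub>v w = U\<^sup>T *\<^sub>v (Zi *\<^sub>v (Q *\<^sub>v (W\<^sup>T *\<^sub>v x) + F *\<^sub>v w))"
    "C\<^sub>X *\<^sub>v x + D\<^sub>X *\<^sub>v w = L\<^sub>X *\<^sub>v (W\<^sup>T *\<^sub>v x) + R\<^sub>X *\<^sub>v w"
    "C\<^sub>Y *\<^sub>v x + D\<^sub>Y *\<^sub>v w = L\<^sub>Y *\<^sub>v (W\<^sup>T *\<^sub>v x) + R\<^sub>Y *\<^sub>v w"
    if [simp]: "dim_vec x = k" "dim_vec w = p" for x w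
  proof -
    have "(Ah *\<^sub>v x + Bh *\<^sub>v w) @\<^sub>v (C\<^sub>X *\<^sub>v x + D\<^sub>X *\<^sub>v w) @\<^sub>v (C\<^sub>Y *\<^sub>v x + D\<^sub>Y *\<^sub>v w)
        = ((Ah @\<^sub>c Bh) @\<^sub>r (C\<^sub>X @\<^sub>c D\<^sub>X) @\<^sub>r (C\<^sub>Y @\<^sub>c D\<^sub>Y)) *\<^sub>v (x @\<^sub>v w)"
      by (simp add: append_rows_mult_vec append_cols_mult_vec)
    also have "\<dots> = diag_block_mat [U\<^sup>T * Zi, 1\<^sub>m p, 1\<^sub>m m] *\<^sub>v
        (((Q @\<^sub>c F) @\<^sub>r (L\<^sub>X @\<^sub>c R\<^sub>X) @\<^sub>r (L\<^sub>Y @\<^sub>c R\<^sub>Y)) *\<^sub>v ((diag_block_mat [W, 1\<^sub>m p])\<^sup>T *\<^sub>v (x @\<^sub>v w)))"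
      unfolding eq by (simp add: mult_mat_mult_vec dims del: diag_block_mat.simps)
    also have "\<dots> = (U\<^sup>T * Zi *\<^sub>v (Q *\<^sub>v (W\<^sup>T *\<^sub>v x) + F *\<^sub>v w)) @\<^sub>v (L\<^sub>X *\<^sub>v (W\<^sup>T *\<^sub>v x) + R\<^sub>X *\<^sub>v w)
        @\<^sub>v (L\<^sub>Y *\<^sub>v (W\<^sup>T *\<^sub>v x) + R\<^sub>Y *\<^sub>v w)"
      unfolding right[OF that] by (simp add: append_rows_mult_vec append_cols_mult_vec left del: diag_block_mat.simps)
    finally have "(Ah *\<^sub>v x + Bh *\<^sub>v w) @\<^sub>v (C\<^sub>X *\<^sub>v x + D\<^sub>X *\<^sub>v w) @\<^sub>v (C\<^sub>Y *\<^sub>v x + D\<^sub>Y *\<^sub>v w)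
        = (U\<^sup>T * Zi *\<^sub>v (Q *\<^sub>v (W\<^sup>T *\<^sub>v x) + F *\<^sub>v w)) @\<^sub>v (L\<^sub>X *\<^sub>v (W\<^sup>T *\<^sub>v x) + R\<^sub>X *\<^sub>v w)
        @\<^sub>v (L\<^sub>Y *\<^sub>v (W\<^sup>T *\<^sub>v x) + R\<^sub>Y *\<^sub>v w)" .
    note 1 = append_vec_eq[THEN iffD1, OF _ _ this, of k]
    note 2 = append_vec_eq[THEN iffD1, OF _ _ 1[THEN conjunct2], of p]
    show "Ah *\<^sub>v x + Bh *\<^sub>v w = U\<^sup>T *\<^sub>v (Zi *\<^sub>v (Q *\<^sub>v (W\<^sup>T *\<^sub>v x) + F *\<^sub>v w))"
      "C\<^sub>X *\<^sub>v x + D\<^sub>X *\<^sub>v w = L\<^sub>X *\<^sub>v (W\<^sup>T *\<^sub>v x) + R\<^sub>X *\<^sub>v w"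
      "C\<^sub>Y *\<^sub>v x + D\<^sub>Y *\<^sub>v w = L\<^sub>Y *\<^sub>v (W\<^sup>T *\<^sub>v x) + R\<^sub>Y *\<^sub>v w"
      using 1 2 by (auto simp: mult_mat_mult_vec carrier_vecI)
  qed
  have add0: "u + 0\<^sub>v n = u" "0\<^sub>v n + u = u" if "dim_vec u = n" for u :: "real vec" and n
    using that by (auto intro!: eq_vecI)
  show "Ah = U\<^sup>T * (Zi * (Q * W\<^sup>T))"
    by (rule mat_eqI_vec[of _ _ k]) (use comp(1)[of _ "0\<^sub>v p"] in \<open>simp_all add: lin_simps add0\<close>)
  show "Bh = U\<^sup>T * (Zi * F)"
    by (rule mat_eqI_vec[of _ _ p]) (use comp(1)[of "0\<^sub>v k"] in \<open>simp_all add: lin_simps add0\<close>)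
  show "C\<^sub>X = L\<^sub>X * W\<^sup>T"
    by (rule mat_eqI_vec[of _ _ k]) (use comp(2)[of _ "0\<^sub>v p"] in \<open>simp_all add: lin_simps add0\<close>)
  show "D\<^sub>X = R\<^sub>X"
    by (rule mat_eqI_vec[of _ _ p]) (use comp(2)[of "0\<^sub>v k"] in \<open>simp_all add: lin_simps add0\<close>)
  show "C\<^sub>Y = L\<^sub>Y * W\<^sup>T"
    by (rule mat_eqI_vec[of _ _ k]) (use comp(3)[of _ "0\<^sub>v p"] in \<open>simp_all add: lin_simps add0\<close>)
  show "D\<^sub>Y = R\<^sub>Y"
    by (rule mat_eqI_vec[of _ _ p]) (use comp(3)[of "0\<^sub>v k"] in \<open>simp_all add: lin_simps add0\<close>)
qed

lemma doubly_coprime_Bezout: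
  assumes "doubly_coprime p m G Ul Vl Nl Ml Ur Vr Nr Mr"
  shows "Ml * Ur - Nl * Vr = 1\<^sub>m p"
proof -
  have c: "Ul \<in> carrier_mat m m" "Vl \<in> carrier_mat m p" "Nl \<in> carrier_mat p m" "Ml \<in> carrier_mat p p"
    "Ur \<in> carrier_mat p p" "Vr \<in> carrier_mat m p" "Nr \<in> carrier_mat p m" "Mr \<in> carrier_mat m m"
    and eq: "four_block_mat Ul (- Vl) (- Nl) Ml * four_block_mat Mr Vr Nr Ur = 1\<^sub>m (m + p)"
    using assms by (auto simp: doubly_coprime_def RH_inf_iff)
  have prod: "four_block_mat Ul (- Vl) (- Nl) Ml * four_block_mat Mr Vr Nr Ur =
    four_block_mat (Ul * Mr + - Vl * Nr) (Ul * Vr + - Vl * Ur) (- Nl * Mr + Ml * Nr) (- Nl * Vr + Ml * Ur)"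
    by (rule mult_four_block_mat) (use c in auto)
  show ?thesis
  proof (rule eq_matI)
    fix i j assume "i < dim_row (1\<^sub>m p :: rfun mat)" "j < dim_col (1\<^sub>m p :: rfun mat)"
    then have ij: "i < p" "j < p" by auto
    have "(- Nl * Vr + Ml * Ur) $$ (i, j) = (1\<^sub>m (m + p) :: rfun mat) $$ (m + i, m + j)"
      unfolding eq[symmetric] prod using ij c by (subst index_mat_four_block) auto
    also have "\<dots> = (1\<^sub>m p :: rfun mat) $$ (i, j)" using ij by auto
    finally show "(Ml * Ur - Nl * Vr) $$ (i, j) = (1\<^sub>m p :: rfun mat) $$ (i, j)"
      using ij c by simp
  qed (use c in auto)
qed

theorem theorem4:
  fixes p m n k :: nat and \<epsilon> :: real
    and Ap Bp Cp A B\<^sub>M B\<^sub>N C D\<^sub>M D\<^sub>N :: "real mat"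
    and G Ul Vl Nl Ml Ur Vr Nr Mr :: "rfun mat"
  assumes "0 < p" "0 < m"
    and "Ap \<in> carrier_mat n n" "Bp \<in> carrier_mat n m" "Cp \<in> carrier_mat p n"
    and "stabilizable Ap Bp" "detectable Cp Ap"
    and "G = ss_tf Ap Bp Cp (0\<^sub>m p m)"
    and "doubly_coprime p m G Ul Vl Nl Ml Ur Vr Nr Mr"
    and "A \<in> carrier_mat k k" "B\<^sub>M \<in> carrier_mat k p" "B\<^sub>N \<in> carrier_mat k m"
    and "C \<in> carrier_mat p k" "D\<^sub>M \<in> carrier_mat p p" "D\<^sub>N \<in> carrier_mat p m"
    and "schur_stable A"
    and "Ml = ss_tf A B\<^sub>M C D\<^sub>M" "Nl = ss_tf A B\<^sub>N C D\<^sub>N"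
    and "\<epsilon> > 0"
  shows
    "((\<exists>Xt \<in> RH_inf p p. \<exists>Yt \<in> RH_inf m p. Hinf_norm (Ml * Xt - Nl * Yt - 1\<^sub>m p) < \<epsilon>) \<longleftrightarrow>
      (\<exists>X Z Q F L\<^sub>X L\<^sub>Y R\<^sub>X R\<^sub>Y.
         lmi_holds k p m \<epsilon> A B\<^sub>M B\<^sub>N C D\<^sub>M D\<^sub>N X Z Q F L\<^sub>X L\<^sub>Y R\<^sub>X R\<^sub>Y)) \<and>
     (\<forall>X Z Q F L\<^sub>X L\<^sub>Y R\<^sub>X R\<^sub>Y.
        lmi_holds k p m \<epsilon> A B\<^sub>M B\<^sub>N C D\<^sub>M D\<^sub>N X Z Q F L\<^sub>X L\<^sub>Y R\<^sub>X R\<^sub>Y \<longrightarrow>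
        invertible_mat Z \<and>
        (\<forall>U \<in> carrier_mat k k. invertible_mat U \<longrightarrow>
          (\<forall>Ah \<in> carrier_mat k k. \<forall>Bh \<in> carrier_mat k p.
           \<forall>C\<^sub>X \<in> carrier_mat p k. \<forall>D\<^sub>X \<in> carrier_mat p p.
           \<forall>C\<^sub>Y \<in> carrier_mat m k. \<forall>D\<^sub>Y \<in> carrier_mat m p.
             (Ah @\<^sub>c Bh) @\<^sub>r (C\<^sub>X @\<^sub>c D\<^sub>X) @\<^sub>r (C\<^sub>Y @\<^sub>c D\<^sub>Y) =
               diag_block_mat [U\<^sup>T * mat_inv Z, 1\<^sub>m p, 1\<^sub>m m] *
               ((Q @\<^sub>c F) @\<^sub>r (L\<^sub>X @\<^sub>c R\<^sub>X) @\<^sub>r (L\<^sub>Y @\<^sub>c R\<^sub>Y)) *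
               (diag_block_mat [mat_inv U, 1\<^sub>m p])\<^sup>T \<longrightarrow>
             (let Xt = ss_tf Ah Bh C\<^sub>X D\<^sub>X; Yt = ss_tf Ah Bh C\<^sub>Y D\<^sub>Y in
                Xt \<in> RH_inf p p \<and> Yt \<in> RH_inf m p \<and>
                Hinf_norm (Ml * Xt - Nl * Yt - 1\<^sub>m p) < \<epsilon>))))"
proof -
  have carr: "A \<in> carrier_mat k k" "B\<^sub>M \<in> carrier_mat k p" "B\<^sub>N \<in> carrier_mat k m"
    "C \<in> carrier_mat p k" "D\<^sub>M \<in> carrier_mat p p" "D\<^sub>N \<in> carrier_mat p m" by fact+
  have realize: "Xt \<in> RH_inf p p \<and> Yt \<in> RH_inf m p \<and> Hinf_norm (Ml * Xt - Nl * Yt - 1\<^sub>m p) < \<epsilon>"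
    if lmi: "lmi_holds k p m \<epsilon> A B\<^sub>M B\<^sub>N C D\<^sub>M D\<^sub>N X Z Q F L\<^sub>X L\<^sub>Y R\<^sub>X R\<^sub>Y"
      and U: "U \<in> carrier_mat k k" "W \<in> carrier_mat k k" "U * W = 1\<^sub>m k"
      and Xt: "Xt = ss_tf (U\<^sup>T * (mat_inv Z * (Q * W\<^sup>T))) (U\<^sup>T * (mat_inv Z * F)) (L\<^sub>X * W\<^sup>T) R\<^sub>X"
      and Yt: "Yt = ss_tf (U\<^sup>T * (mat_inv Z * (Q * W\<^sup>T))) (U\<^sup>T * (mat_inv Z * F)) (L\<^sub>Y * W\<^sup>T) R\<^sub>Y"
    for X Z Q F L\<^sub>X L\<^sub>Y R\<^sub>X R\<^sub>Y U W Xt Yt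
  proof -
    interpret lmi_variables k p m \<epsilon> A B\<^sub>M B\<^sub>N C D\<^sub>M D\<^sub>N X Z Q F L\<^sub>X L\<^sub>Y R\<^sub>X R\<^sub>Y
      using lmi carr by unfold_locales (auto simp: lmi_holds_def sym_mat_def)
    have pd: "pos_def lmi" using lmi by (simp add: lmi_holds_def)
    show ?thesis
      using lmi_sufficient[OF pd \<open>\<epsilon> > 0\<close> \<open>0 < p\<close> \<open>schur_stable A\<close> U refl refl refl refl]
      unfolding Xt Yt \<open>Ml = ss_tf A B\<^sub>M C D\<^sub>M\<close> \<open>Nl = ss_tf A B\<^sub>N C D\<^sub>N\<close> by blast
  qed
  have Z_inv: "invertible_mat Z" "mat_inv Z \<in> carrier_mat k k"
    if lmi: "lmi_holds k p m \<epsilon> A B\<^sub>M B\<^sub>N C D\<^sub>M D\<^sub>N X Z Q F L\<^sub>X L\<^sub>Y R\<^sub>X R\<^sub>Y" for X Z Q F L\<^sub>X L\<^sub>Y R\<^sub>X R\<^sub>Y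
  proof -
    interpret lmi_variables k p m \<epsilon> A B\<^sub>M B\<^sub>N C D\<^sub>M D\<^sub>N X Z Q F L\<^sub>X L\<^sub>Y R\<^sub>X R\<^sub>Y
      using lmi carr by unfold_locales (auto simp: lmi_holds_def sym_mat_def)
    have pd: "pos_def lmi" using lmi by (simp add: lmi_holds_def)
    show "invertible_mat Z" "mat_inv Z \<in> carrier_mat k k" using Z_invertible[OF pd] by auto
  qed
  have feasible: "\<exists>X Z Q F L\<^sub>X L\<^sub>Y R\<^sub>X R\<^sub>Y. lmi_holds k p m \<epsilon> A B\<^sub>M B\<^sub>N C D\<^sub>M D\<^sub>N X Z Q F L\<^sub>X L\<^sub>Y R\<^sub>X R\<^sub>Y"
  proof (rule right_inverse_imp_lmi_feasible[OF carr(1) \<open>schur_stable A\<close> carr(2-6)])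
    show "Ur \<in> RH_inf p p" "Vr \<in> RH_inf m p"
      using \<open>doubly_coprime p m G Ul Vl Nl Ml Ur Vr Nr Mr\<close> by (auto simp: doubly_coprime_def)
    show "ss_tf A B\<^sub>M C D\<^sub>M * Ur - ss_tf A B\<^sub>N C D\<^sub>N * Vr = 1\<^sub>m p"
      using doubly_coprime_Bezout[OF \<open>doubly_coprime p m G Ul Vl Nl Ml Ur Vr Nr Mr\<close>]
      unfolding \<open>Ml = ss_tf A B\<^sub>M C D\<^sub>M\<close> \<open>Nl = ss_tf A B\<^sub>N C D\<^sub>N\<close> .
  qed (rule \<open>\<epsilon> > 0\<close>)
  then obtain X\<^sub>0 Z\<^sub>0 Q\<^sub>0 F\<^sub>0 L\<^sub>X\<^sub>0 L\<^sub>Y\<^sub>0 R\<^sub>X\<^sub>0 R\<^sub>Y\<^sub>0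
    where "lmi_holds k p m \<epsilon> A B\<^sub>M B\<^sub>N C D\<^sub>M D\<^sub>N X\<^sub>0 Z\<^sub>0 Q\<^sub>0 F\<^sub>0 L\<^sub>X\<^sub>0 L\<^sub>Y\<^sub>0 R\<^sub>X\<^sub>0 R\<^sub>Y\<^sub>0" by blast
  then have exists: "\<exists>Xt \<in> RH_inf p p. \<exists>Yt \<in> RH_inf m p. Hinf_norm (Ml * Xt - Nl * Yt - 1\<^sub>m p) < \<epsilon>"
    using realize[of X\<^sub>0 Z\<^sub>0 Q\<^sub>0 F\<^sub>0 L\<^sub>X\<^sub>0 L\<^sub>Y\<^sub>0 R\<^sub>X\<^sub>0 R\<^sub>Y\<^sub>0 "1\<^sub>m k" "1\<^sub>m k"] by auto
  show ?thesis
  proof (intro conjI allI impI iffI ballI)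
    fix X Z Q F L\<^sub>X L\<^sub>Y R\<^sub>X R\<^sub>Y
    assume lmi: "lmi_holds k p m \<epsilon> A B\<^sub>M B\<^sub>N C D\<^sub>M D\<^sub>N X Z Q F L\<^sub>X L\<^sub>Y R\<^sub>X R\<^sub>Y"
    show "invertible_mat Z" by (rule Z_inv[OF lmi])
    fix U Ah Bh C\<^sub>X D\<^sub>X C\<^sub>Y D\<^sub>Y
    assume U: "U \<in> carrier_mat k k" "invertible_mat U"
      and hat: "Ah \<in> carrier_mat k k" "Bh \<in> carrier_mat k p" "C\<^sub>X \<in> carrier_mat p k" "D\<^sub>X \<in> carrier_mat p p"
        "C\<^sub>Y \<in> carrier_mat m k" "D\<^sub>Y \<in> carrier_mat m p"
      and eq: "(Ah @\<^sub>c Bh) @\<^sub>r (C\<^sub>X @\<^sub>c D\<^sub>X) @\<^sub>r (C\<^sub>Y @\<^sub>c D\<^sub>Y) =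
               diag_block_mat [U\<^sup>T * mat_inv Z, 1\<^sub>m p, 1\<^sub>m m] *
               ((Q @\<^sub>c F) @\<^sub>r (L\<^sub>X @\<^sub>c R\<^sub>X) @\<^sub>r (L\<^sub>Y @\<^sub>c R\<^sub>Y)) *
               (diag_block_mat [mat_inv U, 1\<^sub>m p])\<^sup>T"
    note Ui = mat_inv_invertible[OF U]
    have vars: "Q \<in> carrier_mat k k" "F \<in> carrier_mat k p" "L\<^sub>X \<in> carrier_mat p k" "L\<^sub>Y \<in> carrier_mat m k"
      "R\<^sub>X \<in> carrier_mat p p" "R\<^sub>Y \<in> carrier_mat m p"
      using lmi by (auto simp: lmi_holds_def)
    note blocks = realization_blocks[OF U(1) Ui(1) Z_inv(2)[OF lmi] vars hat eq]
    show "let Xt = ss_tf Ah Bh C\<^sub>X D\<^sub>X; Yt = ss_tf Ah Bh C\<^sub>Y D\<^sub>Y in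
        Xt \<in> RH_inf p p \<and> Yt \<in> RH_inf m p \<and> Hinf_norm (Ml * Xt - Nl * Yt - 1\<^sub>m p) < \<epsilon>"
      unfolding Let_def by (rule realize[OF lmi U(1) Ui(1,2)]) (simp_all only: blocks)
  qed (rule feasible, rule exists)
qed

end
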